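(* Let $d,r\in\mathbb{N}$ and let $\sigma\in C^r(\mathbb{R})$ be $r$-finite. Let $U=U_p\times U_q\subseteq\mathbb{R}^{2d}$ be open and $H(p,q,t)=K(p,t)+V(q,t)$ with $K\in C^{r+1}(U_p\times\mathbb{R})$, $V\in C^{r+1}(U_q\times\mathbb{R})$. Let $\Phi(h,t_0,x_0)$ denote the solution at time $t_0+h$ of $\dot x=J^{-1}\nabla_xH(x,t)$, $x(t_0)=x_0$, assumed to exist in $U$ for all $h,t_0\ge0$, $x_0\in U$. Then for every $T>0$, compact $W_t\subseteq[0,\infty)$, compact $W\subseteq U$ and $\epsilon>0$ there is an NATG-SympNet $\psi$ such that, writing $\psi_x(h,t,x)\in\mathbb{R}^{2d}$ for its phase-space component, $$\|\Phi-\psi_x\|_{C^r([0,T]\times W_t\times W;\mathbb{R}^{2d})}<\epsilon.$$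
   Context: $J=\begin{pmatrix}0&I_d\\-I_d&0\end{pmatrix}$. $\sigma$ is $r$-finite if $0<\int_\mathbb{R}|\sigma^{(r)}(x)|\,dx<\infty$; applied componentwise. For width $n$, $K_0\in\mathbb{R}^{n\times d}$, $a,b,c\in\mathbb{R}^n$ let $\hat\sigma(y,t)=K_0^T\operatorname{diag}(a)\sigma(K_0y+ct+b)$. For $m\in\mathbb{N}$ the non-autonomous gradient modules are $u^{(m)}_{up}(h,t,(p,q))=\big(t+\tfrac hm,\ (p+h\hat\sigma(q,t),\,q)\big)$ and $u^{(m)}_{low}(h,t,(p,q))=\big(t+\tfrac hm,\ (p,\,q+h\hat\sigma(p,t))\big)$. An NATG-SympNet is any map $\psi(h,t,x)=(u_m(h,\cdot,\cdot)\circ\dots\circ u_1(h,\cdot,\cdot))(t,x)$ with $m\in\mathbb{N}$ and each $u_j$ an upper or lower module of this form with the same $m$ (each with its own parameters); its output is $(t+h,\psi_x(h,t,x))$. Norm: sum over all partial derivatives of order $\le r$ in $(h,t,x)$ of the sup over the domain of the maximal component. *)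

theory Defs
  imports "HOL-Analysis.Analysis"
begin

text \<open>C^0 = continuous; C^(k+1) = differentiable with all first-order partial
  derivatives (along the standard basis) in C^k.  Intended for open sets S.\<close>
fun Ck_on :: "nat \<Rightarrow> 'a::euclidean_space set \<Rightarrow> ('a \<Rightarrow> 'b::real_normed_vector) \<Rightarrow> bool" where
  "Ck_on 0 S f = continuous_on S f"
| "Ck_on (Suc k) S f =
     (f differentiable_on S \<and> (\<forall>b\<in>Basis. Ck_on k S (\<lambda>x. frechet_derivative f (at x) b)))"

definition r_finite :: "nat \<Rightarrow> (real \<Rightarrow> real) \<Rightarrow> bool" where
  "r_finite r \<sigma> \<longleftrightarrow>
     (\<lambda>x. \<bar>(deriv ^^ r) \<sigma> x\<bar>) integrable_on UNIV \<and>
     0 < integral UNIV (\<lambda>x. \<bar>(deriv ^^ r) \<sigma> x\<bar>)"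

text \<open>Phase space R^(2d) = R^d x R^d, x = (p,q).\<close>
type_synonym 'd phase = "(real^'d) \<times> (real^'d)"

definition grad :: "('a::euclidean_space \<Rightarrow> real) \<Rightarrow> 'a \<Rightarrow> 'a" where
  "grad f x = (\<Sum>b\<in>Basis. frechet_derivative f (at x) b *\<^sub>R b)"

text \<open>J = [[0, I],[-I, 0]] acting on (p,q), and its inverse.\<close>
definition symplJ :: "('d::finite) phase \<Rightarrow> 'd phase" where
  "symplJ x = (snd x, - fst x)"

definition symplJ_inv :: "('d::finite) phase \<Rightarrow> 'd phase" where
  "symplJ_inv x = (- snd x, fst x)"

lemma symplJ_inv_inverse: "symplJ_inv (symplJ x) = x" "symplJ (symplJ_inv x) = x"
  by (auto simp: symplJ_def symplJ_inv_def)

definition Ham :: "(real^('d::finite) \<Rightarrow> real \<Rightarrow> real) \<Rightarrow> (real^'d \<Rightarrow> real \<Rightarrow> real) \<Rightarrow> 'd phase \<Rightarrow> real \<Rightarrow> real" where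
  "Ham K V x t = K (fst x) t + V (snd x) t"

definition ham_sol :: "(real^('d::finite) \<Rightarrow> real \<Rightarrow> real) \<Rightarrow> (real^'d \<Rightarrow> real \<Rightarrow> real) \<Rightarrow> 'd phase set
     \<Rightarrow> real \<Rightarrow> 'd phase \<Rightarrow> (real \<Rightarrow> 'd phase) \<Rightarrow> bool" where
  "ham_sol K V U t0 x0 \<gamma> \<longleftrightarrow>
     \<gamma> 0 = x0 \<and>
     (\<forall>h\<ge>0. \<gamma> h \<in> U \<and>
        (\<gamma> has_vector_derivative symplJ_inv (grad (\<lambda>y. Ham K V y (t0 + h)) (\<gamma> h)))
          (at h within {0..}))"

text \<open>A gradient module: upper/lower flag, width n, K0 (n x d, row i entry j = K0 i j),
  a, b, c in R^n (only indices i < n matter).\<close>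
datatype 'd gmod = GMod bool nat "nat \<Rightarrow> 'd \<Rightarrow> real" "nat \<Rightarrow> real" "nat \<Rightarrow> real" "nat \<Rightarrow> real"

text \<open>sigma_hat(y,t) = K0^T diag(a) sigma(K0 y + c t + b).\<close>
fun sigma_hat :: "(real \<Rightarrow> real) \<Rightarrow> ('d::finite) gmod \<Rightarrow> real^'d \<Rightarrow> real \<Rightarrow> real^'d" where
  "sigma_hat \<sigma> (GMod up n K0 a b c) y t =
     (\<chi> j. \<Sum>i<n. K0 i j * a i * \<sigma> ((\<Sum>k\<in>UNIV. K0 i k * y $ k) + c i * t + b i))"

fun gmod_is_upper :: "'d gmod \<Rightarrow> bool" where
  "gmod_is_upper (GMod up n K0 a b c) = up"

definition apply_gmod :: "(real \<Rightarrow> real) \<Rightarrow> nat \<Rightarrow> ('d::finite) gmod \<Rightarrow> real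
     \<Rightarrow> real \<times> 'd phase \<Rightarrow> real \<times> 'd phase" where
  "apply_gmod \<sigma> m md h z =
     (case z of (t, (p, q)) \<Rightarrow>
       (t + h / real m,
        if gmod_is_upper md then (p + h *\<^sub>R sigma_hat \<sigma> md q t, q)
        else (p, q + h *\<^sub>R sigma_hat \<sigma> md p t)))"

text \<open>NATG-SympNet given by the nonempty list of modules [u_1, ..., u_m] (u_1 applied first),
  m = length of the list; returns (t+h, psi_x(h,t,x)).\<close>
definition natg :: "(real \<Rightarrow> real) \<Rightarrow> ('d::finite) gmod list \<Rightarrow> real \<Rightarrow> real \<Rightarrow> 'd phase
     \<Rightarrow> real \<times> 'd phase" where
  "natg \<sigma> mods h t x = fold (\<lambda>md z. apply_gmod \<sigma> (length mods) md h z) mods (t, x)"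

definition natg_x :: "(real \<Rightarrow> real) \<Rightarrow> ('d::finite) gmod list \<Rightarrow> real \<Rightarrow> real \<Rightarrow> 'd phase \<Rightarrow> 'd phase" where
  "natg_x \<sigma> mods h t x = snd (natg \<sigma> mods h t x)"

definition pd :: "'a::euclidean_space set \<Rightarrow> 'a \<Rightarrow> ('a \<Rightarrow> 'b::real_normed_vector) \<Rightarrow> 'a \<Rightarrow> 'b" where
  "pd \<Omega> e F = (\<lambda>z. frechet_derivative F (at z within \<Omega>) e)"

fun pdl :: "'a::euclidean_space set \<Rightarrow> 'a list \<Rightarrow> ('a \<Rightarrow> 'b::real_normed_vector) \<Rightarrow> 'a \<Rightarrow> 'b" where
  "pdl \<Omega> [] F = F"
| "pdl \<Omega> (e # L) F = pd \<Omega> e (pdl \<Omega> L F)"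

definition sup_maxcomp :: "'a set \<Rightarrow> ('a \<Rightarrow> 'b::euclidean_space) \<Rightarrow> real" where
  "sup_maxcomp D G = (if D = {} then 0 else (SUP z\<in>D. Max ((\<lambda>b. \<bar>G z \<bullet> b\<bar>) ` Basis)))"

text \<open>C^r norm on D: sum over all partial derivatives (all sequences of coordinate directions)
  of order \<le> r, derivatives taken within Omega \<supseteq> D.\<close>
definition cr_norm :: "nat \<Rightarrow> 'a::euclidean_space set \<Rightarrow> 'a set \<Rightarrow> ('a \<Rightarrow> 'b::euclidean_space) \<Rightarrow> real" where
  "cr_norm r \<Omega> D F = (\<Sum>L\<in>{L. set L \<subseteq> Basis \<and> length L \<le> r}. sup_maxcomp D (pdl \<Omega> L F))"

end

theory Submission
  imports Defs "HOL-Complex_Analysis.Great_Picard"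
begin

text \<open>
  With the step size \<open>h\<close> treated as a state variable, \<open>n\<close> alternating pairs of modules are \<open>n\<close> steps of
  an explicit one-step method of step size \<open>1/n\<close> for the time-one flow of the autonomous field
  \<open>(0, h, h f(x, t))\<close> in the variables \<open>(h, t, x)\<close>. If the module fields converge to the Hamiltonian
  field in \<open>C^r\<close> on compact sets, the method converges to the flow in \<open>C^r\<close>: in \<open>C^0\<close> by
  Arzela-Ascoli and uniqueness of solutions (this also covers \<open>r = 0\<close>, where the field need not be
  Lipschitz), and then order by order, because each new derivative satisfies a linear recursion whose
  coefficients already converge. Differentiability of the flow is a by-product.

  The module fields are gradients of ridge sums of an antiderivative \<open>S\<close> of \<open>\<sigma>\<close>, so it remains to
  approximate \<open>C^(r+1)\<close> functions by such sums. Averaging \<open>S\<close> over unit intervals stays in the closure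
  and raises smoothness; the top derivatives are iterated differences of \<open>\<sigma>^(r)\<close>, which do not vanish
  identically since a continuous integrable periodic function is zero. Differentiating a smooth ridge
  function with respect to its weights therefore produces all monomials, and convolution with the
  kernels \<open>(1 - |y|^2/R^2)^n\<close> approximates compactly supported functions by polynomials in \<open>C^(r+1)\<close>.
\<close>

section \<open>Continuous convergence of partial derivatives\<close>

text \<open>The norm counts derivatives in h and t as well as in x. Carrying h and t as state
  variables turns all of them into derivatives with respect to the initial value of a single scheme
  on the fixed interval [0,1].

  The flow is meaningful only for h, t \<ge> 0, so its derivatives on the faces of the quadrant are
  one-sided, whereas the networks are differentiable on the whole space. Convergence is therefore
  formulated for sequences of globally differentiable functions whose limits are taken on a set
  within which derivatives are unique.

  The induction on the order of differentiation needs the coefficients along the entire trajectory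
  and not just at its end point. This is why convergence is proved for the double array of all
  iterates k \<le> n, with k/n tending to an arbitrary s in [0,1].

  On the approximation side an antiderivative of \<open>\<sigma>\<close> is only known to be of
  class C^(r+1), which leaves no room to differentiate its ridge functions in the weights within the
  C^(r+1) topology; each averaging supplies one missing order.\<close>

lemma pd_eq:
  assumes "(f has_derivative f') (at z)"
  shows "pd UNIV b f z = f' b"
  unfolding pd_def using frechet_derivative_at[OF assms] by simp

lemma has_derivative_pd:
  assumes "f differentiable (at z)"
  shows "(f has_derivative (\<lambda>v. pd UNIV v f z)) (at z)"
  unfolding pd_def using assms frechet_derivative_works by blast

lemma pd_add:
  assumes "f differentiable (at z)" "g differentiable (at z)"
  shows "pd UNIV b (\<lambda>z. f z + g z) z = pd UNIV b f z + pd UNIV b g z"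
  by (rule pd_eq[OF has_derivative_add[OF has_derivative_pd[OF assms(1)] has_derivative_pd[OF assms(2)]]])

lemma pd_linear:
  assumes "bounded_linear L" "f differentiable (at z)"
  shows "pd UNIV b (\<lambda>z. L (f z)) z = L (pd UNIV b f z)"
  by (rule pd_eq[OF bounded_linear.has_derivative[OF assms(1) has_derivative_pd[OF assms(2)]]])

lemma pd_const: "pd UNIV b (\<lambda>z. c) z = 0"
  by (rule pd_eq[OF has_derivative_const])

lemma pd_bilinear:
  assumes "bounded_bilinear pr" "f differentiable (at z)" "g differentiable (at z)"
  shows "pd UNIV b (\<lambda>z. pr (f z) (g z)) z = pr (f z) (pd UNIV b g z) + pr (pd UNIV b f z) (g z)"
  by (rule pd_eq[OF bounded_bilinear.FDERIV[OF assms(1) has_derivative_pd[OF assms(2)] has_derivative_pd[OF assms(3)]]])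

lemma differentiable_bilinear:
  assumes "bounded_bilinear pr" "f differentiable (at z)" "g differentiable (at z)"
  shows "(\<lambda>z. pr (f z) (g z)) differentiable (at z)"
  using assms(2,3) bounded_bilinear.FDERIV[OF assms(1)] unfolding differentiable_def by blast

lemma differentiable_linear:
  assumes "bounded_linear L" "f differentiable (at z)"
  shows "(\<lambda>z. L (f z)) differentiable (at z)"
  using assms(2) bounded_linear.has_derivative[OF assms(1)] unfolding differentiable_def by blast

lemma pd_basis_expansion:
  fixes f :: "'a::euclidean_space \<Rightarrow> 'b::real_normed_vector"
  assumes "f differentiable (at z)"
  shows "pd UNIV v f z = (\<Sum>c\<in>Basis. (v \<bullet> c) *\<^sub>R pd UNIV c f z)"
proof -
  have "linear (\<lambda>v. pd UNIV v f z)"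
    using has_derivative_pd[OF assms] has_derivative_linear by blast
  from linear_sum[OF this, of "\<lambda>c. (v \<bullet> c) *\<^sub>R c" Basis] linear_scale[OF this]
  have "pd UNIV (\<Sum>c\<in>Basis. (v \<bullet> c) *\<^sub>R c) f z = (\<Sum>c\<in>Basis. (v \<bullet> c) *\<^sub>R pd UNIV c f z)"
    by simp
  then show ?thesis by (simp add: euclidean_representation)
qed

lemma has_derivative_chain_pd:
  assumes "g differentiable (at (f z))" "f differentiable (at z)"
  shows "((\<lambda>z. g (f z)) has_derivative (\<lambda>v. pd UNIV (pd UNIV v f z) g (f z))) (at z)"
  using has_derivative_compose[OF has_derivative_pd[OF assms(2)] has_derivative_pd[OF assms(1)]] .

lemma pd_chain:
  fixes f :: "'a::euclidean_space \<Rightarrow> 'b::euclidean_space" and g :: "'b \<Rightarrow> 'c::real_normed_vector"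
  assumes "g differentiable (at (f z))" "f differentiable (at z)"
  shows "pd UNIV b (\<lambda>z. g (f z)) z = (\<Sum>c\<in>Basis. (pd UNIV b f z \<bullet> c) *\<^sub>R pd UNIV c g (f z))"
  using pd_eq[OF has_derivative_chain_pd[OF assms]] pd_basis_expansion[OF assms(1)] by metis

text \<open>Along the filter \<open>sequentially \<times> nhds w\<close> this is continuous convergence at \<open>w\<close>, which makes sums,
  products and compositions plain limit arithmetic and still yields uniform convergence on compact sets.\<close>
fun Ck_conv :: "nat \<Rightarrow> ('i \<times> 'a::euclidean_space) filter set \<Rightarrow> ('i \<Rightarrow> 'a \<Rightarrow> 'b::real_normed_vector) \<Rightarrow> bool" where
  "Ck_conv 0 \<F> Y = (\<forall>F\<in>\<F>. \<exists>l. ((\<lambda>(i, z). Y i z) \<longlongrightarrow> l) F)"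
| "Ck_conv (Suc j) \<F> Y = ((\<forall>F\<in>\<F>. \<exists>l. ((\<lambda>(i, z). Y i z) \<longlongrightarrow> l) F) \<and>
     (\<forall>i z. Y i differentiable (at z)) \<and> (\<forall>b\<in>Basis. Ck_conv j \<F> (\<lambda>i. pd UNIV b (Y i))))"

lemma Ck_conv_lim:
  assumes "Ck_conv j \<F> Y" "F \<in> \<F>"
  obtains l where "((\<lambda>(i, z). Y i z) \<longlongrightarrow> l) F"
  using assms by (cases j) auto

lemma Ck_conv_SucD: "Ck_conv (Suc j) \<F> Y \<Longrightarrow> Ck_conv j \<F> Y"
proof (induction j arbitrary: Y)
  case 0 then show ?case by simp
next
  case (Suc j)
  then show ?case by (subst Ck_conv.simps) (auto simp del: Ck_conv.simps(1) dest: Ck_conv.simps(2)[THEN iffD1])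
qed

lemma Ck_conv_le: "i \<le> j \<Longrightarrow> Ck_conv j \<F> Y \<Longrightarrow> Ck_conv i \<F> Y"
  by (induction rule: inc_induct) (auto intro: Ck_conv_SucD simp del: Ck_conv.simps)

lemma Ck_conv_differentiable: "Ck_conv (Suc j) \<F> Y \<Longrightarrow> Y i differentiable (at z)"
  by simp

lemma Ck_conv_pd: "Ck_conv (Suc j) \<F> Y \<Longrightarrow> b \<in> Basis \<Longrightarrow> Ck_conv j \<F> (\<lambda>i. pd UNIV b (Y i))"
  by simp

lemma Ck_conv_SucI:
  assumes "Ck_conv 0 \<F> Y" "\<And>i z. Y i differentiable (at z)"
    "\<And>b. b \<in> Basis \<Longrightarrow> Ck_conv j \<F> (\<lambda>i. pd UNIV b (Y i))"
  shows "Ck_conv (Suc j) \<F> Y"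
  using assms by simp

declare Ck_conv.simps [simp del]

lemma Ck_conv_0I: "(\<And>F. F \<in> \<F> \<Longrightarrow> \<exists>l. ((\<lambda>(i, z). Y i z) \<longlongrightarrow> l) F) \<Longrightarrow> Ck_conv 0 \<F> Y"
  by (simp add: Ck_conv.simps)

lemma Ck_conv_const: "Ck_conv j \<F> (\<lambda>i (z::'a::euclidean_space). c)"
proof (induction j arbitrary: c)
  case 0 show ?case by (rule Ck_conv_0I) (auto simp: case_prod_unfold)
next
  case (Suc j)
  have "pd UNIV b (\<lambda>z. c) = (\<lambda>z. 0)" for b :: 'a using pd_const by blast
  then show ?case
    by (intro Ck_conv_SucI) (auto simp: Suc intro!: Ck_conv_le[OF _ Suc])
qed

lemma Ck_conv_add:
  fixes X Y :: "'i \<Rightarrow> 'a::euclidean_space \<Rightarrow> _"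
  assumes "Ck_conv j \<F> X" "Ck_conv j \<F> Y"
  shows "Ck_conv j \<F> (\<lambda>i z. X i z + Y i z)"
  using assms
proof (induction j arbitrary: X Y)
  case 0 show ?case
  proof (rule Ck_conv_0I)
    fix F assume F: "F \<in> \<F>"
    obtain l l' where "((\<lambda>(i, z). X i z) \<longlongrightarrow> l) F" "((\<lambda>(i, z). Y i z) \<longlongrightarrow> l') F"
      using Ck_conv_lim[OF 0(1) F] Ck_conv_lim[OF 0(2) F] by metis
    from tendsto_add[OF this] show "\<exists>l. ((\<lambda>(i, z). X i z + Y i z) \<longlongrightarrow> l) F"
      by (auto simp: case_prod_unfold)
  qed
next
  case (Suc j)
  note d = Ck_conv_differentiable[OF Suc(2)] Ck_conv_differentiable[OF Suc(3)]
  show ?case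
  proof (rule Ck_conv_SucI)
    show "Ck_conv 0 \<F> (\<lambda>i z. X i z + Y i z)"
      by (rule Ck_conv_le[OF _ Suc(1)[OF Suc(2,3)[THEN Ck_conv_SucD]]]) simp
    show "(\<lambda>z. X i z + Y i z) differentiable at z" for i z using d by simp
    fix b :: 'a assume b: "b \<in> Basis"
    have "(\<lambda>i. pd UNIV b (\<lambda>z. X i z + Y i z)) = (\<lambda>i z. pd UNIV b (X i) z + pd UNIV b (Y i) z)"
      by (intro ext pd_add d)
    then show "Ck_conv j \<F> (\<lambda>i. pd UNIV b (\<lambda>z. X i z + Y i z))"
      using Suc(1)[OF Suc(2,3)[THEN Ck_conv_pd, OF b]] by simp
  qed
qed

lemma Ck_conv_bilinear:
  fixes X :: "'i \<Rightarrow> 'a::euclidean_space \<Rightarrow> _" and Y :: "'i \<Rightarrow> 'a \<Rightarrow> _"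
  assumes pr: "bounded_bilinear pr" and "Ck_conv j \<F> X" "Ck_conv j \<F> Y"
  shows "Ck_conv j \<F> (\<lambda>i z. pr (X i z) (Y i z))"
  using assms(2-)
proof (induction j arbitrary: X Y)
  case 0 show ?case
  proof (rule Ck_conv_0I)
    fix F assume F: "F \<in> \<F>"
    obtain l l' where "((\<lambda>(i, z). X i z) \<longlongrightarrow> l) F" "((\<lambda>(i, z). Y i z) \<longlongrightarrow> l') F"
      using Ck_conv_lim[OF 0(1) F] Ck_conv_lim[OF 0(2) F] by metis
    from bounded_bilinear.tendsto[OF pr this] show "\<exists>l. ((\<lambda>(i, z). pr (X i z) (Y i z)) \<longlongrightarrow> l) F"
      by (auto simp: case_prod_unfold)
  qed
next
  case (Suc j)
  note d = Ck_conv_differentiable[OF Suc(2)] Ck_conv_differentiable[OF Suc(3)]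
  show ?case
  proof (rule Ck_conv_SucI)
    show "Ck_conv 0 \<F> (\<lambda>i z. pr (X i z) (Y i z))"
      by (rule Ck_conv_le[OF _ Suc(1)[OF Suc(2,3)[THEN Ck_conv_SucD]]]) simp
    show "(\<lambda>z. pr (X i z) (Y i z)) differentiable at z" for i z
      by (rule differentiable_bilinear[OF pr d])
    fix b :: 'a assume b: "b \<in> Basis"
    have "(\<lambda>i. pd UNIV b (\<lambda>z. pr (X i z) (Y i z))) =
       (\<lambda>i z. pr (X i z) (pd UNIV b (Y i) z) + pr (pd UNIV b (X i) z) (Y i z))"
      by (intro ext pd_bilinear pr d)
    then show "Ck_conv j \<F> (\<lambda>i. pd UNIV b (\<lambda>z. pr (X i z) (Y i z)))"
      using Ck_conv_add[OF Suc(1)[OF Suc(2)[THEN Ck_conv_SucD] Suc(3)[THEN Ck_conv_pd, OF b]]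
         Suc(1)[OF Suc(2)[THEN Ck_conv_pd, OF b] Suc(3)[THEN Ck_conv_SucD]]] by simp
  qed
qed

lemmas Ck_conv_scaleR = Ck_conv_bilinear[OF bounded_bilinear_scaleR]
lemmas Ck_conv_mult = Ck_conv_bilinear[OF bounded_bilinear_mult]

lemma Ck_conv_linear:
  fixes X :: "'i \<Rightarrow> 'a::euclidean_space \<Rightarrow> _"
  assumes "bounded_linear L" "Ck_conv j \<F> X"
  shows "Ck_conv j \<F> (\<lambda>i z. L (X i z))"
  using assms(2-)
proof (induction j arbitrary: X)
  case 0 show ?case
  proof (rule Ck_conv_0I)
    fix F assume F: "F \<in> \<F>"
    obtain l where "((\<lambda>(i, z). X i z) \<longlongrightarrow> l) F"
      using Ck_conv_lim[OF 0(1) F] by metis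
    from bounded_linear.tendsto[OF assms(1) this] show "\<exists>l. ((\<lambda>(i, z). L (X i z)) \<longlongrightarrow> l) F"
      by (auto simp: case_prod_unfold)
  qed
next
  case (Suc j)
  note d = Ck_conv_differentiable[OF Suc(2)]
  show ?case
  proof (rule Ck_conv_SucI)
    show "Ck_conv 0 \<F> (\<lambda>i z. L (X i z))"
      by (rule Ck_conv_le[OF _ Suc(1)[OF Suc(2)[THEN Ck_conv_SucD]]]) simp
    show "(\<lambda>z. L (X i z)) differentiable at z" for i z
      by (rule differentiable_linear[OF assms(1) d])
    fix b :: 'a assume b: "b \<in> Basis"
    have "(\<lambda>i. pd UNIV b (\<lambda>z. L (X i z))) = (\<lambda>i z. L (pd UNIV b (X i) z))"
      by (intro ext pd_linear assms(1) d)
    then show "Ck_conv j \<F> (\<lambda>i. pd UNIV b (\<lambda>z. L (X i z)))"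
      using Suc(1)[OF Suc(2)[THEN Ck_conv_pd, OF b]] by simp
  qed
qed

lemma Ck_conv_sum:
  assumes "\<And>a. a \<in> A \<Longrightarrow> Ck_conv j \<F> (X a)"
  shows "Ck_conv j \<F> (\<lambda>i z. \<Sum>a\<in>A. X a i z)"
  using assms
  by (induction A rule: infinite_finite_induct) (auto intro: Ck_conv_const Ck_conv_add)

lemma Ck_conv_diff:
  assumes "Ck_conv j \<F> X" "Ck_conv j \<F> Y"
  shows "Ck_conv j \<F> (\<lambda>i z. X i z - Y i z)"
  using Ck_conv_add[OF assms(1) Ck_conv_linear[OF bounded_linear_minus[OF bounded_linear_ident] assms(2)]]
  by simp

lemma Ck_conv_Pair:
  assumes "Ck_conv j \<F> X" "Ck_conv j \<F> Y"
  shows "Ck_conv j \<F> (\<lambda>i z. (X i z, Y i z))"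
proof -
  have "bounded_linear (\<lambda>x. (x, 0))" "bounded_linear (\<lambda>y. (0, y))"
    by (intro bounded_linear_Pair bounded_linear_ident bounded_linear_zero)+
  from Ck_conv_add[OF Ck_conv_linear[OF this(1) assms(1)] Ck_conv_linear[OF this(2) assms(2)]]
  show ?thesis by simp
qed

lemma Ck_conv_ident:
  assumes "\<And>F. F \<in> \<F> \<Longrightarrow> \<exists>l. (snd \<longlongrightarrow> l) F"
  shows "Ck_conv j \<F> (\<lambda>i (z::'a::euclidean_space). z)"
proof -
  have 0: "Ck_conv 0 \<F> (\<lambda>i z. z)"
    by (rule Ck_conv_0I) (use assms in \<open>auto simp: case_prod_unfold\<close>)
  show ?thesis
  proof (cases j)
    case (Suc k)
    have "pd UNIV b (\<lambda>z. z) = (\<lambda>z. b)" for b :: 'a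
      using pd_eq[OF has_derivative_ident] by auto
    then show ?thesis unfolding Suc
      by (intro Ck_conv_SucI 0) (auto intro: Ck_conv_const)
  qed (use 0 in simp)
qed

text \<open>The index map \<open>\<pi>\<close> lets a sequence \<open>S\<close> indexed by the step
  number alone be evaluated along an array \<open>Y\<close> indexed by step number and step count.
  The filter condition does not involve \<open>S\<close>, so it also serves the partial derivatives
  of \<open>S\<close>, and the chain rule closes the induction on \<open>j\<close>.\<close>

lemma Ck_conv_compose:
  fixes Y :: "'i \<Rightarrow> 'a::euclidean_space \<Rightarrow> 'b::euclidean_space"
  assumes "Ck_conv j \<G> S" "Ck_conv j \<F> Y"
    "\<And>F. F \<in> \<F> \<Longrightarrow> \<exists>G\<in>\<G>. filterlim (\<lambda>(i, z). (\<pi> i, Y i z)) G F"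
  shows "Ck_conv j \<F> (\<lambda>i z. S (\<pi> i) (Y i z))"
  using assms(1,2)
proof (induction j arbitrary: S)
  case 0 show ?case
  proof (rule Ck_conv_0I)
    fix F assume F: "F \<in> \<F>"
    obtain G where G: "G \<in> \<G>" "filterlim (\<lambda>(i, z). (\<pi> i, Y i z)) G F" using assms(3)[OF F] by auto
    obtain l where "((\<lambda>(i, z). S i z) \<longlongrightarrow> l) G"
      using Ck_conv_lim[OF 0(1) G(1)] by metis
    from filterlim_compose[OF this G(2)] show "\<exists>l. ((\<lambda>(i, z). S (\<pi> i) (Y i z)) \<longlongrightarrow> l) F"
      by (auto simp: case_prod_unfold)
  qed
next
  case (Suc j)
  note d = Ck_conv_differentiable[OF Suc(2)] Ck_conv_differentiable[OF Suc(3)]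
  show ?case
  proof (rule Ck_conv_SucI)
    show "Ck_conv 0 \<F> (\<lambda>i z. S (\<pi> i) (Y i z))"
      by (rule Ck_conv_le[OF _ Suc(1)[OF Suc(2,3)[THEN Ck_conv_SucD]]]) simp
    show "(\<lambda>z. S (\<pi> i) (Y i z)) differentiable at z" for i z
      using has_derivative_chain_pd[OF d] by (rule differentiableI)
    fix b :: 'a assume b: "b \<in> Basis"
    have "(\<lambda>i. pd UNIV b (\<lambda>z. S (\<pi> i) (Y i z))) =
       (\<lambda>i z. \<Sum>c\<in>Basis. (pd UNIV b (Y i) z \<bullet> c) *\<^sub>R pd UNIV c (S (\<pi> i)) (Y i z))"
      using pd_chain[OF d, of b] by (auto simp del: sum.cong intro!: ext)
    moreover have "Ck_conv j \<F> (\<lambda>i z. \<Sum>c\<in>Basis. (pd UNIV b (Y i) z \<bullet> c) *\<^sub>R pd UNIV c (S (\<pi> i)) (Y i z))"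
      by (intro Ck_conv_sum Ck_conv_scaleR Ck_conv_linear[OF bounded_linear_inner_left] Suc(1)
          Suc(3)[THEN Ck_conv_pd, OF b] Ck_conv_pd[OF Suc(2)] Suc(3)[THEN Ck_conv_SucD])
    ultimately show "Ck_conv j \<F> (\<lambda>i. pd UNIV b (\<lambda>z. S (\<pi> i) (Y i z)))" by simp
  qed
qed

section \<open>Convergence on a set and differentiability of the limit\<close>

text \<open>Only the points at which convergence is tested are restricted to
  \<open>\<Omega>\<close>. The members of the sequence are differentiated on the whole space, which
  suits networks defined for all real h and t that approximate a flow known on a quadrant.\<close>

definition Ck_conv_on :: "nat \<Rightarrow> 'a::euclidean_space set \<Rightarrow> (nat \<Rightarrow> 'a \<Rightarrow> 'b::real_normed_vector) \<Rightarrow> bool" where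
  "Ck_conv_on j \<Omega> Y = Ck_conv j ((\<lambda>w. sequentially \<times>\<^sub>F inf (nhds w) (principal \<Omega>)) ` \<Omega>) Y"

lemma filterlim_snd_nhds_within:
  "filterlim snd (nhds w) (sequentially \<times>\<^sub>F inf (nhds w) (principal \<Omega>))"
  by (rule filterlim_mono[OF filterlim_snd[of _ sequentially] order_refl prod_filter_mono]) auto

lemma Ck_conv_on_ident: "Ck_conv_on j \<Omega> (\<lambda>i z. z)"
  unfolding Ck_conv_on_def
  by (rule Ck_conv_ident) (use filterlim_snd_nhds_within in auto)

text \<open>Reading a function as a constant sequence makes C^k functions a special case of
  convergent sequences, so sums, products and compositions of C^k functions are inherited from the
  rules for \<open>Ck_conv\<close>.\<close>

lemma Ck_on_UNIV_iff: "Ck_on j UNIV f \<longleftrightarrow> Ck_conv_on j UNIV (\<lambda>n. f)"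
proof -
  have *: "continuous_on UNIV f \<longleftrightarrow> (\<forall>F\<in>range (\<lambda>w. sequentially \<times>\<^sub>F nhds w). \<exists>l. ((\<lambda>(i::nat, z). f z) \<longlongrightarrow> l) F)"
    for f :: "'a \<Rightarrow> 'b"
  proof
    assume c: "continuous_on UNIV f"
    show "\<forall>F\<in>range (\<lambda>w. sequentially \<times>\<^sub>F nhds w). \<exists>l. ((\<lambda>(i::nat, z). f z) \<longlongrightarrow> l) F"
    proof (intro ballI, elim rangeE, clarify)
      fix w
      have "(f \<longlongrightarrow> f w) (nhds w)" using c
        by (metis UNIV_I continuous_on_eq_continuous_at isCont_def open_UNIV tendsto_nhds_iff)
      from filterlim_compose[OF this filterlim_snd]
      have "((\<lambda>x. f (snd x)) \<longlongrightarrow> f w) (sequentially \<times>\<^sub>F nhds w)" .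
      then show "\<exists>l. ((\<lambda>(i::nat, z). f z) \<longlongrightarrow> l) (sequentially \<times>\<^sub>F nhds w)" by (auto simp: case_prod_unfold)
    qed
  next
    assume a: "\<forall>F\<in>range (\<lambda>w. sequentially \<times>\<^sub>F nhds w). \<exists>l. ((\<lambda>(i::nat, z). f z) \<longlongrightarrow> l) F"
    show "continuous_on UNIV f"
      unfolding continuous_on_eq_continuous_at[OF open_UNIV]
    proof
      fix w
      obtain l where l: "((\<lambda>(i::nat, z). f z) \<longlongrightarrow> l) (sequentially \<times>\<^sub>F nhds w)" using a by auto
      have "(f \<longlongrightarrow> l) (nhds w)"
        unfolding tendsto_def
      proof (intro allI impI)
        fix S assume "open S" "l \<in> S"
        then have "\<forall>\<^sub>F (i::nat, z) in sequentially \<times>\<^sub>F nhds w. f z \<in> S"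
          using l by (simp add: tendsto_def case_prod_unfold)
        then show "\<forall>\<^sub>F z in nhds w. f z \<in> S" by (simp add: eventually_prod2)
      qed
      then show "isCont f w"
        by (metis isCont_def tendsto_nhds_iff tendsto_at_iff_tendsto_nhds)
    qed
  qed
  show ?thesis
    unfolding Ck_conv_on_def
  proof (induction j arbitrary: f)
    case (Suc j)
    have "(\<forall>F\<in>range (\<lambda>w. sequentially \<times>\<^sub>F nhds w). \<exists>l. ((\<lambda>(i::nat, z). f z) \<longlongrightarrow> l) F)"
      if "\<forall>x. f differentiable at x"
      using that * differentiable_imp_continuous_on[of f UNIV] by (simp add: differentiable_on_def)
    then show ?case using Suc by (auto simp: Ck_conv.simps differentiable_on_def pd_def)
  qed (simp add: Ck_conv.simps *)
qed

lemma eventually_seq_nhds_within: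
  fixes w :: "'a::metric_space"
  shows "eventually P (sequentially \<times>\<^sub>F inf (nhds w) (principal \<Omega>)) \<longleftrightarrow>
    (\<exists>\<delta>>0. \<exists>N. \<forall>n\<ge>N. \<forall>z\<in>\<Omega>. dist z w < \<delta> \<longrightarrow> P (n, z))"
proof
  assume "eventually P (sequentially \<times>\<^sub>F inf (nhds w) (principal \<Omega>))"
  then obtain Q R where Q: "eventually Q sequentially" and R: "eventually R (inf (nhds w) (principal \<Omega>))"
    and P: "\<And>x y. Q x \<Longrightarrow> R y \<Longrightarrow> P (x, y)"
    unfolding eventually_prod_filter by auto
  from Q R obtain N \<delta> where "\<forall>n\<ge>N. Q n" "\<delta> > 0" "\<forall>z. dist z w < \<delta> \<longrightarrow> z \<in> \<Omega> \<longrightarrow> R z"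
    unfolding eventually_inf_principal eventually_sequentially eventually_nhds_metric by blast
  then show "\<exists>\<delta>>0. \<exists>N. \<forall>n\<ge>N. \<forall>z\<in>\<Omega>. dist z w < \<delta> \<longrightarrow> P (n, z)" using P by blast
next
  assume "\<exists>\<delta>>0. \<exists>N. \<forall>n\<ge>N. \<forall>z\<in>\<Omega>. dist z w < \<delta> \<longrightarrow> P (n, z)"
  then obtain \<delta> N where d: "\<delta> > 0" and P: "\<forall>n\<ge>N. \<forall>z\<in>\<Omega>. dist z w < \<delta> \<longrightarrow> P (n, z)" by auto
  have "eventually (\<lambda>n. n \<ge> N) sequentially" by (rule eventually_ge_at_top)
  moreover have "eventually (\<lambda>z. z \<in> \<Omega> \<and> dist z w < \<delta>) (inf (nhds w) (principal \<Omega>))"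
    unfolding eventually_inf_principal eventually_nhds_metric using d by auto
  ultimately show "eventually P (sequentially \<times>\<^sub>F inf (nhds w) (principal \<Omega>))"
    unfolding eventually_prod_filter using P by fast
qed

text \<open>The sequence n -> (n, w) converges along the product filter, so the limit supplied by
  continuous convergence must be the pointwise limit at \<open>w\<close>.\<close>

lemma Ck_conv_on_tendsto:
  assumes Y: "Ck_conv_on j \<Omega> Y" and lim: "(\<lambda>n. Y n w) \<longlonglongrightarrow> l" and w: "w \<in> \<Omega>"
  shows "((\<lambda>(n, z). Y n z) \<longlongrightarrow> l) (sequentially \<times>\<^sub>F inf (nhds w) (principal \<Omega>))"
proof -
  obtain l' where l': "((\<lambda>(n, z). Y n z) \<longlongrightarrow> l') (sequentially \<times>\<^sub>F inf (nhds w) (principal \<Omega>))"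
    using Ck_conv_lim[OF Y[unfolded Ck_conv_on_def]] w by blast
  have "filterlim (\<lambda>n. (n, w)) (sequentially \<times>\<^sub>F inf (nhds w) (principal \<Omega>)) sequentially"
    by (intro filterlim_Pair filterlim_ident)
      (auto simp: filterlim_inf filterlim_principal w)
  from filterlim_compose[OF l' this] have "(\<lambda>n. Y n w) \<longlonglongrightarrow> l'" by simp
  then have "l' = l" using lim LIMSEQ_unique by blast
  then show ?thesis using l' by simp
qed

lemma Ck_conv_on_local:
  assumes "Ck_conv_on j \<Omega> Y" "(\<lambda>n. Y n w) \<longlonglongrightarrow> l" "w \<in> \<Omega>" "\<epsilon> > 0"
  obtains \<delta> N where "\<delta> > 0" "\<And>n z. n \<ge> N \<Longrightarrow> z \<in> \<Omega> \<Longrightarrow> dist z w < \<delta> \<Longrightarrow> dist (Y n z) l < \<epsilon>"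
  using tendstoD[OF Ck_conv_on_tendsto[OF assms(1-3)] assms(4)]
  unfolding eventually_seq_nhds_within by auto

lemma Ck_conv_on_pointwise:
  assumes "Ck_conv_on j \<Omega> Y" "w \<in> \<Omega>"
  obtains l where "(\<lambda>n. Y n w) \<longlonglongrightarrow> l"
proof -
  obtain l' where l': "((\<lambda>(n, z). Y n z) \<longlongrightarrow> l') (sequentially \<times>\<^sub>F inf (nhds w) (principal \<Omega>))"
    using Ck_conv_lim[OF assms(1)[unfolded Ck_conv_on_def]] assms(2) by blast
  have "filterlim (\<lambda>n. (n, w)) (sequentially \<times>\<^sub>F inf (nhds w) (principal \<Omega>)) sequentially"
    by (intro filterlim_Pair filterlim_ident)
      (auto simp: filterlim_inf filterlim_principal assms(2))
  from filterlim_compose[OF l' this] show ?thesis using that by simp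
qed

lemma LIMSEQ_dist_le:
  assumes "x \<longlonglongrightarrow> a" "\<And>n. n \<ge> N \<Longrightarrow> dist (x n) l < \<epsilon>"
  shows "dist a l \<le> \<epsilon>"
proof -
  have "(\<lambda>n. dist (x n) l) \<longlonglongrightarrow> dist a l" using assms(1) by (intro tendsto_intros)
  moreover have "\<forall>n\<ge>N. dist (x n) l \<le> \<epsilon>" using assms(2) less_imp_le by blast
  ultimately show ?thesis using LIMSEQ_le_const2 by blast
qed

lemma Ck_conv_on_continuous_limit:
  assumes "Ck_conv_on j \<Omega> Y" and lim: "\<And>w. w \<in> \<Omega> \<Longrightarrow> (\<lambda>n. Y n w) \<longlonglongrightarrow> f w"
  shows "continuous_on \<Omega> f"
  unfolding continuous_on_iff
proof (intro ballI allI impI)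
  fix w and e :: real assume w: "w \<in> \<Omega>" "e > 0"
  obtain \<delta> N where d: "\<delta> > 0" "\<And>n z. n \<ge> N \<Longrightarrow> z \<in> \<Omega> \<Longrightarrow> dist z w < \<delta> \<Longrightarrow> dist (Y n z) (f w) < e/2"
    using Ck_conv_on_local[OF assms(1) lim w(1) , of "e/2"] w by auto
  have "dist (f z) (f w) < e" if "z \<in> \<Omega>" "dist z w < \<delta>" for z
    using LIMSEQ_dist_le[OF lim[OF that(1)] d(2)[OF _ that], of N] w(2) by simp
  with d(1) show "\<exists>d>0. \<forall>x'\<in>\<Omega>. dist x' w < d \<longrightarrow> dist (f x') (f w) < e" by blast
qed

text \<open>Near each \<open>w\<close> of \<open>C\<close> both \<open>Y n z\<close> and its limit
  \<open>f z\<close> are close to the same value \<open>f w\<close>. Compactness reduces this to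
  finitely many neighbourhoods and hence to one index.\<close>

lemma Ck_conv_on_uniform:
  assumes "Ck_conv_on j \<Omega> Y" and lim: "\<And>w. w \<in> \<Omega> \<Longrightarrow> (\<lambda>n. Y n w) \<longlonglongrightarrow> f w"
    and C: "compact C" "C \<subseteq> \<Omega>" and e: "\<epsilon> > 0"
  shows "\<forall>\<^sub>F n in sequentially. \<forall>z\<in>C. dist (Y n z) (f z) < \<epsilon>"
proof -
  have "\<exists>\<delta> N. \<delta> > 0 \<and> (\<forall>n z. n \<ge> N \<longrightarrow> z \<in> \<Omega> \<longrightarrow> dist z w < \<delta> \<longrightarrow> dist (Y n z) (f w) < \<epsilon>/2)"
    if "w \<in> C" for w
    using Ck_conv_on_local[OF assms(1) lim, of w "\<epsilon>/2"] that C(2) e by (metis half_gt_zero subsetD)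
  then obtain \<delta> N where d: "\<And>w. w \<in> C \<Longrightarrow> \<delta> w > 0"
    "\<And>w n z. w \<in> C \<Longrightarrow> n \<ge> N w \<Longrightarrow> z \<in> \<Omega> \<Longrightarrow> dist z w < \<delta> w \<Longrightarrow> dist (Y n z) (f w) < \<epsilon>/2"
    by metis
  obtain D where D: "D \<subseteq> C" "finite D" "C \<subseteq> (\<Union>w\<in>D. ball w (\<delta> w))"
    by (rule compactE_image[OF C(1), of C "\<lambda>w. ball w (\<delta> w)"]) (use d(1) in auto)
  have "dist (Y n z) (f z) < \<epsilon>" if n: "\<forall>w\<in>D. N w \<le> n" and z: "z \<in> C" for n z
  proof -
    obtain w where w: "w \<in> D" "dist z w < \<delta> w" using D(3) z by (auto simp: dist_commute)
    have wC: "w \<in> C" and zO: "z \<in> \<Omega>" using w D C z by auto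
    have "dist (f z) (f w) \<le> \<epsilon>/2"
      by (rule LIMSEQ_dist_le[OF lim[OF zO] d(2)[OF wC _ zO w(2)]])
    moreover have "dist (Y n z) (f w) < \<epsilon>/2" using d(2)[OF wC _ zO w(2)] n w by blast
    ultimately show ?thesis using dist_triangle2[of "Y n z" "f z" "f w"] by linarith
  qed
  moreover have "\<forall>\<^sub>F n in sequentially. \<forall>w\<in>D. N w \<le> n"
    using D(2) by (intro eventually_ball_finite) (auto intro: eventually_ge_at_top)
  ultimately show ?thesis by (auto elim: eventually_mono)
qed

text \<open>On such sets derivatives within the set are unique and the mean value inequality applies locally.\<close>
definition open_in_quadrant :: "'a::euclidean_space set \<Rightarrow> bool" where
  "open_in_quadrant \<Omega> \<longleftrightarrow> (\<exists>D U. \<Omega> = D \<inter> U \<and> convex D \<and> open U \<and>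
     (\<forall>w\<in>D. \<forall>b\<in>Basis. \<forall>d\<ge>0. w + d *\<^sub>R b \<in> D))"

lemma open_in_quadrant_open: "open \<Omega> \<Longrightarrow> open_in_quadrant \<Omega>"
  unfolding open_in_quadrant_def by (rule exI[of _ UNIV], rule exI[of _ \<Omega>]) auto

text \<open>Every point of the set can be moved a little in the positive direction of each basis
  vector without leaving it, and this many directions determine the derivative.\<close>

lemma open_in_quadrant_unique:
  assumes "open_in_quadrant \<Omega>" "w \<in> \<Omega>"
    "(f has_derivative f') (at w within \<Omega>)" "(f has_derivative f'') (at w within \<Omega>)"
  shows "f' = f''"
proof -
  obtain D U where D: "\<Omega> = D \<inter> U" "open U" "\<forall>w\<in>D. \<forall>b\<in>Basis. \<forall>d\<ge>0. w + d *\<^sub>R b \<in> D"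
    using assms(1) unfolding open_in_quadrant_def by auto
  obtain \<rho> where r: "\<rho> > 0" "ball w \<rho> \<subseteq> U" using D(1,2) assms(2) open_contains_ball by (metis IntD2)
  show ?thesis
  proof (rule frechet_derivative_unique_within[OF assms(3,4)])
    fix i :: 'a and e :: real assume i: "i \<in> Basis" "e > 0"
    define d where "d = min e \<rho> / 2"
    have d: "0 < d" "d < e" "d < \<rho>" using i r by (auto simp: d_def)
    then have "dist w (w + d *\<^sub>R i) < \<rho>" using i by (simp add: dist_norm)
    then have "w + d *\<^sub>R i \<in> \<Omega>" using D r(2) d(1) assms(2) i(1) by auto
    then show "\<exists>d. 0 < \<bar>d\<bar> \<and> \<bar>d\<bar> < e \<and> w + d *\<^sub>R i \<in> \<Omega>" using d
      by (intro exI[of _ d]) auto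
  qed
qed

text \<open>The mean value inequality is applied to \<open>Y n - L\<close>, where \<open>L\<close>
  is the candidate derivative. By continuous convergence the derivative of this difference has norm
  at most \<open>e\<close> on a convex neighbourhood of \<open>w\<close> relative to
  \<open>\<Omega>\<close>, for all large n, and the resulting Lipschitz bound survives the limit in
  n.\<close>

lemma Ck_conv_on_has_derivative:
  fixes Y :: "nat \<Rightarrow> 'a::euclidean_space \<Rightarrow> 'b::real_normed_vector"
  assumes Y: "Ck_conv_on (Suc j) \<Omega> Y" and O: "open_in_quadrant \<Omega>"
    and lim: "\<And>w. w \<in> \<Omega> \<Longrightarrow> (\<lambda>n. Y n w) \<longlonglongrightarrow> f w"
    and g: "\<And>b. b \<in> Basis \<Longrightarrow> (\<lambda>n. pd UNIV b (Y n) w) \<longlonglongrightarrow> g b" and w: "w \<in> \<Omega>"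
  shows "(f has_derivative (\<lambda>v. \<Sum>b\<in>Basis. (v \<bullet> b) *\<^sub>R g b)) (at w within \<Omega>)"
proof -
  define L where "L = (\<lambda>v. \<Sum>b\<in>Basis. (v \<bullet> b) *\<^sub>R g b)"
  have L: "bounded_linear L" unfolding L_def
    by (intro bounded_linear_sum bounded_linear_scaleR_const bounded_linear_inner_left)
  obtain D U where D: "\<Omega> = D \<inter> U" "convex D" "open U"
    using O unfolding open_in_quadrant_def by auto
  obtain \<rho> where r: "\<rho> > 0" "ball w \<rho> \<subseteq> U" using D(1,3) w open_contains_ball by (metis IntD2)
  show ?thesis
    unfolding L_def[symmetric] has_derivative_within_alt
  proof (intro conjI L allI impI)
    fix e :: real assume e: "e > 0"
    \<comment> \<open>A linear map is bounded by the sum of the norms of its values on the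
      \<open>DIM('a)\<close> basis vectors, so each partial derivative receives an equal share of
      \<open>e\<close>.\<close>
    define e' where "e' = e / DIM('a)"
    have e': "e' > 0" using e by (simp add: e'_def)
    have "eventually (\<lambda>p. \<forall>b\<in>Basis. dist (pd UNIV b (Y (fst p)) (snd p)) (g b) < e')
       (sequentially \<times>\<^sub>F inf (nhds w) (principal \<Omega>))"
    proof (rule eventually_ball_finite[OF finite_Basis], rule ballI)
      fix b :: 'a assume b: "b \<in> Basis"
      have "Ck_conv_on j \<Omega> (\<lambda>n. pd UNIV b (Y n))" using Y b unfolding Ck_conv_on_def by (rule Ck_conv_pd)
      from tendstoD[OF Ck_conv_on_tendsto[OF this g[OF b] w] e']
      show "\<forall>\<^sub>F p in sequentially \<times>\<^sub>F inf (nhds w) (principal \<Omega>). dist (pd UNIV b (Y (fst p)) (snd p)) (g b) < e'"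
        by (simp add: case_prod_unfold)
    qed
    then obtain \<delta> N where d: "\<delta> > 0"
      "\<And>n z b. n \<ge> N \<Longrightarrow> z \<in> \<Omega> \<Longrightarrow> dist z w < \<delta> \<Longrightarrow> b \<in> Basis \<Longrightarrow> dist (pd UNIV b (Y n) z) (g b) < e'"
      unfolding eventually_seq_nhds_within fst_conv snd_conv by blast
    define B where "B = D \<inter> ball w (min \<delta> \<rho>)"
    have B: "convex B" "B \<subseteq> \<Omega>" "w \<in> B" "\<And>z. z \<in> B \<Longrightarrow> dist z w < \<delta>"
      using D r d w by (auto simp: B_def dist_commute intro: convex_Int)
    have bd: "norm (Y n y - Y n w - L (y - w)) \<le> e * norm (y - w)" if n: "n \<ge> N" and y: "y \<in> B" for n y
    proof -
      let ?F = "\<lambda>z. Y n z - L z"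
      have der: "(?F has_derivative (\<lambda>v. pd UNIV v (Y n) z - L v)) (at z within B)" for z
        using Ck_conv_differentiable[OF Y[unfolded Ck_conv_on_def]] L
        by (intro has_derivative_diff has_derivative_at_withinI[OF has_derivative_pd]
             bounded_linear_imp_has_derivative) auto
      have "onorm (\<lambda>v. pd UNIV v (Y n) z - L v) \<le> e" if z: "z \<in> B" for z
      proof (rule onorm_le)
        fix v
        have "pd UNIV v (Y n) z - L v = (\<Sum>b\<in>Basis. (v \<bullet> b) *\<^sub>R (pd UNIV b (Y n) z - g b))"
          using pd_basis_expansion[OF Ck_conv_differentiable[OF Y[unfolded Ck_conv_on_def]], of v n z]
          by (simp add: L_def sum_subtractf scaleR_diff_right)
        also have "norm \<dots> \<le> (\<Sum>b\<in>(Basis::'a set). norm v * e')"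
        proof (rule sum_norm_le)
          fix b :: 'a assume b: "b \<in> Basis"
          have "norm (pd UNIV b (Y n) z - g b) \<le> e'"
            using d(2)[OF n _ B(4)[OF z] b] z B(2) by (auto simp: dist_norm intro: less_imp_le)
          moreover have "\<bar>v \<bullet> b\<bar> \<le> norm v" using b by (rule Basis_le_norm)
          ultimately show "norm ((v \<bullet> b) *\<^sub>R (pd UNIV b (Y n) z - g b)) \<le> norm v * e'"
            by (simp add: mult_mono)
        qed
        also have "\<dots> = e * norm v" by (simp add: e'_def)
        finally show "norm (pd UNIV v (Y n) z - L v) \<le> e * norm v" .
      qed
      from differentiable_bound[OF B(1) der this y B(3)]
      show ?thesis unfolding linear_diff[OF bounded_linear.linear[OF L]] by (simp add: algebra_simps)
    qed
    have "norm (f y - f w - L (y - w)) \<le> e * norm (y - w)" if y: "y \<in> B" for y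
    proof (rule LIMSEQ_le_const2)
      show "(\<lambda>n. norm (Y n y - Y n w - L (y - w))) \<longlonglongrightarrow> norm (f y - f w - L (y - w))"
        using lim y B(2) w by (intro tendsto_intros) auto
      show "\<exists>N. \<forall>n\<ge>N. norm (Y n y - Y n w - L (y - w)) \<le> e * norm (y - w)" using bd y by blast
    qed
    moreover have "y \<in> B" if "y \<in> \<Omega>" "norm (y - w) < min \<delta> \<rho>" for y
      using that D(1) by (auto simp: B_def dist_norm norm_minus_commute)
    ultimately show "\<exists>d>0. \<forall>y\<in>\<Omega>. norm (y - w) < d \<longrightarrow> norm (f y - f w - L (y - w)) \<le> e * norm (y - w)"
      using d(1) r(1) by (metis min_less_iff_conj)
  qed
qed

text \<open>The partial derivatives converge by definition; uniqueness of derivatives within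
  \<open>\<Omega>\<close> identifies their limits as the partial derivatives of
  \<open>f\<close>.\<close>

lemma Ck_conv_on_pd_limit:
  fixes Y :: "nat \<Rightarrow> 'a::euclidean_space \<Rightarrow> 'b::real_normed_vector"
  assumes Y: "Ck_conv_on (Suc j) \<Omega> Y" and O: "open_in_quadrant \<Omega>"
    and lim: "\<And>w. w \<in> \<Omega> \<Longrightarrow> (\<lambda>n. Y n w) \<longlonglongrightarrow> f w" and w: "w \<in> \<Omega>"
  shows "f differentiable (at w within \<Omega>)"
    "\<And>b. b \<in> Basis \<Longrightarrow> (\<lambda>n. pd UNIV b (Y n) w) \<longlonglongrightarrow> pd \<Omega> b f w"
proof -
  have "\<exists>l. (\<lambda>n. pd UNIV b (Y n) w) \<longlonglongrightarrow> l" if b: "b \<in> Basis" for b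
    using Ck_conv_on_pointwise[OF Ck_conv_pd[OF Y[unfolded Ck_conv_on_def] b, folded Ck_conv_on_def] w] by metis
  then obtain g where g: "\<And>b. b \<in> Basis \<Longrightarrow> (\<lambda>n. pd UNIV b (Y n) w) \<longlonglongrightarrow> g b" by metis
  have der: "(f has_derivative (\<lambda>v. \<Sum>b\<in>Basis. (v \<bullet> b) *\<^sub>R g b)) (at w within \<Omega>)"
    using Ck_conv_on_has_derivative[OF Y O lim g w] by simp
  then show d: "f differentiable (at w within \<Omega>)" by (rule differentiableI)
  show "(\<lambda>n. pd UNIV b (Y n) w) \<longlonglongrightarrow> pd \<Omega> b f w" if b: "b \<in> Basis" for b
  proof -
    have "frechet_derivative f (at w within \<Omega>) = (\<lambda>v. \<Sum>b\<in>Basis. (v \<bullet> b) *\<^sub>R g b)"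
      using open_in_quadrant_unique[OF O w _ der] d frechet_derivative_works by blast
    then have "pd \<Omega> b f w = (\<Sum>c\<in>Basis. (b \<bullet> c) *\<^sub>R g c)" by (simp add: pd_def)
    also have "\<dots> = (\<Sum>c\<in>Basis. if c = b then g b else 0)"
      by (rule sum.cong) (use b in \<open>auto simp: inner_Basis\<close>)
    finally show ?thesis using g b by simp
  qed
qed

text \<open>In \<open>pdl\<close> the head of the list is the derivative taken last, whereas
  \<open>Ck_conv\<close> recurses on the one taken first. Inductions over \<open>L\<close> therefore
  run from the right end and use this equation.\<close>

lemma pdl_append: "pdl \<Omega> (L @ [b]) f = pdl \<Omega> L (pd \<Omega> b f)"
  by (induction L) auto

lemma Ck_conv_on_pdl_uniform:
  fixes Y :: "nat \<Rightarrow> 'a::euclidean_space \<Rightarrow> 'b::real_normed_vector"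
  assumes "Ck_conv_on j \<Omega> Y" "open_in_quadrant \<Omega>"
    "\<And>w. w \<in> \<Omega> \<Longrightarrow> (\<lambda>n. Y n w) \<longlonglongrightarrow> f w"
    "compact C" "C \<subseteq> \<Omega>" "\<epsilon> > 0" "set L \<subseteq> Basis" "length L \<le> j"
  shows "\<forall>\<^sub>F n in sequentially. \<forall>z\<in>C. dist (pdl UNIV L (Y n) z) (pdl \<Omega> L f z) < \<epsilon>"
  using assms(1,3,7,8)
proof (induction L arbitrary: j Y f rule: rev_induct)
  case Nil then show ?case using Ck_conv_on_uniform[OF Nil(1,2) assms(4-6)] by simp
next
  case (snoc b L)
  obtain k where j: "j = Suc k" using snoc(5) by (cases j) auto
  have b: "b \<in> Basis" using snoc(4) by simp
  note Y = snoc(2)[unfolded j]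
  have "\<forall>\<^sub>F n in sequentially. \<forall>z\<in>C. dist (pdl UNIV L (pd UNIV b (Y n)) z) (pdl \<Omega> L (pd \<Omega> b f) z) < \<epsilon>"
    by (rule snoc(1)[OF Ck_conv_pd[OF Y[unfolded Ck_conv_on_def] b, folded Ck_conv_on_def]])
      (use snoc(4,5) j b Ck_conv_on_pd_limit(2)[OF Y assms(2) snoc(3)] in auto)
  then show ?case by (simp add: pdl_append)
qed

lemma Ck_conv_on_Ck_limit:
  fixes Y :: "nat \<Rightarrow> 'a::euclidean_space \<Rightarrow> 'b::real_normed_vector"
  assumes "Ck_conv_on j UNIV Y" "\<And>w. (\<lambda>n. Y n w) \<longlonglongrightarrow> f w"
  shows "Ck_on j UNIV f"
  using assms
proof (induction j arbitrary: Y f)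
  case 0 then show ?case using Ck_conv_on_continuous_limit[OF 0(1)] by simp
next
  case (Suc j)
  note O = open_in_quadrant_open[OF open_UNIV, where ?'a = 'a]
  have "Ck_on j UNIV (pd UNIV b f)" if b: "b \<in> Basis" for b
    by (rule Suc(1)[OF Ck_conv_pd[OF Suc(2)[unfolded Ck_conv_on_def] b, folded Ck_conv_on_def]])
      (use Ck_conv_on_pd_limit(2)[OF Suc(2) O Suc(3)] b in auto)
  then show ?case
    using Ck_conv_on_pd_limit(1)[OF Suc(2) O Suc(3)] by (simp add: pd_def differentiable_on_def)
qed

section \<open>Euler polygons and their derivatives\<close>

definition polygon :: "(nat \<Rightarrow> 'b::real_normed_vector) \<Rightarrow> real \<Rightarrow> 'b" where
  "polygon x u = x (nat \<lfloor>u\<rfloor>) + frac u *\<^sub>R (x (Suc (nat \<lfloor>u\<rfloor>)) - x (nat \<lfloor>u\<rfloor>))"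

lemma polygon_of_nat [simp]: "polygon x (real k) = x k"
  by (simp add: polygon_def)

text \<open>The telescoping estimate is used with \<open>v = 0\<close> to bound a displacement, and
  with \<open>v\<close> the increment that a limiting field would produce in one step to obtain
  difference quotients.\<close>

lemma norm_sum_increments:
  fixes x :: "nat \<Rightarrow> 'b::real_normed_vector"
  assumes "\<And>l. a \<le> l \<Longrightarrow> l < b \<Longrightarrow> norm (x (Suc l) - x l - v) \<le> B" "a \<le> b"
  shows "norm (x b - x a - real (b - a) *\<^sub>R v) \<le> B * real (b - a)"
  using assms(2,1)
proof (induction b rule: dec_induct)
  case (step n)
  have "x (Suc n) - x a - real (Suc n - a) *\<^sub>R v = (x n - x a - real (n - a) *\<^sub>R v) + (x (Suc n) - x n - v)"
    using step(1) by (simp add: Suc_diff_le algebra_simps)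
  also have "norm \<dots> \<le> B * real (n - a) + B"
    using step by (intro norm_triangle_mono) auto
  also have "\<dots> = B * real (Suc n - a)" using step(1) by (simp add: Suc_diff_le algebra_simps)
  finally show ?case .
qed simp

lemma polygon_lipschitz:
  fixes x :: "nat \<Rightarrow> 'b::real_normed_vector"
  assumes B: "\<And>k. norm (x (Suc k) - x k) \<le> B" and uv: "0 \<le> u" "u \<le> v"
  shows "norm (polygon x u - polygon x v) \<le> B * (v - u)"
proof -
  define a b where "a = nat \<lfloor>u\<rfloor>" and "b = nat \<lfloor>v\<rfloor>"
  have fa: "frac u = u - real a" and fb: "frac v = v - real b" using uv by (auto simp: a_def b_def frac_def)
  have ru: "real a \<le> u" "u \<le> real a + 1" "real b \<le> v"
    using uv by (auto simp: a_def b_def)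
  have ab: "a \<le> b" using uv by (simp add: a_def b_def nat_mono floor_mono)
  have P: "polygon x u = x a + (u - a) *\<^sub>R (x (Suc a) - x a)" "polygon x v = x b + (v - b) *\<^sub>R (x (Suc b) - x b)"
    unfolding polygon_def fa[symmetric] fb[symmetric] by (auto simp: a_def b_def)
  show ?thesis
  proof (cases "a = b")
    case True
    have "polygon x u - polygon x v = (u - v) *\<^sub>R (x (Suc a) - x a)"
      unfolding P True by (simp add: algebra_simps)
    then show ?thesis using mult_left_mono[OF B[of a], of "v - u"] uv by (simp add: mult.commute)
  next
    case False
    then have ab': "Suc a \<le> b" using ab by simp
    \<comment> \<open>The rest of the segment containing \<open>u\<close>, the whole segments
      between nodes, and the beginning of the segment containing \<open>v\<close>.\<close>
    have e: "polygon x u - polygon x v = (u - a - 1) *\<^sub>R (x (Suc a) - x a) - (x b - x (Suc a)) - (v - b) *\<^sub>R (x (Suc b) - x b)"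
      unfolding P by (simp add: algebra_simps)
    have 1: "norm ((u - a - 1) *\<^sub>R (x (Suc a) - x a)) \<le> B * (a + 1 - u)"
    proof -
      have "\<bar>u - real a - 1\<bar> = a + 1 - u" using ru by simp
      moreover have "(a + 1 - u) * norm (x (Suc a) - x a) \<le> (a + 1 - u) * B"
        using ru by (intro mult_left_mono B) simp
      ultimately show ?thesis unfolding norm_scaleR real_norm_def by (simp only: mult.commute)
    qed
    have 2: "norm (x b - x (Suc a)) \<le> B * (real b - (real a + 1))"
      using norm_sum_increments[of "Suc a" b x 0 B] B ab' by (simp add: of_nat_diff add.commute)
    have 3: "norm ((v - b) *\<^sub>R (x (Suc b) - x b)) \<le> B * (v - b)"
      using mult_left_mono[OF B[of b], of "v - b"] ru by (simp add: mult.commute)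
    have "norm (polygon x u - polygon x v) \<le> B * (real (a + 1) - u) + B * (real b - (real a + 1)) + B * (v - real b)"
      unfolding e
      by (rule order_trans[OF norm_triangle_ineq4 add_mono[OF order_trans[OF norm_triangle_ineq4 add_mono[OF 1 2]] 3]])
    then show ?thesis by (simp add: algebra_simps)
  qed
qed

lemma floor_grid_tendsto:
  fixes N :: "nat \<Rightarrow> nat"
  assumes N: "filterlim N at_top sequentially" and s: "0 \<le> s"
  shows "(\<lambda>i. real (nat \<lfloor>s * real (N i)\<rfloor>) / real (N i)) \<longlonglongrightarrow> s"
proof -
  have inv: "(\<lambda>i. 1 / real (N i)) \<longlonglongrightarrow> 0"
    using filterlim_compose[OF lim_1_over_n N] by simp
  have pos: "\<forall>\<^sub>F i in sequentially. N i > 0"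
    using eventually_compose_filterlim[OF eventually_gt_at_top N] .
  show ?thesis
  proof (rule tendsto_sandwich)
    show "\<forall>\<^sub>F i in sequentially. s - 1 / real (N i) \<le> real (nat \<lfloor>s * real (N i)\<rfloor>) / real (N i)"
      using pos
    proof eventually_elim
      case (elim i)
      have "s * real (N i) - 1 \<le> real (nat \<lfloor>s * real (N i)\<rfloor>)" by linarith
      then have "(s * real (N i) - 1) / real (N i) \<le> real (nat \<lfloor>s * real (N i)\<rfloor>) / real (N i)"
        by (rule divide_right_mono) simp
      then show ?case using elim by (simp add: diff_divide_distrib)
    qed
    show "\<forall>\<^sub>F i in sequentially. real (nat \<lfloor>s * real (N i)\<rfloor>) / real (N i) \<le> s"
      using pos
    proof eventually_elim
      case (elim i)
      have "real (nat \<lfloor>s * real (N i)\<rfloor>) \<le> s * real (N i)" using s elim by simp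
      then show ?case using elim by (simp add: field_simps)
    qed
    show "(\<lambda>i. s - 1 / real (N i)) \<longlonglongrightarrow> s" using tendsto_diff[OF tendsto_const inv, of s] by simp
  qed simp
qed

text \<open>Near time \<open>s\<close> every step adds almost \<open>1 / N i\<close> times the
  vector \<open>g s (X s)\<close>, because \<open>f\<close> converges continuously there. Summing
  the steps between two times and letting i tend to infinity gives an estimate for the difference
  quotients of \<open>X\<close>.\<close>

lemma grid_limit_solves:
  fixes x :: "nat \<Rightarrow> nat \<Rightarrow> 'b::real_normed_vector"
  assumes N: "filterlim N at_top sequentially" "\<And>i. N i > 0"
    and step: "\<And>i k. k < N i \<Longrightarrow> x i (Suc k) = x i k + (1 / real (N i)) *\<^sub>R f i k (x i k)"
    and X: "continuous_on {0..1} X"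
    and unif: "\<And>\<epsilon>. \<epsilon> > 0 \<Longrightarrow> \<exists>i0. \<forall>i\<ge>i0. \<forall>k\<le>N i. dist (x i k) (X (real k / real (N i))) < \<epsilon>"
    and conv: "\<And>s \<epsilon>. 0 \<le> s \<Longrightarrow> s \<le> 1 \<Longrightarrow> \<epsilon> > 0 \<Longrightarrow> \<exists>\<eta>>0. \<exists>i0. \<forall>i\<ge>i0. \<forall>k<N i. \<forall>y.
        \<bar>real k / real (N i) - s\<bar> < \<eta> \<longrightarrow> dist y (X s) < \<eta> \<longrightarrow> dist (f i k y) (g s (X s)) < \<epsilon>"
    and s: "0 \<le> s" "s \<le> 1"
  shows "(X has_vector_derivative g s (X s)) (at s within {0..1})"
proof -
  define G where "G = g s (X s)"
  \<comment> \<open>The two times are arbitrary near \<open>s\<close>, so one bound serves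
    difference quotients to the left and to the right of \<open>s\<close>.\<close>
  have key: "\<exists>\<delta>>0. \<forall>s1 s2. 0 \<le> s1 \<longrightarrow> s1 \<le> s2 \<longrightarrow> s2 \<le> 1 \<longrightarrow> \<bar>s1 - s\<bar> < \<delta> \<longrightarrow> \<bar>s2 - s\<bar> < \<delta> \<longrightarrow>
       norm (X s2 - X s1 - (s2 - s1) *\<^sub>R G) \<le> \<epsilon> * (s2 - s1)" if e: "\<epsilon> > 0" for \<epsilon>
  proof -
    obtain \<eta> i0 where \<eta>: "\<eta> > 0" and i0: "\<And>i k y. i \<ge> i0 \<Longrightarrow> k < N i \<Longrightarrow>
        \<bar>real k / real (N i) - s\<bar> < \<eta> \<Longrightarrow> dist y (X s) < \<eta> \<Longrightarrow> dist (f i k y) G < \<epsilon>"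
      using conv[OF s e] unfolding G_def by blast
    obtain \<theta> where \<theta>: "\<theta> > 0" "\<And>u. u \<in> {0..1} \<Longrightarrow> dist u s < \<theta> \<Longrightarrow> dist (X u) (X s) < \<eta>/2"
      using X s \<eta> unfolding continuous_on_iff by (metis atLeastAtMost_iff half_gt_zero)
    obtain i1 where i1: "\<And>i k. i \<ge> i1 \<Longrightarrow> k \<le> N i \<Longrightarrow> dist (x i k) (X (real k / real (N i))) < \<eta>/2"
      using unif[of "\<eta>/2"] \<eta> by auto
    \<comment> \<open>The node just before \<open>s1\<close> may precede it by up to
      \<open>1 / N i\<close>, which is made smaller than \<open>\<delta>\<close>. The nodes in
      between thus stay within \<open>2 * \<delta>\<close> of \<open>s\<close>, hence the
      half.\<close>
    define \<delta> where "\<delta> = min \<eta> \<theta> / 2"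
    have \<delta>: "\<delta> > 0" "2*\<delta> \<le> \<eta>" "2*\<delta> \<le> \<theta>" using \<eta> \<theta> by (auto simp: \<delta>_def)
    have inv: "(\<lambda>i. 1 / real (N i)) \<longlonglongrightarrow> 0"
      using filterlim_compose[OF lim_1_over_n N(1)] by simp
    then obtain i2 where i2: "\<And>i. i \<ge> i2 \<Longrightarrow> 1 / real (N i) < \<delta>"
      using order_tendstoD(2)[OF inv \<delta>(1)] unfolding eventually_sequentially by auto
    have "norm (X s2 - X s1 - (s2 - s1) *\<^sub>R G) \<le> \<epsilon> * (s2 - s1)"
      if s12: "0 \<le> s1" "s1 \<le> s2" "s2 \<le> 1" "\<bar>s1 - s\<bar> < \<delta>" "\<bar>s2 - s\<bar> < \<delta>" for s1 s2
    proof -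
      define k1 k2 where "k1 i = nat \<lfloor>s1 * real (N i)\<rfloor>" and "k2 i = nat \<lfloor>s2 * real (N i)\<rfloor>" for i
      have k12: "k1 i \<le> k2 i" "k2 i \<le> N i" for i
      proof -
        show "k1 i \<le> k2 i" unfolding k1_def k2_def using s12 by (intro nat_mono floor_mono mult_right_mono) auto
        have "s2 * real (N i) \<le> 1 * real (N i)" using s12 by (intro mult_right_mono) auto
        then have "\<lfloor>s2 * real (N i)\<rfloor> \<le> int (N i)" by linarith
        then show "k2 i \<le> N i" unfolding k2_def by simp
      qed
      have lim: "(\<lambda>i. real (k1 i) / real (N i)) \<longlonglongrightarrow> s1" "(\<lambda>i. real (k2 i) / real (N i)) \<longlonglongrightarrow> s2"
        unfolding k1_def k2_def using s12 by (intro floor_grid_tendsto[OF N(1)]; simp)+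
      have Xlim: "(\<lambda>i. x i (k i)) \<longlonglongrightarrow> X t"
        if k: "\<And>i. k i \<le> N i" "(\<lambda>i. real (k i) / real (N i)) \<longlonglongrightarrow> t" and t: "t \<in> {0..1}" for k t
      proof -
        have g01: "real (k i) / real (N i) \<in> {0..1}" for i using k(1)[of i] N(2)[of i] by simp
        have "(\<lambda>i. X (real (k i) / real (N i))) \<longlonglongrightarrow> X t"
          using continuous_on_tendsto_compose[OF X k(2) t] g01 by simp
        moreover have "(\<lambda>i. x i (k i) - X (real (k i) / real (N i))) \<longlonglongrightarrow> 0"
        proof (rule metric_LIMSEQ_I)
          fix e :: real assume "e > 0"
          with unif obtain i0 where "\<forall>i\<ge>i0. \<forall>k\<le>N i. dist (x i k) (X (real k / real (N i))) < e" by blast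
          then show "\<exists>no. \<forall>n\<ge>no. dist (x n (k n) - X (real (k n) / real (N n))) 0 < e"
            using k(1) by (auto simp: dist_norm)
        qed
        ultimately show ?thesis using tendsto_add by fastforce
      qed
      have "norm (x i (k2 i) - x i (k1 i) - (real (k2 i) / real (N i) - real (k1 i) / real (N i)) *\<^sub>R G)
         \<le> \<epsilon> * (real (k2 i) / real (N i) - real (k1 i) / real (N i))" if i: "i \<ge> max i0 (max i1 i2)" for i
      proof -
        have Np: "real (N i) > 0" using N(2) by simp
        have "norm (x i (k2 i) - x i (k1 i) - real (k2 i - k1 i) *\<^sub>R ((1 / real (N i)) *\<^sub>R G)) \<le> (\<epsilon> / real (N i)) * real (k2 i - k1 i)"
        proof (rule norm_sum_increments[OF _ k12(1)])
          fix l assume l: "k1 i \<le> l" "l < k2 i"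
          have lN: "l < N i" using l k12(2)[of i] by simp
          have "s1 * real (N i) - 1 < real (k1 i)" unfolding k1_def by linarith
          then have "(s1 * real (N i) - 1) / real (N i) < real (k1 i) / real (N i)"
            using Np by (rule divide_strict_right_mono)
          then have "s1 - 1 / real (N i) < real (k1 i) / real (N i)" using Np by (simp add: diff_divide_distrib)
          also have "\<dots> \<le> real l / real (N i)" using l by (simp add: divide_right_mono)
          finally have lo: "s1 - \<delta> < real l / real (N i)" using i2[of i] i by simp
          have "real (k2 i) \<le> s2 * real (N i)" unfolding k2_def using s12 Np by simp
          then have "real l \<le> s2 * real (N i)" using l by linarith
          then have "real l / real (N i) \<le> s2" using Np by (simp add: field_simps)
          then have ls: "\<bar>real l / real (N i) - s\<bar> < 2 * \<delta>" using lo s12 by linarith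
          have "real l / real (N i) \<in> {0..1}" using lN Np by simp
          then have "dist (X (real l / real (N i))) (X s) < \<eta>/2"
            using \<theta>(2) ls \<delta>(3) by (simp add: dist_real_def)
          then have "dist (x i l) (X s) < \<eta>"
            using i1[of i l] i lN dist_triangle[of "x i l" "X s" "X (real l / real (N i))"] by simp
          then have "dist (f i l (x i l)) G < \<epsilon>"
            using i0[of i l "x i l"] i lN ls \<delta>(2) by simp
          moreover have "x i (Suc l) - x i l - (1 / real (N i)) *\<^sub>R G = (1 / real (N i)) *\<^sub>R (f i l (x i l) - G)"
            using step[OF lN] by (simp add: algebra_simps)
          ultimately show "norm (x i (Suc l) - x i l - (1 / real (N i)) *\<^sub>R G) \<le> \<epsilon> / real (N i)"
            using Np by (simp add: dist_norm divide_right_mono)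
        qed
        moreover have "real (k2 i - k1 i) *\<^sub>R ((1 / real (N i)) *\<^sub>R G) = (real (k2 i) / real (N i) - real (k1 i) / real (N i)) *\<^sub>R G"
          using k12(1)[of i] by (simp add: of_nat_diff diff_divide_distrib)
        moreover have "(\<epsilon> / real (N i)) * real (k2 i - k1 i) = \<epsilon> * (real (k2 i) / real (N i) - real (k1 i) / real (N i))"
          using k12(1)[of i] by (simp add: of_nat_diff diff_divide_distrib right_diff_distrib)
        ultimately show ?thesis by metis
      qed
      then have ev: "\<exists>M. \<forall>i\<ge>M. norm (x i (k2 i) - x i (k1 i) - (real (k2 i) / real (N i) - real (k1 i) / real (N i)) *\<^sub>R G)
         \<le> \<epsilon> * (real (k2 i) / real (N i) - real (k1 i) / real (N i))" by blast
      show ?thesis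
      proof (rule LIMSEQ_le[OF _ _ ev])
        show "(\<lambda>i. norm (x i (k2 i) - x i (k1 i) - (real (k2 i) / real (N i) - real (k1 i) / real (N i)) *\<^sub>R G))
           \<longlonglongrightarrow> norm (X s2 - X s1 - (s2 - s1) *\<^sub>R G)"
          using s12 k12 order_trans[OF k12] by (intro tendsto_intros Xlim lim) auto
        show "(\<lambda>i. \<epsilon> * (real (k2 i) / real (N i) - real (k1 i) / real (N i))) \<longlonglongrightarrow> \<epsilon> * (s2 - s1)"
          by (intro tendsto_intros lim)
      qed
    qed
    then show ?thesis using \<delta>(1) by blast
  qed
  show ?thesis
    unfolding has_vector_derivative_def has_derivative_within_alt G_def[symmetric]
  proof (intro conjI allI impI)
    show "bounded_linear (\<lambda>h. h *\<^sub>R G)" by (rule bounded_linear_scaleR_left)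
    fix e :: real assume "e > 0"
    from key[OF this] obtain \<delta> where \<delta>: "\<delta> > 0" and
      K: "\<And>s1 s2. 0 \<le> s1 \<Longrightarrow> s1 \<le> s2 \<Longrightarrow> s2 \<le> 1 \<Longrightarrow> \<bar>s1 - s\<bar> < \<delta> \<Longrightarrow> \<bar>s2 - s\<bar> < \<delta> \<Longrightarrow>
       norm (X s2 - X s1 - (s2 - s1) *\<^sub>R G) \<le> e * (s2 - s1)" by blast
    have "norm (X y - X s - (y - s) *\<^sub>R G) \<le> e * norm (y - s)" if y: "y \<in> {0..1}" "norm (y - s) < \<delta>" for y
    proof (cases "s \<le> y")
      case True then show ?thesis using K[of s y] y s \<delta> by simp
    next
      case False
      have "norm (X y - X s - (y - s) *\<^sub>R G) = norm (X s - X y - (s - y) *\<^sub>R G)"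
        by (subst norm_minus_cancel[symmetric]) (simp add: algebra_simps)
      then show ?thesis using K[of y s] y s \<delta> False by simp
    qed
    then show "\<exists>d>0. \<forall>y\<in>{0..1}. norm (y - s) < d \<longrightarrow> norm (X y - X s - (y - s) *\<^sub>R G) \<le> e * norm (y - s)"
      using \<delta> by blast
  qed
qed

text \<open>Bounded increments make the interpolating polygons equi-Lipschitz, so Arzela-Ascoli
  yields a uniformly convergent subsequence, and its limit solves the equation by
  \<open>grid_limit_solves\<close>. At this stage the limit equation may have several solutions, so
  only a subsequence is obtained.\<close>

lemma euler_subsequence_limit:
  fixes x :: "nat \<Rightarrow> nat \<Rightarrow> 'b::euclidean_space"
  assumes N: "filterlim N at_top sequentially" "\<And>i. N i > 0"
    and step: "\<And>i k. k < N i \<Longrightarrow> x i (Suc k) = x i k + (1 / real (N i)) *\<^sub>R f i k (x i k)"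
    and bnd: "\<And>i k. k < N i \<Longrightarrow> norm (f i k (x i k)) \<le> B"
    and init: "(\<lambda>i. x i 0) \<longlonglongrightarrow> x0"
    and conv: "\<And>s y \<epsilon>. 0 \<le> s \<Longrightarrow> s \<le> 1 \<Longrightarrow> \<epsilon> > 0 \<Longrightarrow> \<exists>\<eta>>0. \<exists>i0. \<forall>i\<ge>i0. \<forall>k<N i. \<forall>y'.
        \<bar>real k / real (N i) - s\<bar> < \<eta> \<longrightarrow> dist y' y < \<eta> \<longrightarrow> dist (f i k y') (g s y) < \<epsilon>"
  shows "\<exists>(\<rho> :: nat \<Rightarrow> nat) X. strict_mono \<rho> \<and> X 0 = x0 \<and>
    (\<forall>s. 0 \<le> s \<and> s \<le> 1 \<longrightarrow> (X has_vector_derivative g s (X s)) (at s within {0..1})) \<and>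
    (\<forall>\<epsilon>>0. \<exists>i0. \<forall>i\<ge>i0. \<forall>k\<le>N (\<rho> i). dist (x (\<rho> i) k) (X (real k / real (N (\<rho> i)))) < \<epsilon>)"
proof -
  \<comment> \<open>Recursion and bound are available for \<open>k < N i\<close>; freezing the
    sequence afterwards makes every increment small.\<close>
  define z where "z i k = x i (min k (N i))" for i k
  define P where "P i s = polygon (z i) (s * real (N i))" for i s
  have B0: "B \<ge> 0" using bnd[OF N(2)] norm_ge_zero order_trans by blast
  have zstep: "norm (z i (Suc k) - z i k) \<le> B / real (N i)" for i k
  proof (cases "k < N i")
    case True
    then show ?thesis using step[OF True] bnd[OF True] by (simp add: z_def min_def divide_right_mono)
  qed (use B0 in \<open>simp add: z_def min_def\<close>)
  have lip: "norm (P i s - P i t) \<le> B * \<bar>s - t\<bar>" if st: "s \<in> {0..1}" "t \<in> {0..1}" for i s t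
  proof -
    have *: "norm (P i s - P i t) \<le> B * (t - s)" if "s \<in> {0..1}" "s \<le> t" for s t
    proof -
      have "norm (P i s - P i t) \<le> (B / real (N i)) * (t * real (N i) - s * real (N i))"
        unfolding P_def using that by (intro polygon_lipschitz zstep mult_right_mono) auto
      also have "\<dots> = B * (t - s)" using N(2)[of i] by (simp add: field_simps)
      finally show ?thesis .
    qed
    show ?thesis using *[of s t] *[of t s] st by (cases "s \<le> t") (auto simp: norm_minus_commute)
  qed
  have "Bseq (\<lambda>i. x i 0)" by (rule convergent_imp_Bseq[OF convergentI[OF init]])
  then obtain M where M: "\<And>i. norm (x i 0) \<le> M" unfolding Bseq_def by blast
  obtain X \<rho> where X: "continuous_on {0..1::real} X" and \<rho>: "strict_mono (\<rho> :: nat \<Rightarrow> nat)"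
    and unif: "\<And>e. 0 < e \<Longrightarrow> \<exists>n0. \<forall>n s. n \<ge> n0 \<and> s \<in> {0..1} \<longrightarrow> norm (P (\<rho> n) s - X s) < e"
  proof (rule Arzela_Ascoli[of "{0..1::real}" P "M + B"])
    show "norm (P n s) \<le> M + B" if s: "s \<in> {0..1}" for n s
    proof -
      have "norm (P n s - P n 0) \<le> B * \<bar>s - 0\<bar>" using s by (intro lip) auto
      also have "\<dots> \<le> B" using s B0 by (simp add: mult_left_le)
      finally have "norm (P n s - P n 0) \<le> B" .
      moreover have "P n 0 = x n 0" using polygon_of_nat[of "z n" 0] by (simp add: P_def z_def)
      ultimately show ?thesis using M[of n] norm_triangle_sub[of "P n s" "P n 0"] by simp
    qed
    show "\<exists>d>0. \<forall>n y. y \<in> {0..1} \<and> norm (s - y) < d \<longrightarrow> norm (P n s - P n y) < e" if s: "s \<in> {0..1}" "0 < e" for s e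
    \<comment> \<open>The Lipschitz constant \<open>B\<close> may be 0, hence the divisor
      \<open>B + 1\<close>.\<close>
    proof (intro exI[of _ "e / (B + 1)"] conjI allI impI)
      show "e / (B + 1) > 0" using s B0 by simp
      fix n y assume y: "y \<in> {0..1} \<and> norm (s - y) < e / (B + 1)"
      have "norm (P n s - P n y) \<le> B * \<bar>s - y\<bar>" using s y by (intro lip) auto
      also have "\<dots> \<le> (B + 1) * \<bar>s - y\<bar>" by (intro mult_right_mono) auto
      also have "\<dots> < e" using y B0 by (simp add: field_simps)
      finally show "norm (P n s - P n y) < e" .
    qed
  qed auto
  have N': "filterlim (\<lambda>i. N (\<rho> i)) at_top sequentially"
    using filterlim_compose[OF N(1) filterlim_subseq[OF \<rho>]] .
  have unif': "\<exists>i0. \<forall>i\<ge>i0. \<forall>k\<le>N (\<rho> i). dist (x (\<rho> i) k) (X (real k / real (N (\<rho> i)))) < \<epsilon>"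
    if e: "\<epsilon> > 0" for \<epsilon>
  proof -
    obtain n0 where n0: "\<And>n s. n \<ge> n0 \<Longrightarrow> s \<in> {0..1} \<Longrightarrow> norm (P (\<rho> n) s - X s) < \<epsilon>"
      using unif[OF e] by blast
    have "dist (x (\<rho> i) k) (X (real k / real (N (\<rho> i)))) < \<epsilon>" if i: "i \<ge> n0" "k \<le> N (\<rho> i)" for i k
    proof -
      have "real k / real (N (\<rho> i)) \<in> {0..1}" using i N(2)[of "\<rho> i"] by simp
      moreover have "P (\<rho> i) (real k / real (N (\<rho> i))) = x (\<rho> i) k"
        using N(2)[of "\<rho> i"] i by (simp add: P_def z_def min_def)
      ultimately show ?thesis using n0[OF i(1)] by (metis dist_norm)
    qed
    then show ?thesis by blast
  qed
  have der: "(X has_vector_derivative g s (X s)) (at s within {0..1})" if s: "0 \<le> s" "s \<le> 1" for s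
  proof (rule grid_limit_solves[where x = "\<lambda>i. x (\<rho> i)" and N = "\<lambda>i. N (\<rho> i)" and f = "\<lambda>i. f (\<rho> i)"])
    show "filterlim (\<lambda>i. N (\<rho> i)) at_top sequentially" "continuous_on {0..1} X" "0 \<le> s" "s \<le> 1"
      "\<And>i. N (\<rho> i) > 0" using N' N(2) X s by auto
    show "\<exists>i0. \<forall>i\<ge>i0. \<forall>k\<le>N (\<rho> i). dist (x (\<rho> i) k) (X (real k / real (N (\<rho> i)))) < \<epsilon>" if "\<epsilon> > 0" for \<epsilon>
      by (rule unif'[OF that])
    show "x (\<rho> i) (Suc k) = x (\<rho> i) k + (1 / real (N (\<rho> i))) *\<^sub>R f (\<rho> i) k (x (\<rho> i) k)" if "k < N (\<rho> i)" for i k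
      using step[OF that] .
    show "\<exists>\<eta>>0. \<exists>i0. \<forall>i\<ge>i0. \<forall>k<N (\<rho> i). \<forall>y. \<bar>real k / real (N (\<rho> i)) - s\<bar> < \<eta> \<longrightarrow>
       dist y (X s) < \<eta> \<longrightarrow> dist (f (\<rho> i) k y) (g s (X s)) < \<epsilon>" if s: "0 \<le> s" "s \<le> 1" "\<epsilon> > 0" for s \<epsilon>
    proof -
      obtain \<eta> i0 where *: "\<eta> > 0" "\<forall>i\<ge>i0. \<forall>k<N i. \<forall>y. \<bar>real k / real (N i) - s\<bar> < \<eta> \<longrightarrow>
         dist y (X s) < \<eta> \<longrightarrow> dist (f i k y) (g s (X s)) < \<epsilon>"
        using conv[OF s, of "X s"] by auto
      have "\<rho> i \<ge> i0" if "i \<ge> i0" for i using seq_suble[OF \<rho>, of i] that by linarith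
      then show ?thesis using * by blast
    qed
  qed
  have "X 0 = x0"
  proof (rule LIMSEQ_unique)
    show "(\<lambda>i. x (\<rho> i) 0) \<longlonglongrightarrow> x0" using LIMSEQ_subseq_LIMSEQ[OF init \<rho>] by (simp add: o_def)
    show "(\<lambda>i. x (\<rho> i) 0) \<longlonglongrightarrow> X 0"
    proof (rule metric_LIMSEQ_I)
      fix e :: real assume "e > 0"
      from unif'[OF this] show "\<exists>no. \<forall>n\<ge>no. dist (x (\<rho> n) 0) (X 0) < e" by fastforce
    qed
  qed
  then show ?thesis
    by (intro exI[of _ \<rho>] exI[of _ X] conjI allI impI \<rho> unif' der) auto
qed

section \<open>Convergence of the array of all iterates\<close>

text \<open>Three limits at once: the step number n tends to infinity, the time k/n to
  \<open>s\<close>, and the initial value to \<open>z\<close> inside \<open>D\<close>. Encoding them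
  as one filter makes the rules for \<open>Ck_conv\<close> available for the array of
  iterates.\<close>

definition grid_filter :: "'a::metric_space set \<Rightarrow> real \<Rightarrow> 'a \<Rightarrow> ((nat \<times> nat) \<times> 'a) filter" where
  "grid_filter D s z = (INF e\<in>{0<..}. principal {((n, k), z') |n k z'. 0 < n \<and> k \<le> n \<and> z' \<in> D \<and>
     1 / real n < e \<and> \<bar>real k / real n - s\<bar> < e \<and> dist z' z < e})"

text \<open>All times in [0,1] belong to the family, since an iterate depends on the coefficients at
  every earlier time.\<close>

definition grid_filters :: "'a::metric_space set \<Rightarrow> ((nat \<times> nat) \<times> 'a) filter set" where
  "grid_filters D = {grid_filter D s z |s z. 0 \<le> s \<and> s \<le> 1 \<and> z \<in> D}"

lemma eventually_grid:
  "eventually P (grid_filter D s z) \<longleftrightarrow> (\<exists>e>0. \<forall>n k z'. 0 < n \<longrightarrow> k \<le> n \<longrightarrow> z' \<in> D \<longrightarrow>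
     1 / real n < e \<longrightarrow> \<bar>real k / real n - s\<bar> < e \<longrightarrow> dist z' z < e \<longrightarrow> P ((n, k), z'))"
  unfolding grid_filter_def
proof (subst eventually_INF_base)
  fix a b :: real assume "a \<in> {0<..}" "b \<in> {0<..}"
  then show "\<exists>x\<in>{0<..}. principal {((n, k), z') |n k z'. 0 < n \<and> k \<le> n \<and> z' \<in> D \<and>
     1 / real n < x \<and> \<bar>real k / real n - s\<bar> < x \<and> dist z' z < x}
    \<le> inf (principal {((n, k), z') |n k z'. 0 < n \<and> k \<le> n \<and> z' \<in> D \<and>
     1 / real n < a \<and> \<bar>real k / real n - s\<bar> < a \<and> dist z' z < a})
     (principal {((n, k), z') |n k z'. 0 < n \<and> k \<le> n \<and> z' \<in> D \<and>
     1 / real n < b \<and> \<bar>real k / real n - s\<bar> < b \<and> dist z' z < b})"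
    by (intro bexI[of _ "min a b"]) auto
qed (auto simp: eventually_principal Bex_def)

text \<open>The nodes floor(s n)/n approach every \<open>s\<close>. Non-triviality of the filter
  lets bounds on an array pass to its limits.\<close>

lemma grid_filter_ne_bot:
  assumes "z \<in> D" "0 \<le> s" "s \<le> 1"
  shows "grid_filter D s z \<noteq> bot"
proof -
  have "\<exists>n k. 0 < n \<and> k \<le> n \<and> 1 / real n < e \<and> \<bar>real k / real n - s\<bar> < e" if e: "e > 0" for e
  proof -
    obtain n0 where n0: "n0 > 0" "1 / real n0 < e" using e by (metis nat_approx_posE of_nat_Suc zero_less_Suc)
    define k where "k = nat \<lfloor>s * real n0\<rfloor>"
    have "real k \<le> s * real n0" "s * real n0 < real k + 1" using assms n0 by (auto simp: k_def)
    moreover from this have "real k / real n0 \<le> s" "s < real k / real n0 + 1 / real n0"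
      using n0 by (auto simp: field_simps)
    moreover have "k \<le> n0"
    proof -
      have "s * real n0 \<le> 1 * real n0" using assms by (intro mult_right_mono) auto
      then show ?thesis using \<open>real k \<le> s * real n0\<close> by simp
    qed
    ultimately show ?thesis using n0 by (intro exI[of _ n0] exI[of _ k]) auto
  qed
  then have "\<not> eventually (\<lambda>_. False) (grid_filter D s z)"
    unfolding eventually_grid using assms(1) by (auto, metis dist_self)
  then show ?thesis by (auto simp: trivial_limit_def)
qed

lemma grid_filter_tendsto_index: "filterlim (\<lambda>x. fst (fst x)) sequentially (grid_filter D s z)"
  unfolding filterlim_at_top eventually_grid
proof
  fix M :: nat
  have "M \<le> n" if "1 / real n < 1 / (real M + 1)" "n > 0" for n
    using that by (simp add: field_simps)
  then show "\<exists>e>0. \<forall>n k z'. 0 < n \<longrightarrow> k \<le> n \<longrightarrow> z' \<in> D \<longrightarrow> 1 / real n < e \<longrightarrow> \<bar>real k / real n - s\<bar> < e \<longrightarrow>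
     dist z' z < e \<longrightarrow> M \<le> fst (fst ((n, k), z'))"
    by (intro exI[of _ "1 / (real M + 1)"]) auto
qed

text \<open>Subsequence principle: if the limit failed, some sequence of grids, step counts and
  initial values would keep a fixed distance from \<open>l\<close>, and so would each of its
  subsequences.\<close>

lemma tendsto_gridI:
  fixes Y :: "nat \<times> nat \<Rightarrow> 'a::metric_space \<Rightarrow> 'b::metric_space"
  assumes "\<And>N k \<zeta>. filterlim N at_top sequentially \<Longrightarrow> (\<And>i. 0 < N i) \<Longrightarrow> (\<And>i. k i \<le> N i) \<Longrightarrow>
     (\<lambda>i. real (k i) / real (N i)) \<longlonglongrightarrow> s \<Longrightarrow> (\<And>i. \<zeta> i \<in> D) \<Longrightarrow> \<zeta> \<longlonglongrightarrow> z \<Longrightarrow>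
     \<exists>\<rho>::nat \<Rightarrow> nat. strict_mono \<rho> \<and> (\<lambda>i. Y (N (\<rho> i), k (\<rho> i)) (\<zeta> (\<rho> i))) \<longlonglongrightarrow> l"
  shows "((\<lambda>(p, z). Y p z) \<longlongrightarrow> l) (grid_filter D s z)"
proof (rule ccontr)
  assume "\<not> ?thesis"
  then obtain \<epsilon> where e: "\<epsilon> > 0" and ne: "\<not> eventually (\<lambda>(p, z). dist (Y p z) l < \<epsilon>) (grid_filter D s z)"
    unfolding tendsto_iff by (auto simp: case_prod_unfold)
  have "\<exists>n k z'. 0 < n \<and> k \<le> n \<and> z' \<in> D \<and> 1 / real n < 1 / real (Suc i) \<and>
     \<bar>real k / real n - s\<bar> < 1 / real (Suc i) \<and> dist z' z < 1 / real (Suc i) \<and> \<not> dist (Y (n, k) z') l < \<epsilon>" for i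
    using ne unfolding eventually_grid by (auto simp del: of_nat_Suc dest!: spec[of _ "1 / real (Suc i)"])
  then obtain N k \<zeta> where *: "\<And>i. 0 < N i" "\<And>i. k i \<le> N i" "\<And>i. \<zeta> i \<in> D" "\<And>i. 1 / real (N i) < 1 / real (Suc i)"
     "\<And>i. \<bar>real (k i) / real (N i) - s\<bar> < 1 / real (Suc i)" "\<And>i. dist (\<zeta> i) z < 1 / real (Suc i)"
     "\<And>i. \<not> dist (Y (N i, k i) (\<zeta> i)) l < \<epsilon>" by metis
  have "i \<le> N i" for i using *(1,4)[of i] by (simp add: field_simps)
  then have N: "filterlim N at_top sequentially"
    by (intro filterlim_at_top_mono[OF filterlim_ident always_eventually]) simp
  have inv: "(\<lambda>i. 1 / real (Suc i)) \<longlonglongrightarrow> 0" by (rule LIMSEQ_Suc[OF lim_1_over_n])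
  have k: "(\<lambda>i. real (k i) / real (N i)) \<longlonglongrightarrow> s"
    by (rule metric_tendsto_imp_tendsto[OF inv])
      (use *(5) in \<open>auto simp: dist_real_def intro!: always_eventually less_imp_le\<close>)
  have z: "\<zeta> \<longlonglongrightarrow> z"
    by (rule metric_tendsto_imp_tendsto[OF inv])
      (use *(6) in \<open>auto intro!: always_eventually less_imp_le\<close>)
  obtain \<rho> where "(\<lambda>i. Y (N (\<rho> i), k (\<rho> i)) (\<zeta> (\<rho> i))) \<longlonglongrightarrow> l"
    using assms[OF N *(1,2) k *(3) z] by blast
  from tendstoD[OF this e] have "\<forall>\<^sub>F i in sequentially. False"
    by eventually_elim (use *(7) in auto)
  then show False by simp
qed

text \<open>Compactness of the time interval. Neighbourhoods of finitely many times cover [0,1],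
  which turns properties known near each \<open>s\<close> into one that holds for all k \<le> n
  simultaneously, with finitely many parameters \<open>a\<close>.\<close>

lemma grid_finite_cover:
  assumes "\<And>s. 0 \<le> s \<Longrightarrow> s \<le> 1 \<Longrightarrow> \<exists>a. eventually (P a) (grid_filter D s z)"
  obtains A e where "finite A" "e > 0" "\<And>n k z'. 0 < n \<Longrightarrow> k \<le> n \<Longrightarrow> z' \<in> D \<Longrightarrow> 1 / real n < e \<Longrightarrow>
     dist z' z < e \<Longrightarrow> \<exists>a\<in>A. P a ((n, k), z')"
proof -
  have "\<exists>a e. e > 0 \<and> (\<forall>n k z'. 0 < n \<longrightarrow> k \<le> n \<longrightarrow> z' \<in> D \<longrightarrow>
     1 / real n < e \<longrightarrow> \<bar>real k / real n - s\<bar> < e \<longrightarrow> dist z' z < e \<longrightarrow> P a ((n, k), z'))" if "s \<in> {0..1}" for s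
    using assms[of s] that unfolding eventually_grid by auto
  then obtain a e where ae: "\<And>s. s \<in> {0..1} \<Longrightarrow> e s > 0" "\<And>s n k z'. s \<in> {0..1} \<Longrightarrow> 0 < n \<Longrightarrow> k \<le> n \<Longrightarrow> z' \<in> D \<Longrightarrow>
     1 / real n < e s \<Longrightarrow> \<bar>real k / real n - s\<bar> < e s \<Longrightarrow> dist z' z < e s \<Longrightarrow> P (a s) ((n, k), z')" by metis
  obtain C where C: "C \<subseteq> {0..1}" "finite C" "{0..1} \<subseteq> (\<Union>s\<in>C. ball s (e s))"
    by (rule compactE_image[of "{0..1::real}" "{0..1}" "\<lambda>s. ball s (e s)"]) (use ae(1) in auto)
  have "C \<noteq> {}" using C(3) by auto
  show ?thesis
  proof (rule that[of "a ` C" "Min (e ` C)"])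
    show "finite (a ` C)" using C by simp
    show "Min (e ` C) > 0" using C ae(1) \<open>C \<noteq> {}\<close> by (subst Min_gr_iff) auto
    fix n k :: nat and z' assume *: "0 < n" "k \<le> n" "z' \<in> D" "1 / real n < Min (e ` C)" "dist z' z < Min (e ` C)"
    have "real k / real n \<in> {0..1}" using * by simp
    then have "real k / real n \<in> (\<Union>s\<in>C. ball s (e s))" using C(3) by blast
    then obtain s where s: "s \<in> C" "\<bar>real k / real n - s\<bar> < e s"
      by (auto simp: dist_real_def abs_minus_commute)
    have "Min (e ` C) \<le> e s" using s C by simp
    then have "1 / real n < e s" "dist z' z < e s" using *(4,5) by linarith+
    then have "P (a s) ((n, k), z')" using * s C by (intro ae(2)) auto
    then show "\<exists>a\<in>a ` C. P a ((n, k), z')" using s by auto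
  qed
qed

lemma grid_bounded:
  fixes Y :: "nat \<times> nat \<Rightarrow> 'a::metric_space \<Rightarrow> 'b::real_normed_vector"
  assumes "\<And>s. 0 \<le> s \<Longrightarrow> s \<le> 1 \<Longrightarrow> \<exists>l. ((\<lambda>(p, z). Y p z) \<longlongrightarrow> l) (grid_filter D s z)"
  obtains B e where "B \<ge> 0" "e > 0" "\<And>n k z'. 0 < n \<Longrightarrow> k \<le> n \<Longrightarrow> z' \<in> D \<Longrightarrow> 1 / real n < e \<Longrightarrow>
     dist z' z < e \<Longrightarrow> norm (Y (n, k) z') \<le> B"
proof -
  have "\<exists>a. eventually (\<lambda>(p, z). norm (Y p z) \<le> a) (grid_filter D s z)" if s: "0 \<le> s" "s \<le> 1" for s
  proof -
    obtain l where l: "((\<lambda>(p, z). Y p z) \<longlongrightarrow> l) (grid_filter D s z)" using assms[OF s] by blast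
    have "eventually (\<lambda>(p, z). norm (Y p z) \<le> norm l + 1) (grid_filter D s z)"
      using tendstoD[OF l zero_less_one]
    proof (rule eventually_mono, clarify)
      fix n k z' assume "dist (Y (n, k) z') l < 1"
      then show "norm (Y (n, k) z') \<le> norm l + 1"
        using norm_triangle_sub[of "Y (n, k) z'" l] by (simp add: dist_norm)
    qed
    then show ?thesis by blast
  qed
  then obtain A e where A: "finite A" "e > 0" "\<And>n k z'. 0 < n \<Longrightarrow> k \<le> n \<Longrightarrow> z' \<in> D \<Longrightarrow> 1 / real n < e \<Longrightarrow>
     dist z' z < e \<Longrightarrow> \<exists>a\<in>A. norm (Y (n, k) z') \<le> a"
    using grid_finite_cover[of "\<lambda>a (p, z). norm (Y p z) \<le> a" D z] by auto
  show ?thesis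
  proof (rule that[of "Max (insert 0 A)" e])
    show "norm (Y (n, k) z') \<le> Max (insert 0 A)" if *: "0 < n" "k \<le> n" "z' \<in> D" "1 / real n < e" "dist z' z < e" for n k z'
    proof -
      obtain a where "a \<in> A" "norm (Y (n, k) z') \<le> a" using A(3)[OF *] by blast
      moreover from this have "a \<le> Max (insert 0 A)" using A(1) by simp
      ultimately show ?thesis by linarith
    qed
  qed (use A in auto)
qed

text \<open>The step bound is available only on fine grids and for initial values near
  \<open>z\<close>, so finitely many members of the sequence are dropped before compactness is
  applied. The subsequence found serves every choice of step counts \<open>k\<close> at
  once.\<close>

lemma grid_euler_subsequence:
  fixes x :: "nat \<times> nat \<Rightarrow> 'a::metric_space \<Rightarrow> 'b::euclidean_space"
  assumes step: "\<And>n k z'. k < n \<Longrightarrow> z' \<in> D \<Longrightarrow>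
      x (n, Suc k) z' = x (n, k) z' + (1 / real n) *\<^sub>R f (n, k) z' (x (n, k) z')"
    and bnd: "e > 0" "\<And>n k z'. k < n \<Longrightarrow> z' \<in> D \<Longrightarrow> 1 / real n < e \<Longrightarrow> dist z' z < e \<Longrightarrow>
      norm (f (n, k) z' (x (n, k) z')) \<le> B"
    and conv: "\<And>s y. 0 \<le> s \<Longrightarrow> s \<le> 1 \<Longrightarrow>
      ((\<lambda>((p, z'), y'). f p z' y') \<longlongrightarrow> g s y) (grid_filter D s z \<times>\<^sub>F nhds y)"
    and N: "filterlim N at_top sequentially" "\<And>i. 0 < N i"
    and \<zeta>: "\<And>i. \<zeta> i \<in> D" "\<zeta> \<longlonglongrightarrow> z"
    and init: "(\<lambda>i. x (N i, 0) (\<zeta> i)) \<longlonglongrightarrow> x0"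
  shows "\<exists>(\<rho> :: nat \<Rightarrow> nat) X. strict_mono \<rho> \<and> X 0 = x0 \<and>
    (\<forall>s. 0 \<le> s \<and> s \<le> 1 \<longrightarrow> (X has_vector_derivative g s (X s)) (at s within {0..1})) \<and>
    (\<forall>k s. (\<forall>i. k i \<le> N i) \<and> (\<lambda>i. real (k i) / real (N i)) \<longlonglongrightarrow> s \<and> 0 \<le> s \<and> s \<le> 1 \<longrightarrow>
       (\<lambda>i. x (N (\<rho> i), k (\<rho> i)) (\<zeta> (\<rho> i))) \<longlonglongrightarrow> X s)"
proof -
  have inv: "(\<lambda>i. 1 / real (N i)) \<longlonglongrightarrow> 0"
    using filterlim_compose[OF lim_1_over_n N(1)] by simp
  have small: "\<exists>i0. \<forall>i\<ge>i0. 1 / real (N i) < e \<and> dist (\<zeta> i) z < e" if "e > 0" for e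
    using eventually_conj[OF order_tendstoD(2)[OF inv that] tendstoD[OF \<zeta>(2) that]]
    unfolding eventually_sequentially .
  obtain j where j: "\<And>i. i \<ge> j \<Longrightarrow> 1 / real (N i) < e \<and> dist (\<zeta> i) z < e" using small[OF bnd(1)] by blast
  define N' \<zeta>' where "N' i = N (i + j)" and "\<zeta>' i = \<zeta> (i + j)" for i
  have N': "filterlim N' at_top sequentially" "\<And>i. N' i > 0"
    using N(2) filterlim_compose[OF N(1) filterlim_add_const_nat_at_top[of j]] by (auto simp: N'_def[abs_def])
  have "\<exists>(\<rho> :: nat \<Rightarrow> nat) X. strict_mono \<rho> \<and> X 0 = x0 \<and>
    (\<forall>s. 0 \<le> s \<and> s \<le> 1 \<longrightarrow> (X has_vector_derivative g s (X s)) (at s within {0..1})) \<and>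
    (\<forall>\<epsilon>>0. \<exists>i0. \<forall>i\<ge>i0. \<forall>k\<le>N' (\<rho> i). dist (x (N' (\<rho> i), k) (\<zeta>' (\<rho> i))) (X (real k / real (N' (\<rho> i)))) < \<epsilon>)"
  proof (rule euler_subsequence_limit[where x = "\<lambda>i k. x (N' i, k) (\<zeta>' i)" and N = N'
       and f = "\<lambda>i k. f (N' i, k) (\<zeta>' i)" and g = g and B = B and ?x0.0 = x0])
    show "filterlim N' at_top sequentially" "\<And>i. N' i > 0" by (rule N')+
    show "x (N' i, Suc k) (\<zeta>' i) = x (N' i, k) (\<zeta>' i) + (1 / real (N' i)) *\<^sub>R f (N' i, k) (\<zeta>' i) (x (N' i, k) (\<zeta>' i))"
      if "k < N' i" for i k using step[OF that] \<zeta>(1) by (simp add: \<zeta>'_def)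
    show "norm (f (N' i, k) (\<zeta>' i) (x (N' i, k) (\<zeta>' i))) \<le> B" if "k < N' i" for i k
      using bnd(2)[OF that] \<zeta>(1) j[of "i + j"] by (simp add: \<zeta>'_def N'_def)
    show "(\<lambda>i. x (N' i, 0) (\<zeta>' i)) \<longlonglongrightarrow> x0"
      using LIMSEQ_ignore_initial_segment[OF init, of j] by (simp add: N'_def \<zeta>'_def)
    show "\<exists>\<eta>>0. \<exists>i0. \<forall>i\<ge>i0. \<forall>k<N' i. \<forall>y'. \<bar>real k / real (N' i) - s\<bar> < \<eta> \<longrightarrow> dist y' y < \<eta> \<longrightarrow>
       dist (f (N' i, k) (\<zeta>' i) y') (g s y) < \<epsilon>" if s: "0 \<le> s" "s \<le> 1" and \<epsilon>: "\<epsilon> > 0" for s y \<epsilon>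
    proof -
      obtain P Q where P: "eventually P (grid_filter D s z)" and Q: "eventually Q (nhds y)"
        and PQ: "\<And>p y'. P p \<Longrightarrow> Q y' \<Longrightarrow> dist (f (fst p) (snd p) y') (g s y) < \<epsilon>"
        using tendstoD[OF conv[OF s, of y] \<epsilon>] unfolding eventually_prod_filter by (auto simp: case_prod_unfold)
      obtain e1 where e1: "e1 > 0" "\<And>n k z'. 0 < n \<Longrightarrow> k \<le> n \<Longrightarrow> z' \<in> D \<Longrightarrow> 1 / real n < e1 \<Longrightarrow>
          \<bar>real k / real n - s\<bar> < e1 \<Longrightarrow> dist z' z < e1 \<Longrightarrow> P ((n, k), z')"
        using P unfolding eventually_grid by auto
      obtain e2 where e2: "e2 > 0" "\<And>y'. dist y' y < e2 \<Longrightarrow> Q y'" using Q unfolding eventually_nhds_metric by auto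
      obtain i0 where i0: "\<And>i. i \<ge> i0 \<Longrightarrow> 1 / real (N i) < e1 \<and> dist (\<zeta> i) z < e1" using small[OF e1(1)] by blast
      show ?thesis
      proof (intro exI[of _ "min e1 e2"] exI[of _ i0] conjI allI impI)
        show "min e1 e2 > 0" using e1 e2 by simp
        fix i k y' assume *: "i0 \<le> i" "k < N' i" "\<bar>real k / real (N' i) - s\<bar> < min e1 e2" "dist y' y < min e1 e2"
        have "P ((N' i, k), \<zeta>' i)" using e1(2)[of "N' i" k "\<zeta>' i"] * i0[of "i + j"] N'(2)[of i] \<zeta>(1)
          by (simp add: N'_def \<zeta>'_def)
        moreover have "Q y'" using * e2 by simp
        ultimately show "dist (f (N' i, k) (\<zeta>' i) y') (g s y) < \<epsilon>" using PQ by fastforce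
      qed
    qed
  qed
  then obtain \<rho> :: "nat \<Rightarrow> nat" and X where \<rho>: "strict_mono \<rho>" and X0: "X 0 = x0" and
    der: "\<And>s. 0 \<le> s \<and> s \<le> 1 \<Longrightarrow> (X has_vector_derivative g s (X s)) (at s within {0..1})"
    and unif: "\<forall>\<epsilon>>0. \<exists>i0. \<forall>i\<ge>i0. \<forall>k\<le>N' (\<rho> i).
       dist (x (N' (\<rho> i), k) (\<zeta>' (\<rho> i))) (X (real k / real (N' (\<rho> i)))) < \<epsilon>" by blast
  have cont: "continuous_on {0..1} X"
    by (rule continuous_on_vector_derivative) (use der in auto)
  show ?thesis
  proof (intro exI[of _ "\<lambda>i. \<rho> i + j"] exI[of _ X] conjI allI impI X0 der)
    show "strict_mono (\<lambda>i. \<rho> i + j)" using \<rho> by (simp add: strict_mono_def)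
    fix k s assume "(\<forall>i. k i \<le> N i) \<and> (\<lambda>i. real (k i) / real (N i)) \<longlonglongrightarrow> s \<and> 0 \<le> s \<and> s \<le> (1::real)"
    then have k: "\<And>i. k i \<le> N i" "(\<lambda>i. real (k i) / real (N i)) \<longlonglongrightarrow> s" and s: "0 \<le> s" "s \<le> 1" by auto
    have sm: "strict_mono (\<lambda>i. \<rho> i + j)" using \<rho> by (simp add: strict_mono_def)
    have "(\<lambda>i. real (k (\<rho> i + j)) / real (N (\<rho> i + j))) \<longlonglongrightarrow> s"
      using LIMSEQ_subseq_LIMSEQ[OF k(2) sm] by (simp add: o_def)
    then have 1: "(\<lambda>i. X (real (k (\<rho> i + j)) / real (N (\<rho> i + j)))) \<longlonglongrightarrow> X s"
      by (rule continuous_on_tendsto_compose[OF cont]) (use s k(1) N(2) in auto)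
    have "(\<lambda>i. x (N (\<rho> i + j), k (\<rho> i + j)) (\<zeta> (\<rho> i + j)) - X (real (k (\<rho> i + j)) / real (N (\<rho> i + j)))) \<longlonglongrightarrow> 0"
    proof (rule metric_LIMSEQ_I)
      fix \<epsilon> :: real assume "\<epsilon> > 0"
      with unif obtain i0 where "\<forall>i\<ge>i0. \<forall>k\<le>N' (\<rho> i).
         dist (x (N' (\<rho> i), k) (\<zeta>' (\<rho> i))) (X (real k / real (N' (\<rho> i)))) < \<epsilon>" by blast
      then show "\<exists>no. \<forall>n\<ge>no. dist (x (N (\<rho> n + j), k (\<rho> n + j)) (\<zeta> (\<rho> n + j)) - X (real (k (\<rho> n + j)) / real (N (\<rho> n + j)))) 0 < \<epsilon>"
        using k(1) by (auto simp: N'_def \<zeta>'_def dist_norm)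
    qed
    from tendsto_add[OF this 1]
    show "(\<lambda>i. x (N (\<rho> i + j), k (\<rho> i + j)) (\<zeta> (\<rho> i + j))) \<longlonglongrightarrow> X s" by simp
  qed auto
qed

section \<open>Linear recursions\<close>

text \<open>Gronwall's argument in differential form: the function exp(-2 A u) |W u|^2 has
  nonpositive derivative and starts at 0. Only a bound on \<open>W'\<close> is used, so the field
  may depend on time in any manner.\<close>

lemma linear_growth_zero:
  fixes W :: "real \<Rightarrow> 'b::real_inner"
  assumes der: "\<And>s. 0 \<le> s \<Longrightarrow> s \<le> 1 \<Longrightarrow> (W has_vector_derivative W' s) (at s within {0..1})"
    and bd: "\<And>s. 0 \<le> s \<Longrightarrow> s \<le> 1 \<Longrightarrow> norm (W' s) \<le> A * norm (W s)"
    and "W 0 = 0" "0 \<le> s" "s \<le> 1"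
  shows "W s = 0"
proof (cases "s = 0")
  case False
  then have s: "0 < s" "s \<le> 1" using assms by auto
  define \<phi> where "\<phi> u = exp (- 2 * A * u) * (W u \<bullet> W u)" for u
  define \<phi>' where "\<phi>' u = exp (- 2 * A * u) * (2 * (W u \<bullet> W' u) - 2 * A * (W u \<bullet> W u))" for u
  have d: "(\<phi> has_derivative (\<lambda>h. h * \<phi>' u)) (at u within {0..s})" if u: "0 \<le> u" "u \<le> s" for u
  proof -
    have "(W has_derivative (\<lambda>h. h *\<^sub>R W' u)) (at u within {0..s})"
      using der[of u] u s unfolding has_vector_derivative_def
      by (auto intro: has_derivative_subset)
    then show ?thesis unfolding \<phi>_def \<phi>'_def
      by (auto intro!: derivative_eq_intros simp: algebra_simps inner_commute)
  qed
  obtain u where u: "u \<in> {0<..<s}" "\<phi> s - \<phi> 0 = (s - 0) * \<phi>' u"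
    using mvt_simple[OF s(1), of \<phi> "\<lambda>u h. h * \<phi>' u"] d by auto
  have "W u \<bullet> W' u \<le> norm (W u) * norm (W' u)" by (rule norm_cauchy_schwarz)
  also have "\<dots> \<le> norm (W u) * (A * norm (W u))" using bd[of u] u s by (intro mult_left_mono) auto
  also have "\<dots> = A * (W u \<bullet> W u)" by (simp add: power2_norm_eq_inner[symmetric] power2_eq_square)
  finally have "\<phi>' u \<le> 0" unfolding \<phi>'_def by (intro mult_nonneg_nonpos) auto
  then have "\<phi> s \<le> \<phi> 0" using u s mult_nonneg_nonpos[of s "\<phi>' u"] by simp
  also have "\<phi> 0 = 0" by (simp add: \<phi>_def assms)
  finally have "W s \<bullet> W s \<le> 0" by (simp add: \<phi>_def mult_le_0_iff)
  then show ?thesis using inner_ge_zero[of "W s"] by (simp add: order_antisym_conv)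
qed (use assms in simp)

text \<open>A discrete Gronwall estimate bounds the iterates, so subsequences converge to solutions
  of a linear limit equation. Two of these differ by a solution of the homogeneous equation that
  starts at 0 and is therefore 0. Hence all subsequences have the same limit and the whole array
  converges.\<close>

lemma grid_linear_Ck_0:
  fixes m :: "'b \<Rightarrow> nat \<times> nat \<Rightarrow> 'a::euclidean_space \<Rightarrow> 'b::euclidean_space"
  assumes m: "\<And>c. c \<in> Basis \<Longrightarrow> Ck_conv 0 (grid_filters D) (m c)" and \<beta>: "Ck_conv 0 (grid_filters D) \<beta>"
    and rec: "\<And>n k z. Y (n, Suc k) z = Y (n, k) z + (1 / real n) *\<^sub>R
        ((\<Sum>c\<in>Basis. (Y (n, k) z \<bullet> c) *\<^sub>R m c (n, k) z) + \<beta> (n, k) z)"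
    and init: "\<And>n z. Y (n, 0) z = v0"
  shows "Ck_conv 0 (grid_filters D) Y"
proof (rule Ck_conv_0I)
  fix F assume "F \<in> grid_filters D"
  then obtain s0 z where F: "F = grid_filter D s0 z" and s0: "0 \<le> s0" "s0 \<le> 1" and z: "z \<in> D"
    unfolding grid_filters_def by auto
  have gF: "grid_filter D s z \<in> grid_filters D" if "0 \<le> s" "s \<le> 1" for s
    using that z unfolding grid_filters_def by blast
  have mlim: "\<exists>l. ((\<lambda>(p, z). m c p z) \<longlongrightarrow> l) (grid_filter D s z)" if "c \<in> Basis" "0 \<le> s" "s \<le> 1" for c s
    using Ck_conv_lim[OF m[OF that(1)] gF[OF that(2,3)]] by blast
  then obtain ml where ml: "\<And>c s. c \<in> Basis \<Longrightarrow> 0 \<le> s \<Longrightarrow> s \<le> 1 \<Longrightarrow>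
     ((\<lambda>(p, z). m c p z) \<longlongrightarrow> ml c s) (grid_filter D s z)" by metis
  have "\<exists>l. ((\<lambda>(p, z). \<beta> p z) \<longlongrightarrow> l) (grid_filter D s z)" if "0 \<le> s" "s \<le> 1" for s
    using Ck_conv_lim[OF \<beta> gF[OF that]] by blast
  then obtain \<beta>l where \<beta>l: "\<And>s. 0 \<le> s \<Longrightarrow> s \<le> 1 \<Longrightarrow> ((\<lambda>(p, z). \<beta> p z) \<longlongrightarrow> \<beta>l s) (grid_filter D s z)" by metis
  define f where "f p z' y = (\<Sum>c\<in>Basis. (y \<bullet> c) *\<^sub>R m c p z') + \<beta> p z'" for p z' y
  define g where "g s y = (\<Sum>c\<in>Basis. (y \<bullet> c) *\<^sub>R ml c s) + \<beta>l s" for s y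
  have "\<exists>A e. A \<ge> 0 \<and> e > 0 \<and> (\<forall>n k z'. 0 < n \<longrightarrow> k \<le> n \<longrightarrow> z' \<in> D \<longrightarrow> 1 / real n < e \<longrightarrow> dist z' z < e \<longrightarrow> norm (m c (n, k) z') \<le> A)"
    if "c \<in> Basis" for c
    using grid_bounded[of "m c" D z, OF mlim[OF that]] by metis
  then obtain A e where A: "\<And>c. c \<in> Basis \<Longrightarrow> A c \<ge> 0" "\<And>c. c \<in> Basis \<Longrightarrow> e c > 0"
    "\<And>c n k z'. c \<in> Basis \<Longrightarrow> 0 < n \<Longrightarrow> k \<le> n \<Longrightarrow> z' \<in> D \<Longrightarrow> 1 / real n < e c \<Longrightarrow> dist z' z < e c \<Longrightarrow> norm (m c (n, k) z') \<le> A c"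
    by metis
  obtain A' e' where A': "A' \<ge> 0" "e' > 0" "\<And>n k z'. 0 < n \<Longrightarrow> k \<le> n \<Longrightarrow> z' \<in> D \<Longrightarrow> 1 / real n < e' \<Longrightarrow> dist z' z < e' \<Longrightarrow> norm (\<beta> (n, k) z') \<le> A'"
    using grid_bounded[of \<beta> D z] \<beta>l by metis
  define \<theta> where "\<theta> = Min (insert e' (e ` Basis))"
  have \<theta>: "\<theta> > 0" "\<theta> \<le> e'" "\<And>c. c \<in> Basis \<Longrightarrow> \<theta> \<le> e c"
    using A(2) A'(2) unfolding \<theta>_def by (subst Min_gr_iff) (auto simp del: Min_insert intro!: Min_le)
  define M where "M = sum A Basis"
  have M0: "M \<ge> 0" unfolding M_def using A(1) by (rule sum_nonneg)
  have lin: "norm (\<Sum>c\<in>Basis. (y \<bullet> c) *\<^sub>R v c) \<le> M * norm y" if "\<And>c. c \<in> Basis \<Longrightarrow> norm (v c) \<le> A c" for v :: "'b \<Rightarrow> 'b" and y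
  proof -
    have "norm (\<Sum>c\<in>Basis. (y \<bullet> c) *\<^sub>R v c) \<le> (\<Sum>c\<in>Basis. norm y * A c)"
      by (rule sum_norm_le) (use that Basis_le_norm[of _ y] in \<open>auto intro!: mult_mono\<close>)
    then show ?thesis by (simp add: M_def sum_distrib_left mult.commute)
  qed
  define R where "R = M + A'"
  have fb: "norm (f (n, k) z' y) \<le> R * (norm y + 1)"
    if "0 < n" "k \<le> n" "z' \<in> D" "1 / real n < \<theta>" "dist z' z < \<theta>" for n k z' y
  proof -
    have "norm (f (n, k) z' y) \<le> M * norm y + A'" unfolding f_def
      using that \<theta> A(3)[of _ n k z'] A'(3)[of n k z'] by (intro norm_triangle_mono lin) force+
    also have "\<dots> \<le> R * (norm y + 1)" using M0 A'(1) by (simp add: R_def algebra_simps)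
    finally show ?thesis .
  qed
  have R0: "R \<ge> 0" using M0 A' by (simp add: R_def)
  \<comment> \<open>With 1 added, the norm grows by at most the factor 1 + R/n in each step, hence
    by at most exp R over k \<le> n steps.\<close>
  have Yb: "norm (Y (n, k) z') + 1 \<le> (norm v0 + 1) * exp R"
    if *: "0 < n" "k \<le> n" "z' \<in> D" "1 / real n < \<theta>" "dist z' z < \<theta>" for n k z'
  proof -
    have "norm (Y (n, k) z') + 1 \<le> (norm v0 + 1) * (1 + R / real n) ^ k" using \<open>k \<le> n\<close>
    proof (induction k)
      case (Suc k)
      have "norm (Y (n, Suc k) z') + 1 \<le> norm (Y (n, k) z') + norm ((1 / real n) *\<^sub>R f (n, k) z' (Y (n, k) z')) + 1"
        unfolding rec f_def by (intro add_mono norm_triangle_ineq) simp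
      also have "\<dots> \<le> norm (Y (n, k) z') + (R * (norm (Y (n, k) z') + 1)) / real n + 1"
        using fb[of n k z' "Y (n, k) z'"] * Suc(2) by (simp add: divide_right_mono)
      also have "\<dots> = (norm (Y (n, k) z') + 1) * (1 + R / real n)" by (simp add: algebra_simps add_divide_distrib)
      also have "\<dots> \<le> ((norm v0 + 1) * (1 + R / real n) ^ k) * (1 + R / real n)"
        using Suc R0 by (intro mult_right_mono) auto
      finally show ?case by (simp add: mult_ac)
    qed (simp add: init)
    also have "(1 + R / real n) ^ k \<le> (1 + R / real n) ^ n"
      using R0 that by (intro power_increasing) auto
    also have "\<dots> \<le> exp (R / real n) ^ n" using R0 by (intro power_mono exp_ge_add_one_self) auto
    also have "\<dots> = exp R" using \<open>0 < n\<close> by (simp add: exp_of_nat_mult[symmetric])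
    finally show ?thesis by (simp add: mult_left_mono)
  qed
  have step: "Y (n, Suc k) z' = Y (n, k) z' + (1 / real n) *\<^sub>R f (n, k) z' (Y (n, k) z')" for n k z'
    unfolding f_def by (rule rec)
  have bnd: "norm (f (n, k) z' (Y (n, k) z')) \<le> R * ((norm v0 + 1) * exp R)"
    if "k < n" "z' \<in> D" "1 / real n < \<theta>" "dist z' z < \<theta>" for n k z'
    by (rule order_trans[OF fb mult_left_mono[OF Yb R0]]) (use that in auto)
  have conv: "((\<lambda>((p, z'), y'). f p z' y') \<longlongrightarrow> g s y) (grid_filter D s z \<times>\<^sub>F nhds y)" if s: "0 \<le> s" "s \<le> 1" for s y
  proof -
    have 1: "((\<lambda>x. m c (fst (fst x)) (snd (fst x))) \<longlongrightarrow> ml c s) (grid_filter D s z \<times>\<^sub>F nhds y)" if "c \<in> Basis" for c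
      using filterlim_compose[OF ml[OF that s] filterlim_fst] by (simp add: case_prod_unfold)
    have 2: "((\<lambda>x. \<beta> (fst (fst x)) (snd (fst x))) \<longlongrightarrow> \<beta>l s) (grid_filter D s z \<times>\<^sub>F nhds y)"
      using filterlim_compose[OF \<beta>l[OF s] filterlim_fst] by (simp add: case_prod_unfold)
    show ?thesis unfolding f_def g_def case_prod_unfold
      by (intro tendsto_intros 1 2 filterlim_snd)
  qed
  have mlb: "norm (ml c s) \<le> A c" if c: "c \<in> Basis" and s: "0 \<le> s" "s \<le> 1" for c s
  proof (rule tendsto_upperbound[OF tendsto_norm[OF ml[OF c s]]])
    show "\<forall>\<^sub>F x in grid_filter D s z. norm (case x of (p, z) \<Rightarrow> m c p z) \<le> A c"
      unfolding eventually_grid by (rule exI[of _ "e c"]) (use A(2,3) c in auto)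
    show "grid_filter D s z \<noteq> bot" using grid_filter_ne_bot[OF z s] .
  qed
  have uniq: "X s = X' s" if X: "X 0 = X' 0" "\<And>s. 0 \<le> s \<Longrightarrow> s \<le> 1 \<Longrightarrow> (X has_vector_derivative g s (X s)) (at s within {0..1})"
     "\<And>s. 0 \<le> s \<Longrightarrow> s \<le> 1 \<Longrightarrow> (X' has_vector_derivative g s (X' s)) (at s within {0..1})" and s: "0 \<le> s" "s \<le> 1" for X X' s
  proof -
    have "X s - X' s = 0"
    proof (rule linear_growth_zero[where W = "\<lambda>s. X s - X' s"])
      show "((\<lambda>s. X s - X' s) has_vector_derivative g s (X s) - g s (X' s)) (at s within {0..1})" if "0 \<le> s" "s \<le> 1" for s
        by (intro has_vector_derivative_diff X that)
      show "norm (g s (X s) - g s (X' s)) \<le> M * norm (X s - X' s)" if "0 \<le> s" "s \<le> 1" for s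
      proof -
        have "g s (X s) - g s (X' s) = (\<Sum>c\<in>Basis. ((X s - X' s) \<bullet> c) *\<^sub>R ml c s)"
          by (simp add: g_def inner_diff_left scaleR_diff_left sum_subtractf)
        then show ?thesis using lin[of "\<lambda>c. ml c s"] mlb that by simp
      qed
    qed (use X s in auto)
    then show ?thesis by simp
  qed
  have pos: "\<And>i. 0 < Suc i" by simp
  \<comment> \<open>The reference solution is produced by the scheme itself, on the grids
    \<open>Suc i\<close> with constant initial value \<open>z\<close>.\<close>
  obtain Xb where Xb: "Xb 0 = v0" "\<And>s. 0 \<le> s \<Longrightarrow> s \<le> 1 \<Longrightarrow> (Xb has_vector_derivative g s (Xb s)) (at s within {0..1})"
    using grid_euler_subsequence[where N = Suc and \<zeta> = "\<lambda>i. z" and x = Y and D = D and ?x0.0 = v0 and f = f and g = g,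
        OF step \<theta>(1) bnd conv filterlim_Suc pos] z init by auto
  have "((\<lambda>(p, z). Y p z) \<longlongrightarrow> Xb s0) (grid_filter D s0 z)"
  proof (rule tendsto_gridI)
    fix N k \<zeta> assume N: "filterlim N at_top sequentially" "\<And>i. 0 < N i" and k: "\<And>i. k i \<le> N i"
      "(\<lambda>i. real (k i) / real (N i)) \<longlonglongrightarrow> s0" and \<zeta>: "\<And>i. \<zeta> i \<in> D" "\<zeta> \<longlonglongrightarrow> z"
    have i: "(\<lambda>i. Y (N i, 0) (\<zeta> i)) \<longlonglongrightarrow> v0" by (simp add: init)
    obtain \<rho> :: "nat \<Rightarrow> nat" and X where X: "strict_mono \<rho>" "X 0 = v0"
      "\<And>s. 0 \<le> s \<and> s \<le> 1 \<Longrightarrow> (X has_vector_derivative g s (X s)) (at s within {0..1})"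
      "\<And>k s. (\<forall>i. k i \<le> N i) \<and> (\<lambda>i. real (k i) / real (N i)) \<longlonglongrightarrow> s \<and> 0 \<le> s \<and> s \<le> 1 \<Longrightarrow>
       (\<lambda>i. Y (N (\<rho> i), k (\<rho> i)) (\<zeta> (\<rho> i))) \<longlonglongrightarrow> X s"
      using grid_euler_subsequence[where f = f and g = g, OF step \<theta>(1) bnd conv N \<zeta> i] by auto
    have "X s0 = Xb s0" by (rule uniq) (use X Xb s0 in auto)
    then show "\<exists>\<rho>. strict_mono \<rho> \<and> (\<lambda>i. Y (N (\<rho> i), k (\<rho> i)) (\<zeta> (\<rho> i))) \<longlonglongrightarrow> Xb s0"
      using X(1) X(4)[of k s0] k s0 by auto
  qed
  then show "\<exists>l. ((\<lambda>(p, z). Y p z) \<longlongrightarrow> l) F" unfolding F by blast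
qed

text \<open>Differentiating the recursion in a direction \<open>b\<close> reproduces it with the
  same coefficients \<open>m\<close>, initial value 0, and an inhomogeneity built from
  \<open>Y\<close> and from derivatives of \<open>m\<close> and \<open>\<beta>\<close>. Convergence
  of \<open>Y\<close> at order j is established beforehand, so this inhomogeneity converges at order
  j and the induction hypothesis applies a second time, to the derivative.\<close>

lemma grid_linear_Ck:
  fixes m :: "'b \<Rightarrow> nat \<times> nat \<Rightarrow> 'a::euclidean_space \<Rightarrow> 'b::euclidean_space"
  assumes "\<And>c. c \<in> Basis \<Longrightarrow> Ck_conv j (grid_filters D) (m c)" "Ck_conv j (grid_filters D) \<beta>"
    "\<And>n k z. Y (n, Suc k) z = Y (n, k) z + (1 / real n) *\<^sub>R
        ((\<Sum>c\<in>Basis. (Y (n, k) z \<bullet> c) *\<^sub>R m c (n, k) z) + \<beta> (n, k) z)"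
    "\<And>n z. Y (n, 0) z = v0"
  shows "Ck_conv j (grid_filters D) Y"
  using assms
proof (induction j arbitrary: \<beta> Y v0)
  case 0 then show ?case by (rule grid_linear_Ck_0)
next
  case (Suc j)
  note dm = Ck_conv_differentiable[OF Suc(2)] and d\<beta> = Ck_conv_differentiable[OF Suc(3)]
  have Yj: "Ck_conv j (grid_filters D) Y"
    by (rule Suc(1)[OF Suc(2)[THEN Ck_conv_SucD] Suc(3)[THEN Ck_conv_SucD] Suc(4,5)])
  have Y0: "Y (n, 0) = (\<lambda>z. v0)" for n using Suc(5) by auto
  have YS: "Y (n, Suc k) = (\<lambda>z. Y (n, k) z + (1 / real n) *\<^sub>R
        ((\<Sum>c\<in>Basis. (Y (n, k) z \<bullet> c) *\<^sub>R m c (n, k) z) + \<beta> (n, k) z))" for n k using Suc(4) by auto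
  have dY: "Y (n, k) differentiable (at z)" for n k z
  proof (induction k)
    case (Suc k)
    have "(\<lambda>z. (Y (n, k) z \<bullet> c) *\<^sub>R m c (n, k) z) differentiable (at z)" if "c \<in> Basis" for c
      by (intro differentiable_scaleR differentiable_inner differentiable_const Suc dm that)
    then show ?case unfolding YS
      by (intro differentiable_add differentiable_scaleR differentiable_sum Suc d\<beta> differentiable_const) auto
  qed (simp add: Y0)
  show ?case
  proof (rule Ck_conv_SucI)
    show "Ck_conv 0 (grid_filters D) Y" by (rule Ck_conv_le[OF _ Yj]) simp
    show "Y i differentiable at z" for i z using dY by (cases i) auto
    fix b :: 'a assume b: "b \<in> Basis"
    define \<beta>' where "\<beta>' p z = (\<Sum>c\<in>Basis. (Y p z \<bullet> c) *\<^sub>R pd UNIV b (m c p) z) + pd UNIV b (\<beta> p) z" for p z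
    show "Ck_conv j (grid_filters D) (\<lambda>i. pd UNIV b (Y i))"
    proof (rule Suc(1)[OF Suc(2)[THEN Ck_conv_SucD], of \<beta>'])
      show "Ck_conv j (grid_filters D) \<beta>'" unfolding \<beta>'_def
        by (intro Ck_conv_add Ck_conv_sum Ck_conv_scaleR Ck_conv_linear[OF bounded_linear_inner_left] Yj
            Ck_conv_pd[OF Suc(2) b] Ck_conv_pd[OF Suc(3) b])
      show "pd UNIV b (Y (n, 0)) z = 0" for n z unfolding Y0 by (rule pd_const)
      fix n k z
      have "(Y (n, Suc k) has_derivative (\<lambda>v. pd UNIV v (Y (n, k)) z + (1 / real n) *\<^sub>R
          ((\<Sum>c\<in>Basis. (Y (n, k) z \<bullet> c) *\<^sub>R pd UNIV v (m c (n, k)) z + (pd UNIV v (Y (n, k)) z \<bullet> c) *\<^sub>R m c (n, k) z)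
             + pd UNIV v (\<beta> (n, k)) z))) (at z)"
        unfolding YS
        by (intro has_derivative_add has_derivative_scaleR_right has_derivative_sum has_derivative_scaleR
            has_derivative_inner_left has_derivative_pd dm d\<beta> dY)
      from pd_eq[OF this, of b]
      show "pd UNIV b (Y (n, Suc k)) z = pd UNIV b (Y (n, k)) z + (1 / real n) *\<^sub>R
          ((\<Sum>c\<in>Basis. (pd UNIV b (Y (n, k)) z \<bullet> c) *\<^sub>R m c (n, k) z) + \<beta>' (n, k) z)"
        by (simp add: \<beta>'_def sum.distrib algebra_simps)
    qed
  qed
qed

section \<open>Nonlinear one-step schemes\<close>

lemma nhds_inf_principal_open:
  assumes "open \<Omega>" "w \<in> \<Omega>"
  shows "inf (nhds w) (principal \<Omega>) = nhds w"
proof -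
  have "\<forall>\<^sub>F x in nhds w. x \<in> \<Omega>" using assms by (rule eventually_nhds_in_open)
  then have "nhds w \<le> principal \<Omega>" by (simp add: le_principal)
  then show ?thesis by (rule inf.absorb1)
qed

text \<open>The fields \<open>S n\<close> converge only on \<open>\<Omega>\<close>, so the scheme is
  compared with one whose field is cut off outside a tube around the curve \<open>Z\<close>. Limits
  of the modified scheme solve the cut-off equation; they cannot leave the inner tube, where the
  cut-off is 1, and so equal \<open>Z\<close> by the uniqueness assumed for \<open>G\<close>. Hence
  the modified iterates eventually remain in the inner tube as well, where they coincide with
  \<open>E\<close>.\<close>

lemma euler_grid_tendsto:
  fixes S :: "nat \<Rightarrow> 'a::euclidean_space \<Rightarrow> 'a"
  assumes \<Omega>: "open \<Omega>" and S: "Ck_conv_on 0 \<Omega> S" and lim: "\<And>w. w \<in> \<Omega> \<Longrightarrow> (\<lambda>n. S n w) \<longlonglongrightarrow> G w"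
    and Z: "\<And>s. 0 \<le> s \<Longrightarrow> s \<le> 1 \<Longrightarrow> Z s \<in> \<Omega>" "continuous_on {0..1} Z" "Z 0 = z"
    and uniq: "\<And>X t. 0 \<le> t \<Longrightarrow> t \<le> 1 \<Longrightarrow> X 0 = z \<Longrightarrow> (\<And>s. 0 \<le> s \<Longrightarrow> s \<le> t \<Longrightarrow> X s \<in> \<Omega>) \<Longrightarrow>
       (\<And>s. 0 \<le> s \<Longrightarrow> s \<le> t \<Longrightarrow> (X has_vector_derivative G (X s)) (at s within {0..t})) \<Longrightarrow> X t = Z t"
    and E0: "\<And>n z. E (n, 0) z = z"
    and ES: "\<And>n k z. E (n, Suc k) z = E (n, k) z + (1 / real n) *\<^sub>R S n (E (n, k) z)"
    and s0: "0 \<le> s0" "s0 \<le> 1"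
  shows "((\<lambda>(p, z). E p z) \<longlongrightarrow> Z s0) (grid_filter D s0 z)"
proof -
  define C where "C = Z ` {0..1}"
  have C: "compact C" "C \<noteq> {}" "C \<subseteq> \<Omega>" "closed C"
    using Z compact_continuous_image[OF Z(2)] by (auto simp: C_def compact_imp_closed)
  obtain e0 where e0: "e0 > 0" "(\<Union>x\<in>C. ball x e0) \<subseteq> \<Omega>"
    using compact_subset_open_imp_ball_epsilon_subset[OF C(1) \<Omega> C(3)] by blast
  define \<delta> where "\<delta> = e0 / 2"
  have \<delta>: "\<delta> > 0" using e0 by (simp add: \<delta>_def)
  define K where "K = {x. infdist x C \<le> \<delta>}"
  have K: "compact K" unfolding K_def by (rule compact_infdist_le[OF C(2,1) \<delta>])
  have K\<Omega>: "K \<subseteq> \<Omega>"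
  proof
    fix x assume x: "x \<in> K"
    obtain y where "y \<in> C" "infdist x C = dist x y" using infdist_attains_inf[OF C(4,2)] by blast
    then have "y \<in> C" "dist y x < e0" using x e0 by (auto simp: K_def \<delta>_def dist_commute)
    then have "x \<in> (\<Union>x\<in>C. ball x e0)" by auto
    then show "x \<in> \<Omega>" using e0(2) by blast
  qed
  \<comment> \<open>Equal to 1 up to distance \<open>\<delta> / 2\<close> from the curve and to 0
    outside \<open>K\<close>, with linear decay in the distance between.\<close>
  define \<kappa> where "\<kappa> x = max 0 (min 1 (2 - 2 * infdist x C / \<delta>))" for x
  have \<kappa>c: "(\<kappa> \<longlongrightarrow> \<kappa> y) (nhds y)" for y
  proof -
    have "isCont \<kappa> y" unfolding \<kappa>_def
      by (intro continuous_intros) (use \<delta> in auto)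
    then show ?thesis by (simp add: continuous_at tendsto_at_iff_tendsto_nhds)
  qed
  have \<kappa>1: "\<kappa> x = 1" if "infdist x C \<le> \<delta>/2" for x using that \<delta> by (simp add: \<kappa>_def field_simps)
  have \<kappa>0: "\<kappa> x = 0" if "x \<notin> K" for x using that \<delta> by (simp add: \<kappa>_def K_def field_simps)
  have \<kappa>b: "0 \<le> \<kappa> x" "\<kappa> x \<le> 1" for x by (auto simp: \<kappa>_def)
  define f where "f p (z'::'a) y = \<kappa> y *\<^sub>R S (fst p) y" for p :: "nat \<times> nat" and z' y
  define g where "g (s::real) y = \<kappa> y *\<^sub>R G y" for s y
  define x where "x p z' = ((\<lambda>y. y + (1 / real (fst p)) *\<^sub>R (\<kappa> y *\<^sub>R S (fst p) y)) ^^ snd p) z'" for p z'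
  have step: "x (n, Suc k) z' = x (n, k) z' + (1 / real n) *\<^sub>R f (n, k) z' (x (n, k) z')" for n k z'
    by (simp add: x_def f_def)
  have conv: "((\<lambda>((p, z'), y'). f p z' y') \<longlongrightarrow> g s y) (grid_filter D s z \<times>\<^sub>F nhds y)" for s y
  proof (cases "y \<in> \<Omega>")
    case True
    have "((\<lambda>(n, z). S n z) \<longlongrightarrow> G y) (sequentially \<times>\<^sub>F nhds y)"
      using Ck_conv_on_tendsto[OF S lim[OF True] True] nhds_inf_principal_open[OF \<Omega> True] by simp
    moreover have "filterlim (\<lambda>x. (fst (fst (fst x)), snd x)) (sequentially \<times>\<^sub>F nhds y) (grid_filter D s z \<times>\<^sub>F nhds y)"
      by (intro filterlim_Pair filterlim_snd filterlim_compose[OF grid_filter_tendsto_index filterlim_fst])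
    ultimately have 1: "((\<lambda>x. S (fst (fst (fst x))) (snd x)) \<longlongrightarrow> G y) (grid_filter D s z \<times>\<^sub>F nhds y)"
      by (auto dest: filterlim_compose simp: case_prod_unfold)
    show ?thesis unfolding f_def g_def case_prod_unfold
      by (intro tendsto_scaleR 1 filterlim_compose[OF \<kappa>c filterlim_snd])
  next
    case False
    then have y: "y \<notin> K" using K\<Omega> by auto
    have "\<forall>\<^sub>F y' in nhds y. y' \<in> - K"
      using y K by (intro eventually_nhds_in_open) (auto simp: compact_imp_closed open_Compl)
    then have "\<forall>\<^sub>F y' in nhds y. \<kappa> y' = 0" by eventually_elim (auto intro: \<kappa>0)
    then have "\<forall>\<^sub>F x in grid_filter D s z \<times>\<^sub>F nhds y. \<kappa> (snd x) = 0"
      by (rule eventually_compose_filterlim[OF _ filterlim_snd])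
    then have ev: "\<forall>\<^sub>F x in grid_filter D s z \<times>\<^sub>F nhds y. (case x of ((p, z'), y') \<Rightarrow> f p z' y') = 0"
      by eventually_elim (auto simp: f_def)
    have "g s y = 0" using \<kappa>0[OF y] by (simp add: g_def)
    then show ?thesis using tendsto_eventually[OF ev] by (simp add: case_prod_unfold)
  qed
  have Gc: "continuous_on \<Omega> G" by (rule Ck_conv_on_continuous_limit[OF S lim])
  have "bounded (G ` K)" by (intro compact_imp_bounded compact_continuous_image continuous_on_subset[OF Gc K\<Omega>] K)
  then obtain B where B: "\<And>w. w \<in> K \<Longrightarrow> norm (G w) \<le> B" unfolding bounded_iff by auto
  obtain n0 where n0: "\<And>n w. n \<ge> n0 \<Longrightarrow> w \<in> K \<Longrightarrow> dist (S n w) (G w) < 1"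
    using Ck_conv_on_uniform[OF S lim K K\<Omega> zero_less_one] unfolding eventually_sequentially by blast
  define e where "e = 1 / (real n0 + 1)"
  have e: "e > 0" by (simp add: e_def)
  have fb: "norm (f (n, k) z' y) \<le> \<bar>B\<bar> + 1" if "n > 0" "1 / real n < e" for n k z' y
  proof (cases "y \<in> K")
    case True
    have "n \<ge> n0" using that by (simp add: e_def field_simps)
    then have "norm (S n y) \<le> \<bar>B\<bar> + 1"
      using n0[OF _ True, of n] B[OF True] norm_triangle_sub[of "S n y" "G y"] by (simp add: dist_norm)
    moreover have "norm (f (n, k) z' y) \<le> 1 * norm (S n y)"
      unfolding f_def using \<kappa>b[of y] by (simp add: mult_left_le_one_le)
    ultimately show ?thesis by simp
  qed (simp add: f_def \<kappa>0)
  have bnd: "norm (f (n, k) z' (x (n, k) z')) \<le> \<bar>B\<bar> + 1"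
    if "k < n" "z' \<in> D" "1 / real n < e" "dist z' z < e" for n k z'
    using fb that by simp
  have z: "z \<in> C" using Z(3) unfolding C_def by (metis atLeastAtMost_iff image_eqI order_refl zero_le_one)
  have uniqX: "X s = Z s" if X: "X 0 = z" "\<And>s. 0 \<le> s \<Longrightarrow> s \<le> 1 \<Longrightarrow> (X has_vector_derivative g s (X s)) (at s within {0..1})"
    and s: "0 \<le> s" "s \<le> 1" for X s
  proof -
    have Xc: "continuous_on {0..1} X" by (rule continuous_on_vector_derivative) (use X(2) in auto)
    define d where "d s = infdist (X s) C" for s
    have dc: "continuous_on {0..1} d" unfolding d_def by (intro continuous_intros Xc)
    have solve: "X t = Z t" if t: "0 \<le> t" "t \<le> 1" "\<And>s. 0 \<le> s \<Longrightarrow> s \<le> t \<Longrightarrow> d s \<le> \<delta>/2" for t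
    proof (rule uniq[of t X, OF t(1,2) X(1)])
      fix s assume s: "0 \<le> s" "s \<le> t"
      have "d s \<le> \<delta>/2" using t(3) s by blast
      then have "\<kappa> (X s) = 1" "X s \<in> K" using \<kappa>1 \<delta> by (auto simp: d_def K_def)
      then show "X s \<in> \<Omega>" using K\<Omega> by auto
      have "(X has_vector_derivative g s (X s)) (at s within {0..t})"
        using X(2)[of s] s t by (auto intro: has_vector_derivative_within_subset)
      then show "(X has_vector_derivative G (X s)) (at s within {0..t})"
        using \<open>\<kappa> (X s) = 1\<close> by (simp add: g_def)
    qed
    have "d s < \<delta>/2" if s: "0 \<le> s" "s \<le> 1" for s
    proof (rule ccontr)
      assume "\<not> d s < \<delta>/2"
      \<comment> \<open>At the earliest time in \<open>A\<close> the distance is exactly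
        \<open>\<delta> / 2\<close>. Up to that time the cut-off is inactive, so uniqueness puts the
        solution on the curve, at distance 0: a contradiction.\<close>
      define A where "A = {u \<in> {0..1}. d u \<ge> \<delta>/2}"
      have A: "A = {0..1} \<inter> d -` {\<delta>/2..}" by (auto simp: A_def)
      have "closed A" unfolding A by (rule continuous_closed_preimage[OF dc]) auto
      then have "compact ({0..1} \<inter> A)" by (intro compact_Int_closed) auto
      then have "compact A" by (simp add: A)
      moreover have "A \<noteq> {}" using s \<open>\<not> d s < \<delta>/2\<close> by (auto simp: A_def)
      ultimately obtain t where t: "t \<in> A" "\<And>u. u \<in> A \<Longrightarrow> t \<le> u" using compact_attains_inf by metis
      have t0: "t > 0"
      proof (rule ccontr)
        assume "\<not> t > 0"
        then have "t = 0" using t by (simp add: A_def)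
        then show False using t(1) X(1) z \<delta> by (simp add: A_def d_def)
      qed
      have lt: "d u < \<delta>/2" if "0 \<le> u" "u < t" for u
        using t(2)[of u] t(1) that by (force simp: A_def)
      have "d t \<le> \<delta>/2"
      proof (rule ccontr)
        assume "\<not> d t \<le> \<delta>/2"
        then have "0 < d t - \<delta>/2" by simp
        then obtain \<eta> where \<eta>: "\<eta> > 0" "\<And>u. u \<in> {0..1} \<Longrightarrow> dist u t < \<eta> \<Longrightarrow> dist (d u) (d t) < d t - \<delta>/2"
          using dc t(1) unfolding continuous_on_iff A_def by blast
        define u where "u = max 0 (t - \<eta>/2)"
        have u: "0 \<le> u" "u < t" "u \<in> {0..1}" "dist u t < \<eta>" using t0 \<eta> t(1) by (auto simp: u_def A_def dist_real_def)
        show False using \<eta>(2)[OF u(3,4)] lt[OF u(1,2)] by (simp add: dist_real_def)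
      qed
      then have "d u \<le> \<delta>/2" if "0 \<le> u" "u \<le> t" for u using lt[of u] that by (cases "u = t") auto
      then have "X t = Z t" using t(1) t0 by (intro solve) (auto simp: A_def)
      then have "d t = 0" using t(1) by (auto simp: d_def C_def A_def)
      then show False using t(1) \<delta> by (simp add: A_def)
    qed
    then show ?thesis using s by (intro solve) (auto intro!: less_imp_le)
  qed
  have xlim: "((\<lambda>(p, z). x p z) \<longlongrightarrow> Z s) (grid_filter D s z)" if s: "0 \<le> s" "s \<le> 1" for s
  proof (rule tendsto_gridI)
    fix N k \<zeta> assume N: "filterlim N at_top sequentially" "\<And>i. 0 < N i" and k: "\<And>i. k i \<le> N i"
      "(\<lambda>i. real (k i) / real (N i)) \<longlonglongrightarrow> s" and \<zeta>: "\<And>i. \<zeta> i \<in> D" "\<zeta> \<longlonglongrightarrow> z"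
    have i: "(\<lambda>i. x (N i, 0) (\<zeta> i)) \<longlonglongrightarrow> z" using \<zeta> by (simp add: x_def)
    obtain \<rho> :: "nat \<Rightarrow> nat" and X where X: "strict_mono \<rho>" "X 0 = z"
      "\<And>s. 0 \<le> s \<and> s \<le> 1 \<Longrightarrow> (X has_vector_derivative g s (X s)) (at s within {0..1})"
      "\<And>k s. (\<forall>i. k i \<le> N i) \<and> (\<lambda>i. real (k i) / real (N i)) \<longlonglongrightarrow> s \<and> 0 \<le> s \<and> s \<le> 1 \<Longrightarrow>
       (\<lambda>i. x (N (\<rho> i), k (\<rho> i)) (\<zeta> (\<rho> i))) \<longlonglongrightarrow> X s"
      using grid_euler_subsequence[where f = f and g = g, OF step e bnd conv N \<zeta> i] by auto
    have "X s = Z s" by (rule uniqX) (use X s in auto)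
    then show "\<exists>\<rho>. strict_mono \<rho> \<and> (\<lambda>i. x (N (\<rho> i), k (\<rho> i)) (\<zeta> (\<rho> i))) \<longlonglongrightarrow> Z s"
      using X(1) X(4)[of k s] k s by auto
  qed
  \<comment> \<open>The covering argument is wanted here only for uniformity in the time, so its
    parameter has type \<open>unit\<close>.\<close>
  have ev: "\<exists>a::unit. eventually (\<lambda>(p, z). infdist (x p z) C < \<delta>/2) (grid_filter D s z)" if s: "0 \<le> s" "s \<le> 1" for s
  proof -
    have "((\<lambda>(p, z). infdist (x p z) C) \<longlongrightarrow> infdist (Z s) C) (grid_filter D s z)"
      using tendsto_infdist[OF xlim[OF s]] by (simp add: case_prod_unfold)
    moreover have "infdist (Z s) C < \<delta>/2" using s \<delta> by (auto simp: C_def)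
    ultimately have "\<forall>\<^sub>F q in grid_filter D s z. (case q of (p, z) \<Rightarrow> infdist (x p z) C) < \<delta>/2"
      by (rule order_tendstoD(2))
    then show ?thesis by (simp only: case_prod_unfold) simp
  qed
  obtain A :: "unit set" and e1 where "e1 > 0" and A: "\<And>n k z'. 0 < n \<Longrightarrow> k \<le> n \<Longrightarrow> z' \<in> D \<Longrightarrow> 1 / real n < e1 \<Longrightarrow>
     dist z' z < e1 \<Longrightarrow> \<exists>a\<in>A. (\<lambda>(p, z). infdist (x p z) C < \<delta>/2) ((n, k), z')"
    using grid_finite_cover[of "\<lambda>(a::unit) (p, z). infdist (x p z) C < \<delta>/2" D z, OF ev] by metis
  have e1: "e1 > 0" "\<And>n k z'. 0 < n \<Longrightarrow> k \<le> n \<Longrightarrow> z' \<in> D \<Longrightarrow> 1 / real n < e1 \<Longrightarrow>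
     dist z' z < e1 \<Longrightarrow> infdist (x (n, k) z') C < \<delta>/2"
    using \<open>e1 > 0\<close> A by (simp, blast)
  \<comment> \<open>As long as an iterate lies in the inner tube, both schemes take the same next
    step.\<close>
  have eq: "E (n, k) z' = x (n, k) z'" if *: "0 < n" "k \<le> n" "z' \<in> D" "1 / real n < e1" "dist z' z < e1" for n k z'
    using \<open>k \<le> n\<close>
  proof (induction k)
    case (Suc k)
    have "infdist (x (n, k) z') C < \<delta>/2" using e1(2)[of n k z'] * Suc(2) by simp
    then have "\<kappa> (x (n, k) z') = 1" using \<kappa>1 by simp
    then show ?case using Suc by (simp add: ES step f_def)
  qed (simp add: E0 x_def)
  have "\<forall>\<^sub>F p in grid_filter D s0 z. (\<lambda>(p, z). E p z) p = (\<lambda>(p, z). x p z) p"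
    unfolding eventually_grid using eq e1(1) by auto
  then show ?thesis using xlim[OF s0] by (simp add: filterlim_cong[OF refl refl])
qed

text \<open>The coefficients of the differentiated recursion are partial derivatives of
  \<open>S n\<close> evaluated at the iterates. By composition they converge at order j once
  \<open>E\<close> does, at the cost of one of the \<open>r\<close> orders of \<open>S\<close>. The
  recursion is homogeneous and starts from the basis vector \<open>b\<close>.\<close>

lemma euler_grid_Ck:
  fixes S :: "nat \<Rightarrow> 'a::euclidean_space \<Rightarrow> 'a"
  assumes \<Omega>: "open \<Omega>" and S: "Ck_conv_on r \<Omega> S"
    and base: "\<And>s z. 0 \<le> s \<Longrightarrow> s \<le> 1 \<Longrightarrow> z \<in> D \<Longrightarrow> \<exists>w\<in>\<Omega>. ((\<lambda>(p, z). E p z) \<longlongrightarrow> w) (grid_filter D s z)"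
    and E0: "\<And>n z. E (n, 0) z = z"
    and ES: "\<And>n k z. E (n, Suc k) z = E (n, k) z + (1 / real n) *\<^sub>R S n (E (n, k) z)"
  shows "Ck_conv r (grid_filters D) E"
proof -
  have "j \<le> r \<Longrightarrow> Ck_conv j (grid_filters D) E" for j
  proof (induction j)
    case 0 show ?case using base by (intro Ck_conv_0I) (auto simp: grid_filters_def)
  next
    case (Suc j)
    obtain r' where r: "r = Suc r'" using Suc(2) by (cases r) auto
    note S' = S[unfolded r Ck_conv_on_def]
    have Ej: "Ck_conv j (grid_filters D) E" using Suc by simp
    have E0': "E (n, 0) = (\<lambda>z. z)" for n using E0 by auto
    have ES': "E (n, Suc k) = (\<lambda>z. E (n, k) z + (1 / real n) *\<^sub>R S n (E (n, k) z))" for n k using ES by auto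
    have dE: "E (n, k) differentiable (at z)" for n k z
    proof (induction k arbitrary: z)
      case (Suc k)
      have "(\<lambda>z. S n (E (n, k) z)) differentiable (at z)"
        using has_derivative_chain_pd[OF Ck_conv_differentiable[OF S'] Suc] by (rule differentiableI)
      then show ?case unfolding ES' by (intro differentiable_add differentiable_scaleR Suc) auto
    qed (simp add: E0')
    show ?case
    proof (rule Ck_conv_SucI)
      show "Ck_conv 0 (grid_filters D) E" by (rule Ck_conv_le[OF _ Ej]) simp
      show "E i differentiable at z" for i z using dE by (cases i) auto
      fix b :: 'a assume b: "b \<in> Basis"
      have lim: "\<exists>G\<in>(\<lambda>w. sequentially \<times>\<^sub>F inf (nhds w) (principal \<Omega>)) ` \<Omega>.
           filterlim (\<lambda>(i, z). (fst i, E i z)) G F" if FD: "F \<in> grid_filters D" for F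
      proof -
        obtain s z where F: "F = grid_filter D s z" and s: "0 \<le> s" "s \<le> 1" and z: "z \<in> D"
          using FD unfolding grid_filters_def by auto
        obtain w where w: "w \<in> \<Omega>" "((\<lambda>(p, z). E p z) \<longlongrightarrow> w) F" using base[OF s z] F by blast
        have "filterlim (\<lambda>x. (fst (fst x), E (fst x) (snd x))) (sequentially \<times>\<^sub>F nhds w) F"
          using w(2) grid_filter_tendsto_index unfolding F by (intro filterlim_Pair) (auto simp: case_prod_unfold)
        then show ?thesis using w(1) nhds_inf_principal_open[OF \<Omega> w(1)]
          by (intro bexI[of _ "sequentially \<times>\<^sub>F nhds w"] image_eqI[of _ _ w]) (auto simp: case_prod_unfold)
      qed
      show "Ck_conv j (grid_filters D) (\<lambda>p. pd UNIV b (E p))"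
      proof (rule grid_linear_Ck[where m = "\<lambda>c p z. pd UNIV c (S (fst p)) (E p z)" and \<beta> = "\<lambda>p z. 0" and ?v0.0 = b])
        fix c :: 'a assume c: "c \<in> Basis"
        have "Ck_conv j ((\<lambda>w. sequentially \<times>\<^sub>F inf (nhds w) (principal \<Omega>)) ` \<Omega>) (\<lambda>n. pd UNIV c (S n))"
          by (rule Ck_conv_le[OF _ Ck_conv_pd[OF S' c]]) (use Suc r in simp)
        from Ck_conv_compose[OF this Ej lim]
        show "Ck_conv j (grid_filters D) (\<lambda>p z. pd UNIV c (S (fst p)) (E p z))" by simp
      next
        show "pd UNIV b (E (n, 0)) z = b" for n z unfolding E0' by (rule pd_eq[OF has_derivative_ident])
      next
        fix n k z
        note d = Ck_conv_differentiable[OF S'] dE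
        have "(E (n, Suc k) has_derivative (\<lambda>v. pd UNIV v (E (n, k)) z + (1 / real n) *\<^sub>R
           (pd UNIV (pd UNIV v (E (n, k)) z) (S n) (E (n, k) z)))) (at z)"
          unfolding ES' by (intro has_derivative_add has_derivative_scaleR_right has_derivative_pd has_derivative_chain_pd d)
        from pd_eq[OF this, of b]
        show "pd UNIV b (E (n, Suc k)) z = pd UNIV b (E (n, k)) z + (1 / real n) *\<^sub>R
          ((\<Sum>c\<in>Basis. (pd UNIV b (E (n, k)) z \<bullet> c) *\<^sub>R pd UNIV c (S (fst (n, k))) (E (n, k) z)) + 0)"
          using pd_basis_expansion[OF d(1), of "pd UNIV b (E (n, k)) z" n "E (n, k) z"] by simp
      qed (rule Ck_conv_const)
    qed
  qed
  then show ?thesis by simp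
qed

section \<open>Approximation in the C^k topology\<close>

lemma Ck_on_UNIV_Suc:
  "Ck_on (Suc k) UNIV f \<longleftrightarrow> (\<forall>z. f differentiable (at z)) \<and> (\<forall>b\<in>Basis. Ck_on k UNIV (pd UNIV b f))"
  by (simp add: pd_def differentiable_on_def)

lemma Ck_on_UNIV_le: "Ck_on j UNIV f \<Longrightarrow> i \<le> j \<Longrightarrow> Ck_on i UNIV f"
  unfolding Ck_on_UNIV_iff Ck_conv_on_def by (rule Ck_conv_le)

lemma Ck_on_UNIV_continuous: "Ck_on k UNIV f \<Longrightarrow> continuous_on UNIV f"
  using Ck_on_UNIV_le[of k f 0] by simp

lemma Ck_on_UNIV_add: "Ck_on k UNIV f \<Longrightarrow> Ck_on k UNIV g \<Longrightarrow> Ck_on k UNIV (\<lambda>z. f z + g z)"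
  unfolding Ck_on_UNIV_iff Ck_conv_on_def by (rule Ck_conv_add)

lemma Ck_on_UNIV_diff: "Ck_on k UNIV f \<Longrightarrow> Ck_on k UNIV g \<Longrightarrow> Ck_on k UNIV (\<lambda>z. f z - g z)"
  unfolding Ck_on_UNIV_iff Ck_conv_on_def by (rule Ck_conv_diff)

lemma Ck_on_UNIV_mult:
  fixes f g :: "'a::euclidean_space \<Rightarrow> real"
  shows "Ck_on k UNIV f \<Longrightarrow> Ck_on k UNIV g \<Longrightarrow> Ck_on k UNIV (\<lambda>z. f z * g z)"
  unfolding Ck_on_UNIV_iff Ck_conv_on_def by (rule Ck_conv_mult)

lemma Ck_on_UNIV_const: "Ck_on k UNIV (\<lambda>z. c)"
  unfolding Ck_on_UNIV_iff Ck_conv_on_def by (rule Ck_conv_const)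

lemma Ck_on_UNIV_linear:
  assumes "bounded_linear L"
  shows "Ck_on k UNIV L"
proof -
  have "Ck_on k UNIV (\<lambda>z. L z)"
    unfolding Ck_on_UNIV_iff Ck_conv_on_def
    by (rule Ck_conv_linear[OF assms Ck_conv_on_ident[unfolded Ck_conv_on_def]])
  then show ?thesis .
qed

lemma Ck_on_UNIV_sum:
  "(\<And>a. a \<in> A \<Longrightarrow> Ck_on k UNIV (f a)) \<Longrightarrow> Ck_on k UNIV (\<lambda>z. \<Sum>a\<in>A. f a z)"
  unfolding Ck_on_UNIV_iff Ck_conv_on_def by (rule Ck_conv_sum)

lemma Ck_conv_on_compose:
  fixes Y :: "nat \<Rightarrow> 'a::euclidean_space \<Rightarrow> 'b::euclidean_space"
  assumes "Ck_conv_on k \<Omega>' S" "Ck_conv_on k \<Omega> Y" "open \<Omega>'"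
    "\<And>w. w \<in> \<Omega> \<Longrightarrow> \<exists>v\<in>\<Omega>'. (\<lambda>n. Y n w) \<longlonglongrightarrow> v"
  shows "Ck_conv_on k \<Omega> (\<lambda>n z. S n (Y n z))"
  unfolding Ck_conv_on_def
proof (rule Ck_conv_compose[where \<pi> = "\<lambda>n. n", OF assms(1,2)[unfolded Ck_conv_on_def]])
  fix F assume "F \<in> (\<lambda>w. sequentially \<times>\<^sub>F inf (nhds w) (principal \<Omega>)) ` \<Omega>"
  then obtain w where w: "w \<in> \<Omega>" and F: "F = sequentially \<times>\<^sub>F inf (nhds w) (principal \<Omega>)" by auto
  obtain v where v: "v \<in> \<Omega>'" "(\<lambda>n. Y n w) \<longlonglongrightarrow> v" using assms(4)[OF w] by blast
  have "filterlim (\<lambda>x. (fst x, Y (fst x) (snd x))) (sequentially \<times>\<^sub>F nhds v) F"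
    using Ck_conv_on_tendsto[OF assms(2) v(2) w] unfolding F
    by (intro filterlim_Pair filterlim_fst) (simp add: case_prod_unfold)
  then show "\<exists>G\<in>(\<lambda>w. sequentially \<times>\<^sub>F inf (nhds w) (principal \<Omega>')) ` \<Omega>'. filterlim (\<lambda>(i, z). (i, Y i z)) G F"
    using v(1) nhds_inf_principal_open[OF assms(3) v(1)]
    by (intro bexI[of _ "sequentially \<times>\<^sub>F nhds v"] image_eqI[of _ _ v]) (auto simp: case_prod_unfold)
qed

lemma Ck_on_UNIV_compose:
  fixes f :: "'a::euclidean_space \<Rightarrow> 'b::euclidean_space"
  assumes "Ck_on k UNIV g" "Ck_on k UNIV f"
  shows "Ck_on k UNIV (\<lambda>z. g (f z))"
  using Ck_conv_on_compose[OF assms[unfolded Ck_on_UNIV_iff] open_UNIV] unfolding Ck_on_UNIV_iff by auto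

lemma Ck_conv_on_index:
  fixes \<Omega> :: "'a::euclidean_space set"
  assumes "a \<longlonglongrightarrow> l"
  shows "Ck_conv_on k \<Omega> (\<lambda>n z. a n)"
proof -
  have 0: "Ck_conv_on 0 \<Omega> (\<lambda>n z. a n)"
    unfolding Ck_conv_on_def
  proof (rule Ck_conv_0I)
    fix F assume "F \<in> (\<lambda>w. sequentially \<times>\<^sub>F inf (nhds w) (principal \<Omega>)) ` \<Omega>"
    then obtain w where F: "F = sequentially \<times>\<^sub>F inf (nhds w) (principal \<Omega>)" by auto
    from filterlim_compose[OF assms filterlim_fst] show "\<exists>l. ((\<lambda>(i, z). a i) \<longlongrightarrow> l) F"
      unfolding F by (auto simp: case_prod_unfold)
  qed
  show ?thesis
  proof (cases k)
    case (Suc j)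
    have "pd UNIV b (\<lambda>z. a n) = (\<lambda>z. 0)" for b :: 'a and n using pd_const by blast
    then show ?thesis unfolding Suc Ck_conv_on_def
      by (intro Ck_conv_SucI 0[unfolded Ck_conv_on_def]) (auto intro: Ck_conv_const)
  qed (use 0 in simp)
qed

lemma Ck_conv_on_fixed: "Ck_on k UNIV f \<Longrightarrow> Ck_conv_on k UNIV (\<lambda>n. f)"
  by (simp add: Ck_on_UNIV_iff)

lemma pdl_add:
  assumes "Ck_on k UNIV f" "Ck_on k UNIV g" "set L \<subseteq> Basis" "length L \<le> k"
  shows "pdl UNIV L (\<lambda>z. f z + g z) = (\<lambda>z. pdl UNIV L f z + pdl UNIV L g z)"
  using assms
proof (induction L arbitrary: k f g rule: rev_induct)
  case (snoc b L)
  obtain j where j: "k = Suc j" using snoc by (cases k) auto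
  have "pd UNIV b (\<lambda>z. f z + g z) = (\<lambda>z. pd UNIV b f z + pd UNIV b g z)"
    using snoc(2,3) unfolding j Ck_on_UNIV_Suc by (intro ext pd_add) auto
  moreover have "pdl UNIV L (\<lambda>z. pd UNIV b f z + pd UNIV b g z) = (\<lambda>z. pdl UNIV L (pd UNIV b f) z + pdl UNIV L (pd UNIV b g) z)"
    using snoc(2-5) unfolding j Ck_on_UNIV_Suc by (intro snoc(1)[of j]) auto
  ultimately show ?case by (simp add: pdl_append)
qed simp

lemma pdl_linear:
  assumes "bounded_linear T" "Ck_on k UNIV f" "set L \<subseteq> Basis" "length L \<le> k"
  shows "pdl UNIV L (\<lambda>z. T (f z)) = (\<lambda>z. T (pdl UNIV L f z))"
  using assms(2-)
proof (induction L arbitrary: k f rule: rev_induct)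
  case (snoc b L)
  obtain j where j: "k = Suc j" using snoc by (cases k) auto
  have "pd UNIV b (\<lambda>z. T (f z)) = (\<lambda>z. T (pd UNIV b f z))"
    using snoc(2) unfolding j Ck_on_UNIV_Suc by (intro ext pd_linear assms(1)) auto
  moreover have "pdl UNIV L (\<lambda>z. T (pd UNIV b f z)) = (\<lambda>z. T (pdl UNIV L (pd UNIV b f) z))"
    using snoc(2-4) unfolding j Ck_on_UNIV_Suc by (intro snoc(1)[of j]) auto
  ultimately show ?case by (simp add: pdl_append)
qed simp

lemma pdl_cong_open:
  assumes "open U" "\<And>z. z \<in> U \<Longrightarrow> f z = g z" "z \<in> U"
  shows "pdl UNIV L f z = pdl UNIV L g z"
  using assms(3)
proof (induction L arbitrary: z)
  case (Cons b L)
  have "frechet_derivative (pdl UNIV L f) (at z) = frechet_derivative (pdl UNIV L g) (at z)"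
  proof -
    have "((pdl UNIV L f) has_derivative h) (at z) \<longleftrightarrow> ((pdl UNIV L g) has_derivative h) (at z)" for h
    proof
      show "(pdl UNIV L g has_derivative h) (at z)" if "(pdl UNIV L f has_derivative h) (at z)"
        by (rule has_derivative_transform_within_open[OF that assms(1) Cons(2) Cons(1)])
      show "(pdl UNIV L f has_derivative h) (at z)" if "(pdl UNIV L g has_derivative h) (at z)"
        by (rule has_derivative_transform_within_open[OF that assms(1) Cons(2) Cons(1)[symmetric]])
    qed
    then show ?thesis by (simp add: frechet_derivative_def)
  qed
  then show ?case by (simp add: pd_def)
qed (use assms in simp)

section \<open>Closeness and closure in C^k on compact sets\<close>

text \<open>All derivatives are full derivatives on the ambient space and only the comparison is
  confined to \<open>C\<close>, so \<open>C\<close> may have empty interior.\<close>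

definition Ck_near :: "nat \<Rightarrow> 'a::euclidean_space set \<Rightarrow> real \<Rightarrow> ('a \<Rightarrow> 'b::real_normed_vector) \<Rightarrow> ('a \<Rightarrow> 'b) \<Rightarrow> bool" where
  "Ck_near k C \<epsilon> f g \<longleftrightarrow> (\<forall>L. set L \<subseteq> Basis \<and> length L \<le> k \<longrightarrow> (\<forall>z\<in>C. dist (pdl UNIV L f z) (pdl UNIV L g z) < \<epsilon>))"

lemma Ck_near_trans:
  fixes f :: "'a::euclidean_space \<Rightarrow> 'b::real_normed_vector"
  shows "Ck_near k C \<epsilon> f g \<Longrightarrow> Ck_near k C \<delta> g h \<Longrightarrow> Ck_near k C (\<epsilon> + \<delta>) f h"
  unfolding Ck_near_def
proof (intro allI impI ballI)
  fix L :: "'a list" and z assume f: "\<forall>L. set L \<subseteq> Basis \<and> length L \<le> k \<longrightarrow> (\<forall>z\<in>C. dist (pdl UNIV L f z) (pdl UNIV L g z) < \<epsilon>)"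
    and g: "\<forall>L. set L \<subseteq> Basis \<and> length L \<le> k \<longrightarrow> (\<forall>z\<in>C. dist (pdl UNIV L g z) (pdl UNIV L h z) < \<delta>)"
    and L: "set L \<subseteq> Basis \<and> length L \<le> k" "z \<in> C"
  show "dist (pdl UNIV L f z) (pdl UNIV L h z) < \<epsilon> + \<delta>"
    using f[rule_format, OF L] g[rule_format, OF L] dist_triangle[of "pdl UNIV L f z" "pdl UNIV L h z" "pdl UNIV L g z"]
    by linarith
qed

lemma Ck_near_cong_open:
  assumes "open U" "C \<subseteq> U" "\<And>z. z \<in> U \<Longrightarrow> f z = f' z" "\<And>z. z \<in> U \<Longrightarrow> g z = g' z" "Ck_near k C \<epsilon> f g"
  shows "Ck_near k C \<epsilon> f' g'"
proof -
  have "pdl UNIV L f z = pdl UNIV L f' z" "pdl UNIV L g z = pdl UNIV L g' z" if "z \<in> C" for z L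
    using pdl_cong_open[OF assms(1), of f f' z L] pdl_cong_open[OF assms(1), of g g' z L] that assms(2-4) by auto
  then show ?thesis using assms(5) unfolding Ck_near_def by auto
qed

lemma Ck_near_pd:
  assumes "Ck_near (Suc k) C \<epsilon> f g" "b \<in> Basis"
  shows "Ck_near k C \<epsilon> (pd UNIV b f) (pd UNIV b g)"
  unfolding Ck_near_def pdl_append[symmetric]
  using assms unfolding Ck_near_def by (auto dest!: spec[of _ "_ @ [b]"])

lemma Ck_near_add:
  fixes f :: "'a::euclidean_space \<Rightarrow> 'b::real_normed_vector"
  assumes "Ck_on k UNIV f" "Ck_on k UNIV f'" "Ck_on k UNIV g" "Ck_on k UNIV g'"
    "Ck_near k C \<epsilon> f f'" "Ck_near k C \<delta> g g'"
  shows "Ck_near k C (\<epsilon> + \<delta>) (\<lambda>z. f z + g z) (\<lambda>z. f' z + g' z)"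
  unfolding Ck_near_def
proof (intro allI impI ballI)
  fix L :: "'a list" and z assume L: "set L \<subseteq> Basis \<and> length L \<le> k" and z: "z \<in> C"
  have "dist (pdl UNIV L f z) (pdl UNIV L f' z) < \<epsilon>" "dist (pdl UNIV L g z) (pdl UNIV L g' z) < \<delta>"
    using assms(5,6) L z unfolding Ck_near_def by auto
  then show "dist (pdl UNIV L (\<lambda>z. f z + g z) z) (pdl UNIV L (\<lambda>z. f' z + g' z) z) < \<epsilon> + \<delta>"
    using pdl_add[OF assms(1,3), of L] pdl_add[OF assms(2,4), of L] L
      dist_triangle_add[of "pdl UNIV L f z" "pdl UNIV L g z" "pdl UNIV L f' z" "pdl UNIV L g' z"] by simp
qed

lemma Ck_near_scale:
  fixes f f' :: "'a::euclidean_space \<Rightarrow> real"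
  assumes "Ck_on k UNIV f" "Ck_on k UNIV f'" "Ck_near k C \<epsilon> f f'" "\<epsilon> > 0"
  shows "Ck_near k C ((\<bar>c\<bar> + 1) * \<epsilon>) (\<lambda>z. c * f z) (\<lambda>z. c * f' z)"
  unfolding Ck_near_def
proof (intro allI impI ballI)
  fix L :: "'a list" and z assume L: "set L \<subseteq> Basis \<and> length L \<le> k" and z: "z \<in> C"
  have "\<bar>pdl UNIV L f z - pdl UNIV L f' z\<bar> < \<epsilon>"
    using assms(3) L z unfolding Ck_near_def dist_real_def by auto
  then have "\<bar>c\<bar> * \<bar>pdl UNIV L f z - pdl UNIV L f' z\<bar> \<le> \<bar>c\<bar> * \<epsilon>" by (intro mult_left_mono) auto
  also have "\<dots> < (\<bar>c\<bar> + 1) * \<epsilon>" using assms(4) by simp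
  finally show "dist (pdl UNIV L (\<lambda>z. c * f z) z) (pdl UNIV L (\<lambda>z. c * f' z) z) < (\<bar>c\<bar> + 1) * \<epsilon>"
    using pdl_linear[OF bounded_linear_mult_right assms(1), of L] pdl_linear[OF bounded_linear_mult_right assms(2), of L] L
    by (simp add: dist_real_def right_diff_distrib[symmetric] abs_mult)
qed

lemma Ck_conv_on_near:
  fixes Y :: "nat \<Rightarrow> 'a::euclidean_space \<Rightarrow> 'b::real_normed_vector"
  assumes "Ck_conv_on k UNIV Y" "\<And>w. (\<lambda>n. Y n w) \<longlonglongrightarrow> f w" "compact C" "\<epsilon> > 0"
  shows "\<forall>\<^sub>F n in sequentially. Ck_near k C \<epsilon> (Y n) f"
proof -
  have "\<forall>\<^sub>F n in sequentially. \<forall>L\<in>{L. set L \<subseteq> Basis \<and> length L \<le> k}. \<forall>z\<in>C. dist (pdl UNIV L (Y n) z) (pdl UNIV L f z) < \<epsilon>"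
    by (intro eventually_ball_finite finite_lists_length_le finite_Basis ballI
        Ck_conv_on_pdl_uniform[OF assms(1) open_in_quadrant_open[OF open_UNIV]] assms) auto
  then show ?thesis by eventually_elim (auto simp: Ck_near_def)
qed

lemma Ck_near_sym: "Ck_near k C \<epsilon> f g \<Longrightarrow> Ck_near k C \<epsilon> g f"
  unfolding Ck_near_def by (simp add: dist_commute)

text \<open>The closure in the topology of uniform convergence on compact sets of all derivatives up
  to order \<open>k\<close>.\<close>

definition Ck_closure :: "nat \<Rightarrow> ('a::euclidean_space \<Rightarrow> real) set \<Rightarrow> ('a \<Rightarrow> real) set" where
  "Ck_closure k X = {f. Ck_on k UNIV f \<and> (\<forall>C \<epsilon>. compact C \<longrightarrow> \<epsilon> > 0 \<longrightarrow> (\<exists>g\<in>X. Ck_near k C \<epsilon> f g))}"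

locale Ck_subspace =
  fixes k :: nat and X :: "('a::euclidean_space \<Rightarrow> real) set"
  assumes Ck: "f \<in> X \<Longrightarrow> Ck_on k UNIV f"
    and zero: "(\<lambda>z. 0) \<in> X"
    and add: "f \<in> X \<Longrightarrow> g \<in> X \<Longrightarrow> (\<lambda>z. f z + g z) \<in> X"
    and scale: "f \<in> X \<Longrightarrow> (\<lambda>z. c * f z) \<in> X"
begin

lemma closure_Ck: "f \<in> Ck_closure k X \<Longrightarrow> Ck_on k UNIV f"
  by (simp add: Ck_closure_def)

lemma closure_superset: "f \<in> X \<Longrightarrow> f \<in> Ck_closure k X"
  unfolding Ck_closure_def using Ck by (auto simp: Ck_near_def intro!: bexI[of _ f])

lemma closure_add:
  assumes "f \<in> Ck_closure k X" "g \<in> Ck_closure k X"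
  shows "(\<lambda>z. f z + g z) \<in> Ck_closure k X"
  unfolding Ck_closure_def
proof (intro CollectI conjI allI impI)
  show "Ck_on k UNIV (\<lambda>z. f z + g z)" using assms closure_Ck by (intro Ck_on_UNIV_add) auto
  fix C and \<epsilon> :: real assume C: "compact (C :: 'a set)" "\<epsilon> > 0"
  then have e: "\<epsilon>/2 > 0" by simp
  obtain f' where f: "f' \<in> X" "Ck_near k C (\<epsilon>/2) f f'"
    using assms(1) C(1) e unfolding Ck_closure_def by blast
  obtain g' where g: "g' \<in> X" "Ck_near k C (\<epsilon>/2) g g'"
    using assms(2) C(1) e unfolding Ck_closure_def by blast
  note fg = f(1) g(1) f(2) g(2)
  have "Ck_near k C (\<epsilon>/2 + \<epsilon>/2) (\<lambda>z. f z + g z) (\<lambda>z. f' z + g' z)"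
    by (intro Ck_near_add fg closure_Ck assms Ck)
  then show "\<exists>h\<in>X. Ck_near k C \<epsilon> (\<lambda>z. f z + g z) h" using add[OF fg(1,2)] by auto
qed

lemma closure_scale:
  assumes "f \<in> Ck_closure k X"
  shows "(\<lambda>z. c * f z) \<in> Ck_closure k X"
  unfolding Ck_closure_def
proof (intro CollectI conjI allI impI)
  show "Ck_on k UNIV (\<lambda>z. c * f z)" using assms closure_Ck by (intro Ck_on_UNIV_mult Ck_on_UNIV_const) auto
  fix C and \<epsilon> :: real assume C: "compact (C :: 'a set)" "\<epsilon> > 0"
  \<comment> \<open>The added 1 keeps the divisor positive when \<open>c = 0\<close>.\<close>
  have e: "\<epsilon> / (\<bar>c\<bar> + 1) > 0" using C by (simp add: add_nonneg_pos)
  obtain f' where f: "f' \<in> X" "Ck_near k C (\<epsilon> / (\<bar>c\<bar> + 1)) f f'"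
    using assms C(1) e unfolding Ck_closure_def by blast
  then have "Ck_near k C ((\<bar>c\<bar> + 1) * (\<epsilon> / (\<bar>c\<bar> + 1))) (\<lambda>z. c * f z) (\<lambda>z. c * f' z)"
    using assms closure_Ck Ck e by (intro Ck_near_scale) auto
  moreover have "(\<bar>c\<bar> + 1) * (\<epsilon> / (\<bar>c\<bar> + 1)) = \<epsilon>" by (simp add: add_nonneg_eq_0_iff)
  ultimately show "\<exists>h\<in>X. Ck_near k C \<epsilon> (\<lambda>z. c * f z) h" using scale[OF f(1)] by auto
qed

lemma closure_sum:
  "(\<And>a. a \<in> A \<Longrightarrow> f a \<in> Ck_closure k X) \<Longrightarrow> (\<lambda>z. \<Sum>a\<in>A. f a z) \<in> Ck_closure k X"
  by (induction A rule: infinite_finite_induct) (auto intro: closure_superset zero closure_add)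

text \<open>Sequential closedness. Both averaging of ridge functions and differentiation in their
  weights enter the closure through it.\<close>

lemma closure_limit:
  assumes "Ck_conv_on k UNIV Y" "\<And>w. (\<lambda>n. Y n w) \<longlonglongrightarrow> f w" "\<And>n. Y n \<in> Ck_closure k X"
  shows "f \<in> Ck_closure k X"
  unfolding Ck_closure_def
proof (intro CollectI conjI allI impI)
  show "Ck_on k UNIV f" by (rule Ck_conv_on_Ck_limit[OF assms(1,2)])
  fix C and \<epsilon> :: real assume C: "compact (C :: 'a set)" "\<epsilon> > 0"
  then have e: "\<epsilon>/2 > 0" by simp
  obtain n where n: "Ck_near k C (\<epsilon>/2) (Y n) f"
    using eventually_happens[OF Ck_conv_on_near[OF assms(1,2) C(1) e]] by auto
  obtain g where g: "g \<in> X" "Ck_near k C (\<epsilon>/2) (Y n) g"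
    using assms(3)[of n] C(1) e unfolding Ck_closure_def by blast
  have "Ck_near k C \<epsilon> f g" using Ck_near_trans[OF Ck_near_sym[OF n] g(2)] by simp
  then show "\<exists>g\<in>X. Ck_near k C \<epsilon> f g" using g by blast
qed

end

section \<open>Averages and difference quotients of functions of one variable\<close>

lemma pd_real_eq:
  fixes f :: "real \<Rightarrow> real"
  assumes "(f has_real_derivative f') (at x)"
  shows "pd UNIV 1 f x = f'"
  using pd_eq[OF assms[unfolded has_field_derivative_def], of 1] by simp

lemma has_real_derivative_pd:
  fixes f :: "real \<Rightarrow> real"
  assumes "f differentiable (at x)"
  shows "(f has_real_derivative pd UNIV 1 f x) (at x)"
proof -
  obtain f' where "(f has_real_derivative f') (at x)"
    using assms real_differentiable_def by blast
  then show ?thesis using pd_real_eq by metis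
qed

lemma Ck_on_real_Suc:
  fixes f :: "real \<Rightarrow> real"
  shows "Ck_on (Suc k) UNIV f \<longleftrightarrow> (\<forall>z. f differentiable (at z)) \<and> Ck_on k UNIV (pd UNIV 1 f)"
  unfolding Ck_on_UNIV_Suc by simp

lemma ex_antiderivative:
  fixes \<phi> :: "real \<Rightarrow> real"
  assumes "continuous_on UNIV \<phi>"
  obtains \<Phi> where "\<And>x. (\<Phi> has_real_derivative \<phi> x) (at x)"
  using einterval_antiderivative[of "-\<infinity>" "\<infinity>" \<phi>] assms
  by (auto simp: continuous_on_eq_continuous_at has_real_derivative_iff_has_vector_derivative)

lemma Ck_conv_on_UNIV_0I:
  assumes "\<And>w. \<exists>l. ((\<lambda>(n, z). Y n z) \<longlongrightarrow> l) (sequentially \<times>\<^sub>F nhds w)"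
  shows "Ck_conv_on 0 UNIV Y"
  unfolding Ck_conv_on_def using assms by (intro Ck_conv_0I) auto

lemma Ck_conv_on_SucI:
  assumes "Ck_conv_on 0 \<Omega> Y" "\<And>i z. Y i differentiable (at z)"
    "\<And>b. b \<in> Basis \<Longrightarrow> Ck_conv_on j \<Omega> (\<lambda>i. pd UNIV b (Y i))"
  shows "Ck_conv_on (Suc j) \<Omega> Y"
  using assms unfolding Ck_conv_on_def by (rule Ck_conv_SucI)

text \<open>The left Riemann sum with n nodes for the integral of \<open>\<phi>\<close> over
  [x, x + 1]. It is a finite combination of translates of \<open>\<phi>\<close>, which for ridge
  functions are changes of the bias.\<close>

definition riemann_sum :: "(real \<Rightarrow> real) \<Rightarrow> nat \<Rightarrow> real \<Rightarrow> real" where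
  "riemann_sum \<phi> n x = (\<Sum>j<n. (1 / real n) * \<phi> (x + real j / real n))"

text \<open>On each subinterval the increment of \<open>\<Phi>\<close> is the step length times a
  value of \<open>\<phi>\<close> at an intermediate point; uniform continuity compares it with the
  value at the left node.\<close>

lemma riemann_sum_tendsto:
  fixes \<phi> :: "real \<Rightarrow> real"
  assumes c: "continuous_on UNIV \<phi>" and \<Phi>: "\<And>x. (\<Phi> has_real_derivative \<phi> x) (at x)"
  shows "((\<lambda>(n, x). riemann_sum \<phi> n x) \<longlongrightarrow> \<Phi> (w + 1) - \<Phi> w) (sequentially \<times>\<^sub>F nhds w)"
proof -
  have \<Phi>c: "isCont \<Phi> x" for x using \<Phi> by (rule DERIV_isCont)
  then have \<Phi>t: "(\<Phi> \<longlongrightarrow> \<Phi> x) (nhds x)" for x by (simp add: isCont_def tendsto_at_iff_tendsto_nhds)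
  have 1: "((\<lambda>p. \<Phi> (snd p + 1) - \<Phi> (snd p)) \<longlongrightarrow> \<Phi> (w + 1) - \<Phi> w) (sequentially \<times>\<^sub>F nhds w)"
  proof (intro tendsto_diff)
    show "((\<lambda>p. \<Phi> (snd p)) \<longlongrightarrow> \<Phi> w) (sequentially \<times>\<^sub>F nhds w)" by (rule filterlim_compose[OF \<Phi>t filterlim_snd])
    have "((\<lambda>p. snd p + 1) \<longlongrightarrow> w + 1) (sequentially \<times>\<^sub>F nhds w)" by (intro tendsto_add filterlim_snd tendsto_const)
    then show "((\<lambda>p. \<Phi> (snd p + 1)) \<longlongrightarrow> \<Phi> (w + 1)) (sequentially \<times>\<^sub>F nhds w)" by (rule filterlim_compose[OF \<Phi>t])
  qed
  have 2: "((\<lambda>p. riemann_sum \<phi> (fst p) (snd p) - (\<Phi> (snd p + 1) - \<Phi> (snd p))) \<longlongrightarrow> 0) (sequentially \<times>\<^sub>F nhds w)"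
  proof (rule tendstoI)
    fix \<epsilon> :: real assume e: "\<epsilon> > 0"
    \<comment> \<open>For x within 1 of \<open>w\<close> the nodes lie in [x, x + 1] and the
      intermediate points below x + 2, so everything stays in this interval.\<close>
    have "uniformly_continuous_on {w - 1..w + 3} \<phi>"
      by (intro compact_uniformly_continuous continuous_on_subset[OF c]) auto
    then obtain \<delta> where \<delta>: "\<delta> > 0" "\<And>x y. x \<in> {w - 1..w + 3} \<Longrightarrow> y \<in> {w - 1..w + 3} \<Longrightarrow> dist y x < \<delta> \<Longrightarrow> dist (\<phi> y) (\<phi> x) < \<epsilon>/2"
      unfolding uniformly_continuous_on_def using e by (metis half_gt_zero)
    have "\<forall>\<^sub>F n in sequentially. 0 < n \<and> 1 / real n < \<delta>"
      using eventually_conj[OF eventually_gt_at_top[of 0] order_tendstoD(2)[OF lim_1_over_n \<delta>(1)]] .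
    moreover have "\<forall>\<^sub>F x in nhds w. dist x w < 1" unfolding eventually_nhds_metric by (auto intro: exI[of _ 1])
    moreover have est: "dist (riemann_sum \<phi> n x - (\<Phi> (x + 1) - \<Phi> x)) 0 < \<epsilon>" if n: "0 < n \<and> 1 / real n < \<delta>" and x: "dist x w < 1" for n x
    proof -
      define X where "X j = x + real j / real n" for j :: nat
      have "\<Phi> (x + 1) - \<Phi> x = \<Phi> (X n) - \<Phi> (X 0)" using n by (simp add: X_def)
      also have "\<dots> = (\<Sum>j<n. \<Phi> (X (Suc j)) - \<Phi> (X j))" by (rule sum_lessThan_telescope[symmetric])
      finally have "riemann_sum \<phi> n x - (\<Phi> (x + 1) - \<Phi> x) = (\<Sum>j<n. (1 / real n) * \<phi> (X j) - (\<Phi> (X (Suc j)) - \<Phi> (X j)))"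
        by (simp add: riemann_sum_def X_def sum_subtractf)
      also have "\<bar>\<dots>\<bar> \<le> (\<Sum>j<n. (1 / real n) * (\<epsilon>/2))"
      proof (rule order_trans[OF sum_abs sum_mono])
        fix j assume j: "j \<in> {..<n}"
        have XX: "X (Suc j) = X j + 1 / real n" by (simp add: X_def add_divide_distrib)
        obtain \<xi> where \<xi>: "X j < \<xi>" "\<xi> < X (Suc j)" "\<Phi> (X (Suc j)) - \<Phi> (X j) = (X (Suc j) - X j) * \<phi> \<xi>"
          using MVT2[of "X j" "X (Suc j)" \<Phi> \<phi>] \<Phi> n XX by auto
        have "0 \<le> real j / real n" "real j / real n \<le> 1" "1 / real n \<le> 1" using j n by auto
        then have "x \<le> X j" "X j \<le> x + 1" "X (Suc j) \<le> X j + 1" unfolding XX by (auto simp: X_def)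
        moreover have "w - 1 \<le> x" "x \<le> w + 1" using x by (auto simp: dist_real_def)
        ultimately have "X j \<in> {w - 1..w + 3}" "\<xi> \<in> {w - 1..w + 3}"
          using \<xi>(1,2) unfolding atLeastAtMost_iff by linarith+
        moreover have "dist (X j) \<xi> < \<delta>" using \<xi> XX n by (simp add: dist_real_def)
        ultimately have "\<bar>\<phi> (X j) - \<phi> \<xi>\<bar> \<le> \<epsilon>/2" using \<delta>(2)[of \<xi> "X j"] by (simp add: dist_real_def)
        moreover have "(1 / real n) * \<phi> (X j) - (\<Phi> (X (Suc j)) - \<Phi> (X j)) = (1 / real n) * (\<phi> (X j) - \<phi> \<xi>)"
          using \<xi>(3) XX by (simp add: right_diff_distrib)
        ultimately show "\<bar>(1 / real n) * \<phi> (X j) - (\<Phi> (X (Suc j)) - \<Phi> (X j))\<bar> \<le> (1 / real n) * (\<epsilon>/2)"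
          by (simp only: abs_mult) (intro mult_mono; simp)
      qed
      also have "\<dots> = \<epsilon>/2" using n by simp
      finally show ?thesis using e by simp
    qed
    ultimately show "\<forall>\<^sub>F p in sequentially \<times>\<^sub>F nhds w. dist (riemann_sum \<phi> (fst p) (snd p) - (\<Phi> (snd p + 1) - \<Phi> (snd p))) 0 < \<epsilon>"
      unfolding eventually_prod_filter
      by (intro exI[of _ "\<lambda>n. 0 < n \<and> 1 / real n < \<delta>"] exI[of _ "\<lambda>x. dist x w < 1"]) (simp add: est)
  qed
  from tendsto_add[OF 2 1] show ?thesis by (simp add: case_prod_unfold)
qed

text \<open>Differentiation commutes with the finite sum, so convergence holds at the full order of
  \<open>\<phi>\<close>.\<close>

lemma riemann_sum_Ck: "Ck_on k UNIV \<phi> \<Longrightarrow> Ck_conv_on k UNIV (riemann_sum \<phi>)"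
proof (induction k arbitrary: \<phi>)
  case 0
  then have c: "continuous_on UNIV \<phi>" by simp
  obtain \<Phi> where "\<And>x. (\<Phi> has_real_derivative \<phi> x) (at x)" using ex_antiderivative[OF c] by blast
  from riemann_sum_tendsto[OF c this] show ?case by (intro Ck_conv_on_UNIV_0I) auto
next
  case (Suc k)
  have d: "\<And>x. \<phi> differentiable (at x)" and Ck': "Ck_on k UNIV (pd UNIV 1 \<phi>)"
    using Suc(2) unfolding Ck_on_real_Suc by auto
  have der: "(riemann_sum \<phi> n has_real_derivative riemann_sum (pd UNIV 1 \<phi>) n x) (at x)" for n x
    unfolding riemann_sum_def
    by (intro DERIV_sum DERIV_cmult DERIV_shift[THEN iffD1] has_real_derivative_pd[OF d])
  show ?case
  proof (rule Ck_conv_on_SucI)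
    have "Ck_conv_on k UNIV (riemann_sum \<phi>)" by (rule Suc(1)[OF Ck_on_UNIV_le[OF Suc(2)]]) simp
    then show "Ck_conv_on 0 UNIV (riemann_sum \<phi>)" unfolding Ck_conv_on_def by (rule Ck_conv_le[OF le0])
    show "riemann_sum \<phi> i differentiable at z" for i z
      using der real_differentiable_def by blast
    fix b :: real assume "b \<in> Basis"
    then have "(\<lambda>i. pd UNIV b (riemann_sum \<phi> i)) = riemann_sum (pd UNIV 1 \<phi>)"
      using pd_real_eq[OF der] by (intro ext) simp
    then show "Ck_conv_on k UNIV (\<lambda>i. pd UNIV b (riemann_sum \<phi> i))" using Suc(1)[OF Ck'] by simp
  qed
qed

lemma Ck_on_affine: "Ck_on k UNIV (\<lambda>z::'a::euclidean_space. w \<bullet> z + b)"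
  by (intro Ck_on_UNIV_add Ck_on_UNIV_linear[OF bounded_linear_inner_right] Ck_on_UNIV_const)

text \<open>Difference quotient, with respect to the weight \<open>w\<close> in direction
  \<open>e\<close> and for the increment \<open>1 / Suc n\<close>, of the ridge function of
  \<open>\<phi>\<close>. Its limit is \<open>e \<bullet> z\<close> times the ridge function of the
  derivative of \<open>\<phi>\<close>.\<close>

definition diff_quot :: "'a::euclidean_space \<Rightarrow> 'a \<Rightarrow> real \<Rightarrow> (real \<Rightarrow> real) \<Rightarrow> nat \<Rightarrow> 'a \<Rightarrow> real" where
  "diff_quot e w b \<phi> n z = real (Suc n) * (\<phi> (w \<bullet> z + b + (e \<bullet> z) / real (Suc n)) - \<phi> (w \<bullet> z + b))"

lemma diff_quot_tendsto:
  fixes \<phi> :: "real \<Rightarrow> real" and z0 :: "'a::euclidean_space"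
  assumes d: "\<And>x. \<phi> differentiable (at x)" and c: "continuous_on UNIV (pd UNIV 1 \<phi>)"
  shows "((\<lambda>(n, z). diff_quot e w b \<phi> n z) \<longlongrightarrow> (e \<bullet> z0) * pd UNIV 1 \<phi> (w \<bullet> z0 + b)) (sequentially \<times>\<^sub>F nhds z0)"
proof -
  define u where "u z = w \<bullet> z + b" for z
  define h where "h n z = (e \<bullet> z) / real (Suc n)" for n z
  \<comment> \<open>The increment is a multiple of \<open>e \<bullet> z\<close>, which may have
    either sign or vanish, so the mean value theorem is prepared for all three cases.\<close>
  have "\<exists>\<xi>. \<phi> (x + h) - \<phi> x = h * pd UNIV 1 \<phi> \<xi> \<and> \<bar>\<xi> - x\<bar> \<le> \<bar>h\<bar>" for x h
  proof (cases h "0::real" rule: linorder_cases)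
    case less
    then obtain \<xi> where "x + h < \<xi>" "\<xi> < x" "\<phi> x - \<phi> (x + h) = (x - (x + h)) * pd UNIV 1 \<phi> \<xi>"
      using MVT2[of "x + h" x \<phi> "pd UNIV 1 \<phi>"] has_real_derivative_pd[OF d] by auto
    then show ?thesis using less by (intro exI[of _ \<xi>]) (auto simp: algebra_simps)
  next
    case greater
    then obtain \<xi> where "x < \<xi>" "\<xi> < x + h" "\<phi> (x + h) - \<phi> x = (x + h - x) * pd UNIV 1 \<phi> \<xi>"
      using MVT2[of x "x + h" \<phi> "pd UNIV 1 \<phi>"] has_real_derivative_pd[OF d] by auto
    then show ?thesis using greater by (intro exI[of _ \<xi>]) auto
  qed auto
  then obtain \<xi> where \<xi>: "\<And>x h. \<phi> (x + h) - \<phi> x = h * pd UNIV 1 \<phi> (\<xi> x h)" "\<And>x h. \<bar>\<xi> x h - x\<bar> \<le> \<bar>h\<bar>" by metis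
  have q: "diff_quot e w b \<phi> n z = (e \<bullet> z) * pd UNIV 1 \<phi> (\<xi> (u z) (h n z))" for n z
    unfolding diff_quot_def using \<xi>(1)[of "u z" "h n z"] by (simp add: u_def h_def)
  have inner: "((\<lambda>p. v \<bullet> snd p) \<longlongrightarrow> v \<bullet> z0) (sequentially \<times>\<^sub>F nhds z0)" for v :: 'a
    by (intro tendsto_intros filterlim_snd)
  have inv: "((\<lambda>p. 1 / real (Suc (fst p))) \<longlongrightarrow> 0) (sequentially \<times>\<^sub>F nhds z0)"
    by (rule filterlim_compose[OF LIMSEQ_Suc[OF lim_1_over_n] filterlim_fst])
  have "((\<lambda>p. (e \<bullet> snd p) * (1 / real (Suc (fst p)))) \<longlongrightarrow> (e \<bullet> z0) * 0) (sequentially \<times>\<^sub>F nhds z0)"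
    by (intro tendsto_mult inner inv)
  then have h0: "((\<lambda>p. h (fst p) (snd p)) \<longlongrightarrow> 0) (sequentially \<times>\<^sub>F nhds z0)" by (simp add: h_def)
  have "((\<lambda>p. \<xi> (u (snd p)) (h (fst p) (snd p)) - u (snd p)) \<longlongrightarrow> 0) (sequentially \<times>\<^sub>F nhds z0)"
    by (rule Lim_null_comparison[OF always_eventually tendsto_rabs_zero[OF h0]]) (use \<xi>(2) in simp)
  moreover have "((\<lambda>p. u (snd p)) \<longlongrightarrow> u z0) (sequentially \<times>\<^sub>F nhds z0)"
    unfolding u_def by (intro tendsto_add inner tendsto_const)
  ultimately have "((\<lambda>p. \<xi> (u (snd p)) (h (fst p) (snd p))) \<longlongrightarrow> u z0) (sequentially \<times>\<^sub>F nhds z0)"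
    using tendsto_add by fastforce
  moreover have "(pd UNIV 1 \<phi> \<longlongrightarrow> pd UNIV 1 \<phi> (u z0)) (nhds (u z0))"
    using c by (simp add: continuous_on_eq_continuous_at isCont_def tendsto_at_iff_tendsto_nhds)
  ultimately have "((\<lambda>p. pd UNIV 1 \<phi> (\<xi> (u (snd p)) (h (fst p) (snd p)))) \<longlongrightarrow> pd UNIV 1 \<phi> (u z0)) (sequentially \<times>\<^sub>F nhds z0)"
    by (rule filterlim_compose[rotated])
  from tendsto_mult[OF inner[of e] this] show ?thesis by (simp add: q case_prod_unfold u_def)
qed

text \<open>One derivative of \<open>\<phi>\<close> is spent on the existence of the limit, hence
  \<open>Suc k\<close> orders for convergence at order \<open>k\<close>. Differentiating in z yields
  a difference quotient for the derivative of \<open>\<phi>\<close> plus a ridge term with perturbed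
  weight, which closes the induction.\<close>

lemma diff_quot_Ck: "Ck_on (Suc k) UNIV \<phi> \<Longrightarrow> Ck_conv_on k UNIV (diff_quot (e::'a::euclidean_space) w b \<phi>)"
proof (induction k arbitrary: \<phi>)
  case 0
  then have "\<And>x. \<phi> differentiable (at x)" "continuous_on UNIV (pd UNIV 1 \<phi>)" unfolding Ck_on_real_Suc by auto
  from diff_quot_tendsto[OF this] show ?case by (intro Ck_conv_on_UNIV_0I) blast
next
  case (Suc k)
  have d: "\<And>x. \<phi> differentiable (at x)" and Ck': "Ck_on (Suc k) UNIV (pd UNIV 1 \<phi>)"
    using Suc(2) unfolding Ck_on_real_Suc[of "Suc k"] by auto
  have dc: "((\<lambda>z. \<phi> (g z)) has_derivative (\<lambda>v. g' v * pd UNIV 1 \<phi> (g z))) (at z)"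
    if "(g has_derivative g') (at z)" for g g' and z :: 'a
    using has_derivative_compose[OF that has_real_derivative_pd[OF d, unfolded has_field_derivative_def]] by (simp add: mult.commute)
  have der: "(diff_quot e w b \<phi> n has_derivative (\<lambda>v. real (Suc n) * ((w \<bullet> v + (e \<bullet> v) / real (Suc n)) * pd UNIV 1 \<phi> (w \<bullet> z + b + (e \<bullet> z) / real (Suc n))
      - (w \<bullet> v) * pd UNIV 1 \<phi> (w \<bullet> z + b)))) (at z)" for n z
    unfolding diff_quot_def[abs_def]
    by (intro has_derivative_mult_right has_derivative_diff dc) (auto intro!: derivative_eq_intros)
  show ?case
  proof (rule Ck_conv_on_SucI)
    have "Ck_conv_on k UNIV (diff_quot e w b \<phi>)" by (rule Suc(1)[OF Ck_on_UNIV_le[OF Suc(2)]]) simp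
    then show "Ck_conv_on 0 UNIV (diff_quot e w b \<phi>)" unfolding Ck_conv_on_def by (rule Ck_conv_le[OF le0])
    show "diff_quot e w b \<phi> i differentiable at z" for i z using der by (rule differentiableI)
    fix v :: 'a assume "v \<in> Basis"
    have "pd UNIV v (diff_quot e w b \<phi> n) z = (w \<bullet> v) * diff_quot e w b (pd UNIV 1 \<phi>) n z
       + (e \<bullet> v) * pd UNIV 1 \<phi> (w \<bullet> z + b + (e \<bullet> z) * (1 / real (Suc n)))" for n z
    proof -
      have alg: "N * ((a + c / N) * P - a * Q) = a * (N * (P - Q)) + c * P" if "N \<noteq> 0" for N a c P Q :: real
        using that by (simp add: field_simps)
      show ?thesis unfolding pd_eq[OF der] diff_quot_def by (subst alg) auto
    qed
    then have eq: "(\<lambda>n. pd UNIV v (diff_quot e w b \<phi> n)) = (\<lambda>n z. (w \<bullet> v) * diff_quot e w b (pd UNIV 1 \<phi>) n z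
       + (e \<bullet> v) * pd UNIV 1 \<phi> (w \<bullet> z + b + (e \<bullet> z) * (1 / real (Suc n))))" by blast
    have aff: "Ck_conv_on k UNIV (\<lambda>n z. w \<bullet> z + b + (e \<bullet> z) * (1 / real (Suc n)))"
      unfolding Ck_conv_on_def
      by (intro Ck_conv_add Ck_conv_mult Ck_conv_const Ck_conv_linear[OF bounded_linear_inner_right]
          Ck_conv_on_ident[unfolded Ck_conv_on_def]
          Ck_conv_on_index[OF LIMSEQ_Suc[OF lim_1_over_n], unfolded Ck_conv_on_def])
    have "(\<lambda>n. w \<bullet> z + b + (e \<bullet> z) * (1 / real (Suc n))) \<longlonglongrightarrow> w \<bullet> z + b + (e \<bullet> z) * 0" for z
      by (intro tendsto_intros LIMSEQ_Suc[OF lim_1_over_n])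
    then have "Ck_conv_on k UNIV (\<lambda>n z. pd UNIV 1 \<phi> (w \<bullet> z + b + (e \<bullet> z) * (1 / real (Suc n))))"
      by (intro Ck_conv_on_compose[OF Ck_conv_on_fixed[OF Ck_on_UNIV_le[OF Ck']] aff open_UNIV]) auto
    then show "Ck_conv_on k UNIV (\<lambda>n. pd UNIV v (diff_quot e w b \<phi> n))"
      unfolding eq using Suc(1)[OF Ck'] unfolding Ck_conv_on_def
      by (intro Ck_conv_add Ck_conv_mult Ck_conv_const)
  qed
qed

section \<open>Ridge functions and polynomials\<close>

abbreviation (input) rderiv :: "(real \<Rightarrow> real) \<Rightarrow> real \<Rightarrow> real" where
  "rderiv \<equiv> pd UNIV 1"

definition fwd_diff :: "(real \<Rightarrow> real) \<Rightarrow> real \<Rightarrow> real" where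
  "fwd_diff g x = g (x + 1) - g x"

lemma Ck_on_real_funpow: "Ck_on (k + m) UNIV f \<Longrightarrow> Ck_on k UNIV ((rderiv ^^ m) f)"
proof (induction m arbitrary: f)
  case (Suc m)
  then have "Ck_on (k + m) UNIV (rderiv f)" unfolding add_Suc_right Ck_on_real_Suc by simp
  from Suc(1)[OF this] show ?case by (simp add: funpow_swap1)
qed simp

lemma Ck_on_shift: "Ck_on k UNIV f \<Longrightarrow> Ck_on k UNIV (\<lambda>x::real. f (x + c))"
  by (rule Ck_on_UNIV_compose, assumption)
    (intro Ck_on_UNIV_add Ck_on_UNIV_linear[OF bounded_linear_ident] Ck_on_UNIV_const)

lemma Ck_on_fwd_diff: "Ck_on k UNIV f \<Longrightarrow> Ck_on k UNIV (fwd_diff f)"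
  unfolding fwd_diff_def[abs_def] by (intro Ck_on_UNIV_diff Ck_on_shift)

lemma rderiv_fwd_diff:
  assumes "\<And>x. f differentiable (at x)"
  shows "rderiv (fwd_diff f) = fwd_diff (rderiv f)"
proof
  fix x
  have "(fwd_diff f has_real_derivative fwd_diff (rderiv f) x) (at x)"
    unfolding fwd_diff_def by (intro DERIV_diff DERIV_shift[THEN iffD1] has_real_derivative_pd assms)
  then show "rderiv (fwd_diff f) x = fwd_diff (rderiv f) x" by (rule pd_real_eq)
qed

lemma rderiv_funpow_fwd_diff:
  "Ck_on n UNIV f \<Longrightarrow> (rderiv ^^ n) (fwd_diff f) = fwd_diff ((rderiv ^^ n) f)"
proof (induction n arbitrary: f)
  case (Suc n)
  then have d: "\<And>x. f differentiable (at x)" "Ck_on n UNIV (rderiv f)" unfolding Ck_on_real_Suc by auto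
  have "(rderiv ^^ Suc n) (fwd_diff f) = (rderiv ^^ n) (rderiv (fwd_diff f))" by (simp add: funpow_swap1)
  also have "\<dots> = (rderiv ^^ n) (fwd_diff (rderiv f))" by (simp only: rderiv_fwd_diff[OF d(1)])
  also have "\<dots> = fwd_diff ((rderiv ^^ Suc n) f)" using Suc(1)[OF d(2)] by (simp add: funpow_swap1)
  finally show ?case .
qed simp

text \<open>This weakening of integrability is inherited by forward differences and excludes nonzero periodic
  functions.\<close>
definition vanishing_mean :: "(real \<Rightarrow> real) \<Rightarrow> bool" where
  "vanishing_mean g \<longleftrightarrow> continuous_on UNIV g \<and>
     (\<forall>y. (\<lambda>n. integral {0..1} (\<lambda>x. \<bar>g (y + real n + x)\<bar>)) \<longlonglongrightarrow> 0)"

lemma continuous_on_abs_translate: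
  fixes g :: "real \<Rightarrow> real"
  assumes "continuous_on UNIV g"
  shows "continuous_on A (\<lambda>x. \<bar>g (c + x)\<bar>)"
proof (rule continuous_on_rabs)
  have "continuous_on A (\<lambda>x. c + x)" by (intro continuous_intros)
  then show "continuous_on A (\<lambda>x. g (c + x))" by (rule continuous_on_compose2[OF assms]) simp
qed

lemma vanishing_mean_integrable:
  assumes "vanishing_mean g"
  shows "(\<lambda>x. \<bar>g (c + x)\<bar>) integrable_on {0..1}"
  using assms unfolding vanishing_mean_def
  by (intro integrable_continuous_interval continuous_on_abs_translate) auto

lemma vanishing_mean_fwd_diff:
  assumes g: "vanishing_mean g"
  shows "vanishing_mean (fwd_diff g)"
proof -
  have c: "continuous_on UNIV g" using g by (simp add: vanishing_mean_def)
  have c': "continuous_on UNIV (fwd_diff g)" unfolding fwd_diff_def[abs_def]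
    by (rule continuous_on_diff[OF continuous_on_compose2[OF c] c]) (auto intro!: continuous_intros)
  have "(\<lambda>n. integral {0..1} (\<lambda>x. \<bar>fwd_diff g (y + real n + x)\<bar>)) \<longlonglongrightarrow> 0" for y
  proof (rule Lim_null_comparison)
    show "\<forall>\<^sub>F n in sequentially. norm (integral {0..1} (\<lambda>x. \<bar>fwd_diff g (y + real n + x)\<bar>)) \<le>
       integral {0..1} (\<lambda>x. \<bar>g (y + real (Suc n) + x)\<bar>) + integral {0..1} (\<lambda>x. \<bar>g (y + real n + x)\<bar>)"
    proof (rule always_eventually, rule allI)
      fix n
      have i: "(\<lambda>x. \<bar>fwd_diff g (y + real n + x)\<bar>) integrable_on {0..1}"
        by (intro integrable_continuous_interval continuous_on_abs_translate c')
      have "norm (integral {0..1} (\<lambda>x. \<bar>fwd_diff g (y + real n + x)\<bar>)) = integral {0..1} (\<lambda>x. \<bar>fwd_diff g (y + real n + x)\<bar>)"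
        using integral_nonneg[OF i] by simp
      also have "\<dots> \<le> integral {0..1} (\<lambda>x. \<bar>g (y + real (Suc n) + x)\<bar> + \<bar>g (y + real n + x)\<bar>)"
      proof (rule integral_le[OF i])
        show "(\<lambda>x. \<bar>g (y + real (Suc n) + x)\<bar> + \<bar>g (y + real n + x)\<bar>) integrable_on {0..1}"
          by (intro integrable_add vanishing_mean_integrable g)
        fix x :: real
        have "y + real n + x + 1 = y + real (Suc n) + x" by simp
        then show "\<bar>fwd_diff g (y + real n + x)\<bar> \<le> \<bar>g (y + real (Suc n) + x)\<bar> + \<bar>g (y + real n + x)\<bar>"
          unfolding fwd_diff_def by (metis abs_triangle_ineq4)
      qed
      also have "\<dots> = integral {0..1} (\<lambda>x. \<bar>g (y + real (Suc n) + x)\<bar>) + integral {0..1} (\<lambda>x. \<bar>g (y + real n + x)\<bar>)"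
        by (intro integral_add vanishing_mean_integrable g)
      finally show "norm (integral {0..1} (\<lambda>x. \<bar>fwd_diff g (y + real n + x)\<bar>)) \<le>
       integral {0..1} (\<lambda>x. \<bar>g (y + real (Suc n) + x)\<bar>) + integral {0..1} (\<lambda>x. \<bar>g (y + real n + x)\<bar>)" .
    qed
    have "(\<lambda>n. integral {0..1} (\<lambda>x. \<bar>g (y + real n + x)\<bar>)) \<longlonglongrightarrow> 0" using g by (simp add: vanishing_mean_def)
    from tendsto_add[OF LIMSEQ_Suc[OF this] this]
    show "(\<lambda>n. integral {0..1} (\<lambda>x. \<bar>g (y + real (Suc n) + x)\<bar>) + integral {0..1} (\<lambda>x. \<bar>g (y + real n + x)\<bar>)) \<longlonglongrightarrow> 0"
      by simp
  qed
  then show ?thesis using c' by (simp add: vanishing_mean_def)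
qed

text \<open>For a function of period 1 the integrals over successive unit intervals are all equal,
  so their limit 0 is their common value, and continuity then forces the function to vanish.\<close>

lemma vanishing_mean_periodic:
  assumes g: "vanishing_mean g" and p: "\<And>x. fwd_diff g x = 0"
  shows "g y = 0"
proof -
  have per: "g (x + real n) = g x" for x n
  proof (induction n)
    case (Suc n)
    have "g (x + real (Suc n)) = g (x + real n + 1)" by (simp add: algebra_simps)
    also have "\<dots> = g (x + real n)" using p[of "x + real n"] by (simp add: fwd_diff_def)
    finally show ?case using Suc by simp
  qed simp
  have "g (y + real n + x) = g (y + x)" for n x using per[of "y + x" n] by (simp add: algebra_simps)
  moreover have "(\<lambda>n. integral {0..1} (\<lambda>x. \<bar>g (y + real n + x)\<bar>)) \<longlonglongrightarrow> 0"
    using g unfolding vanishing_mean_def by blast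
  ultimately have "(\<lambda>n::nat. integral {0..1} (\<lambda>x. \<bar>g (y + x)\<bar>)) \<longlonglongrightarrow> 0" by simp
  then have I: "integral {0..1} (\<lambda>x. \<bar>g (y + x)\<bar>) = 0" by (simp add: LIMSEQ_const_iff)
  have c: "continuous_on {0..1} (\<lambda>x. \<bar>g (y + x)\<bar>)"
    using g unfolding vanishing_mean_def by (intro continuous_on_abs_translate) auto
  have "\<forall>x\<in>{0..1}. g (y + x) = 0"
    using integral_eq_0_iff[OF c] I by auto
  then have "g (y + 0) = 0" by (rule bspec) simp
  then show ?thesis by simp
qed

text \<open>If a forward difference vanished identically, the function it is taken of would be
  periodic with vanishing mean, and hence already 0.\<close>

lemma vanishing_mean_funpow:
  assumes "vanishing_mean g" "g \<noteq> (\<lambda>x. 0)"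
  shows "vanishing_mean ((fwd_diff ^^ n) g) \<and> (fwd_diff ^^ n) g \<noteq> (\<lambda>x. 0)"
proof (induction n)
  case (Suc n)
  have "fwd_diff ((fwd_diff ^^ n) g) \<noteq> (\<lambda>x. 0)"
    using vanishing_mean_periodic[of "(fwd_diff ^^ n) g"] Suc by (metis ext)
  then show ?case using vanishing_mean_fwd_diff Suc by simp
qed (use assms in simp)

text \<open>The integrals over successive unit intervals are the increments of a bounded monotone
  sequence. That sequence converges, so the increments tend to 0.\<close>

lemma vanishing_mean_of_integrable:
  assumes c: "continuous_on UNIV g" and i: "(\<lambda>x. \<bar>g x\<bar>) integrable_on UNIV"
  shows "vanishing_mean g"
  unfolding vanishing_mean_def
proof (intro conjI c allI)
  fix y
  have ci: "(\<lambda>x. \<bar>g x\<bar>) integrable_on {a..b}" for a b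
    using continuous_on_abs_translate[OF c, of "{a..b}" 0] by (intro integrable_continuous_interval) simp
  define F where "F n = integral {y..y + real n} (\<lambda>x. \<bar>g x\<bar>)" for n :: nat
  have eq: "integral {0..1} (\<lambda>x. \<bar>g (y + real n + x)\<bar>) = F (Suc n) - F n" for n
  proof -
    have "((\<lambda>x. \<bar>g x\<bar>) has_integral integral {y + real n..y + real (Suc n)} (\<lambda>x. \<bar>g x\<bar>)) (cbox (y + real n) (y + real (Suc n)))"
      using ci by (simp add: integrable_integral)
    from has_integral_affinity'[OF this, of 1 "y + real n"]
    have "integral {0..1} (\<lambda>x. \<bar>g (y + real n + x)\<bar>) = integral {y + real n..y + real (Suc n)} (\<lambda>x. \<bar>g x\<bar>)"
      by (intro integral_unique) (simp add: add_ac)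
    moreover have "F n + integral {y + real n..y + real (Suc n)} (\<lambda>x. \<bar>g x\<bar>) = F (Suc n)"
      unfolding F_def by (rule Henstock_Kurzweil_Integration.integral_combine[OF _ _ ci]) auto
    ultimately show ?thesis by simp
  qed
  have "convergent F"
  proof (rule Bseq_monoseq_convergent)
    have "\<bar>F n\<bar> \<le> integral UNIV (\<lambda>x. \<bar>g x\<bar>)" for n
      using integral_nonneg[OF ci] integral_subset_le[OF subset_UNIV ci i] by (simp add: F_def)
    then show "Bseq F" by (intro BseqI'[of _ "integral UNIV (\<lambda>x. \<bar>g x\<bar>)"]) simp
    have "F n \<le> F (Suc n)" for n unfolding F_def by (intro integral_subset_le ci) auto
    then show "monoseq F" by (auto simp: monoseq_Suc)
  qed
  then obtain l where l: "F \<longlonglongrightarrow> l" by (auto simp: convergent_def)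
  from tendsto_diff[OF LIMSEQ_Suc[OF l] l]
  show "(\<lambda>n. integral {0..1} (\<lambda>x. \<bar>g (y + real n + x)\<bar>)) \<longlonglongrightarrow> 0" by (simp add: eq)
qed

section \<open>Monomials as limits of ridge functions\<close>

text \<open>A list of vectors replaces a multi-index: each entry corresponds to one differentiation
  with respect to the weight, and the empty list gives the constant 1.\<close>

definition lin_monomial :: "'a::euclidean_space list \<Rightarrow> 'a \<Rightarrow> real" where
  "lin_monomial es z = prod_list (map (\<lambda>e. e \<bullet> z) es)"

lemma Ck_on_lin_monomial: "Ck_on k UNIV (lin_monomial es)"
proof (induction es)
  case Nil show ?case unfolding lin_monomial_def[abs_def] by (simp add: Ck_on_UNIV_const)
next
  case (Cons e es)
  have "lin_monomial (e # es) = (\<lambda>z. (e \<bullet> z) * lin_monomial es z)" by (auto simp: lin_monomial_def)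
  then show ?case using Ck_on_UNIV_mult[OF Ck_on_UNIV_linear[OF bounded_linear_inner_right] Cons] by simp
qed

text \<open>In the application \<open>S\<close> is an antiderivative of the activation and
  \<open>k = r + 1\<close>, so that the k-th derivative of \<open>S\<close> is the r-th derivative
  of the activation. The last two assumptions then come from r-finiteness.\<close>

locale ridge_subspace = Ck_subspace k X for k :: nat and X :: "('a::euclidean_space \<Rightarrow> real) set" +
  fixes S :: "real \<Rightarrow> real"
  assumes S_Ck: "Ck_on k UNIV S"
    and ridge: "(\<lambda>z. S (w \<bullet> z + b)) \<in> X"
    and S_vanishing: "vanishing_mean ((rderiv ^^ k) S)"
    and S_nonzero: "(rderiv ^^ k) S \<noteq> (\<lambda>x. 0)"
begin

definition ridge_ok :: "(real \<Rightarrow> real) \<Rightarrow> bool" where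
  "ridge_ok \<phi> \<longleftrightarrow> (\<forall>w b. (\<lambda>z. \<phi> (w \<bullet> z + b)) \<in> Ck_closure k X)"

text \<open>\<open>fwd_diff \<Phi>\<close> is the average of \<open>\<phi>\<close> over [x, x + 1]
  and thus a C^k limit of Riemann sums, each of which combines ridge functions with shifted
  biases.\<close>

lemma ridge_ok_average:
  assumes ok: "ridge_ok \<phi>" and Ck: "Ck_on k UNIV \<phi>" and \<Phi>: "\<And>x. (\<Phi> has_real_derivative \<phi> x) (at x)"
  shows "ridge_ok (fwd_diff \<Phi>)"
  unfolding ridge_ok_def
proof (intro allI)
  fix w :: 'a and b
  have c: "continuous_on UNIV \<phi>" using Ck by (rule Ck_on_UNIV_continuous)
  have lim: "(\<lambda>n. riemann_sum \<phi> n x) \<longlonglongrightarrow> fwd_diff \<Phi> x" for x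
  proof -
    have "filterlim (\<lambda>n. (n, x)) (sequentially \<times>\<^sub>F nhds x) sequentially"
      by (intro filterlim_Pair filterlim_ident tendsto_const)
    from filterlim_compose[OF riemann_sum_tendsto[OF c \<Phi>, of x] this]
    show ?thesis by (simp add: fwd_diff_def)
  qed
  show "(\<lambda>z. fwd_diff \<Phi> (w \<bullet> z + b)) \<in> Ck_closure k X"
  proof (rule closure_limit)
    show "Ck_conv_on k UNIV (\<lambda>n z. riemann_sum \<phi> n (w \<bullet> z + b))"
      by (rule Ck_conv_on_compose[OF riemann_sum_Ck[OF Ck] Ck_conv_on_fixed[OF Ck_on_affine] open_UNIV]) auto
    show "(\<lambda>n. riemann_sum \<phi> n (w \<bullet> z + b)) \<longlonglongrightarrow> fwd_diff \<Phi> (w \<bullet> z + b)" for z by (rule lim)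
    show "(\<lambda>z. riemann_sum \<phi> n (w \<bullet> z + b)) \<in> Ck_closure k X" for n
      unfolding riemann_sum_def add.assoc
      by (intro closure_sum closure_scale) (use ok in \<open>simp add: ridge_ok_def\<close>)
  qed
qed

text \<open>Each averaging gains one derivative, because the derivative of the average of
  \<open>f\<close> is \<open>fwd_diff f\<close>. The derivative of order k + j is tracked exactly,
  since it is the quantity that has to be nonzero.\<close>

lemma ridge_ok_smooth:
  "\<exists>f. Ck_on (k + j) UNIV f \<and> ridge_ok f \<and> (rderiv ^^ (k + j)) f = (fwd_diff ^^ j) ((rderiv ^^ k) S)"
proof (induction j)
  case 0
  show ?case using S_Ck ridge by (intro exI[of _ S]) (auto simp: ridge_ok_def intro: closure_superset)
next
  case (Suc j)
  then obtain f where f: "Ck_on (k + j) UNIV f" "ridge_ok f"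
    "(rderiv ^^ (k + j)) f = (fwd_diff ^^ j) ((rderiv ^^ k) S)" by blast
  obtain \<Phi> where \<Phi>: "\<And>x. (\<Phi> has_real_derivative f x) (at x)"
    using ex_antiderivative[OF Ck_on_UNIV_continuous[OF f(1)]] by blast
  have der: "(fwd_diff \<Phi> has_real_derivative fwd_diff f x) (at x)" for x
    unfolding fwd_diff_def by (intro DERIV_diff DERIV_shift[THEN iffD1] \<Phi>)
  have r: "rderiv (fwd_diff \<Phi>) = fwd_diff f" using pd_real_eq[OF der] by blast
  have "Ck_on (k + Suc j) UNIV (fwd_diff \<Phi>)"
    unfolding add_Suc_right Ck_on_real_Suc r using Ck_on_fwd_diff[OF f(1)] der real_differentiable_def by blast
  moreover have "ridge_ok (fwd_diff \<Phi>)"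
    by (rule ridge_ok_average[OF f(2) Ck_on_UNIV_le[OF f(1)] \<Phi>]) simp
  moreover have "(rderiv ^^ (k + Suc j)) (fwd_diff \<Phi>) = (rderiv ^^ (k + j)) (rderiv (fwd_diff \<Phi>))"
    by (simp add: funpow_swap1)
  ultimately show ?case
    using rderiv_funpow_fwd_diff[OF f(1)] f(3) r by (intro exI[of _ "fwd_diff \<Phi>"]) simp
qed

text \<open>Each entry of the list stands for one differentiation with respect to the weight in that
  direction, carried out as a C^k limit of difference quotients. Every one of them costs an order of
  differentiability of \<open>\<phi>\<close> beyond \<open>k\<close>.\<close>

lemma monomial_ridge:
  assumes "ridge_ok \<phi>" "Ck_on (k + length es) UNIV \<phi>"
  shows "(\<lambda>z. lin_monomial es z * (rderiv ^^ length es) \<phi> (w \<bullet> z + b)) \<in> Ck_closure k X"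
  using assms(2)
proof (induction es arbitrary: w b)
  case Nil then show ?case using assms(1) by (simp add: lin_monomial_def ridge_ok_def)
next
  case (Cons e es)
  define \<psi> where "\<psi> = (rderiv ^^ length es) \<phi>"
  have \<psi>: "Ck_on (Suc k) UNIV \<psi>" unfolding \<psi>_def by (rule Ck_on_real_funpow) (use Cons(2) in simp)
  have IH: "(\<lambda>z. lin_monomial es z * \<psi> (w \<bullet> z + b)) \<in> Ck_closure k X" for w b
    unfolding \<psi>_def by (rule Cons(1)[OF Ck_on_UNIV_le[OF Cons(2)]]) simp
  have \<psi>d: "\<And>x. \<psi> differentiable (at x)" "continuous_on UNIV (rderiv \<psi>)"
    using \<psi> Ck_on_UNIV_continuous[of k "rderiv \<psi>"] unfolding Ck_on_real_Suc by auto
  have "(\<lambda>z. lin_monomial es z * ((e \<bullet> z) * rderiv \<psi> (w \<bullet> z + b))) \<in> Ck_closure k X"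
  proof (rule closure_limit)
    show "Ck_conv_on k UNIV (\<lambda>n z. lin_monomial es z * diff_quot e w b \<psi> n z)"
      using Ck_conv_mult[OF Ck_conv_on_fixed[OF Ck_on_lin_monomial, unfolded Ck_conv_on_def]
        diff_quot_Ck[OF \<psi>, unfolded Ck_conv_on_def]] unfolding Ck_conv_on_def .
    show "(\<lambda>n. lin_monomial es z * diff_quot e w b \<psi> n z) \<longlonglongrightarrow> lin_monomial es z * ((e \<bullet> z) * rderiv \<psi> (w \<bullet> z + b))" for z
    proof -
      have "filterlim (\<lambda>n. (n, z)) (sequentially \<times>\<^sub>F nhds z) sequentially"
        by (intro filterlim_Pair filterlim_ident tendsto_const)
      from filterlim_compose[OF diff_quot_tendsto[OF \<psi>d, of e w b z] this]
      show ?thesis by (intro tendsto_mult tendsto_const) simp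
    qed
    show "(\<lambda>z. lin_monomial es z * diff_quot e w b \<psi> n z) \<in> Ck_closure k X" for n
    proof -
      have "(\<lambda>z. lin_monomial es z * diff_quot e w b \<psi> n z) =
        (\<lambda>z. real (Suc n) * (lin_monomial es z * \<psi> ((w + (1 / real (Suc n)) *\<^sub>R e) \<bullet> z + b)) +
           (- real (Suc n)) * (lin_monomial es z * \<psi> (w \<bullet> z + b)))"
        unfolding diff_quot_def by (intro ext) (simp add: inner_add_left algebra_simps)
      then show ?thesis using closure_add[OF closure_scale[OF IH] closure_scale[OF IH]] by simp
    qed
  qed
  then show ?case by (simp add: lin_monomial_def \<psi>_def mult_ac)
qed

text \<open>At weight 0 the ridge factor is a constant, the value of a derivative at the bias
  \<open>b\<close>. If it were 0 for every \<open>b\<close>, the derivative with \<open>k\<close>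
  further orders would vanish too, but that one is an iterated difference of the k-th derivative of
  \<open>S\<close>.\<close>

lemma monomial_in_closure: "lin_monomial es \<in> Ck_closure k X"
proof -
  obtain f where f: "Ck_on (k + length es) UNIV f" "ridge_ok f"
    "(rderiv ^^ (k + length es)) f = (fwd_diff ^^ length es) ((rderiv ^^ k) S)" using ridge_ok_smooth by blast
  have "\<exists>b. (rderiv ^^ length es) f b \<noteq> 0"
  proof (rule ccontr)
    assume "\<not> ?thesis"
    then have "(rderiv ^^ length es) f = (\<lambda>x. 0)" by auto
    then have "(rderiv ^^ (k + length es)) f = (rderiv ^^ k) (\<lambda>x. 0)" by (simp add: funpow_add)
    also have "\<dots> = (\<lambda>x. 0)"
    proof (induction k)
      case (Suc k)
      have "pd UNIV 1 (\<lambda>x::real. 0::real) = (\<lambda>x. 0)" using pd_const by blast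
      then show ?case by (simp add: Suc)
    qed simp
    finally show False using f(3) vanishing_mean_funpow[OF S_vanishing S_nonzero] by simp
  qed
  then obtain b where b: "(rderiv ^^ length es) f b \<noteq> 0" by blast
  from closure_scale[OF monomial_ridge[OF f(2,1), of 0 b], of "1 / (rderiv ^^ length es) f b"]
  show ?thesis using b by simp
qed

end

section \<open>Polynomial mollification\<close>

definition cube :: "real \<Rightarrow> 'a::euclidean_space set" where
  "cube c = cbox (- (c *\<^sub>R One)) (c *\<^sub>R One)"

lemma mem_cube: "x \<in> cube c \<longleftrightarrow> (\<forall>i\<in>Basis. \<bar>x \<bullet> i\<bar> \<le> c)"
  by (auto simp: cube_def mem_box abs_le_iff)

lemma compact_cube: "compact (cube c)"
  by (simp add: cube_def compact_cbox)

lemma norm_le_cube: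
  fixes c :: real
  assumes "x \<in> (cube c :: 'a::euclidean_space set)"
  shows "norm x \<le> DIM('a) * c"
proof -
  have "norm x \<le> (\<Sum>i\<in>Basis. \<bar>x \<bullet> i\<bar>)" by (rule norm_le_l1)
  also have "\<dots> \<le> (\<Sum>i\<in>(Basis::'a set). c)" using assms by (intro sum_mono) (auto simp: mem_cube)
  finally show ?thesis by simp
qed

lemma in_cube_norm: "norm x \<le> c \<Longrightarrow> x \<in> cube c"
  unfolding mem_cube using Basis_le_norm order_trans by blast

lemma content_cube_pos: "c > 0 \<Longrightarrow> measure lborel (cube c :: 'a::euclidean_space set) > 0"
  unfolding cube_def by (subst content_pos_lt_eq) auto

text \<open>The multidimensional Landau kernel: powers of a quadratic polynomial, normalised on a
  cube. The parameter \<open>T\<close> carries the type of the space, which does not occur in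
  \<open>c\<close> but determines the radius through its dimension.\<close>

locale landau_kernel =
  fixes c :: real and T :: "'a::euclidean_space itself"
  assumes c_pos: "c > 0"
begin

text \<open>Strictly larger than the norm of every point of \<open>cube c\<close>, so that
  \<open>\<kappa>\<close> does not change sign on the cube.\<close>

definition R :: real where "R = DIM('a) * c + 1"

definition \<kappa> :: "'a \<Rightarrow> real" where "\<kappa> y = 1 - (norm y)\<^sup>2 / R\<^sup>2"

definition mass :: "nat \<Rightarrow> real" where "mass n = integral (cube c) (\<lambda>y. \<kappa> y ^ n)"

lemma R_pos: "R > 0" using c_pos by (simp add: R_def add_nonneg_pos)

lemma kappa_cont: "continuous_on A (\<lambda>y. \<kappa> y ^ n)"
  unfolding \<kappa>_def using R_pos by (intro continuous_intros) auto

lemma kappa_integrable: "(\<lambda>y. \<kappa> y ^ n) integrable_on cube r"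
  unfolding cube_def by (rule integrable_continuous[OF kappa_cont])

lemma kappa_nonneg: "y \<in> cube c \<Longrightarrow> 0 \<le> \<kappa> y"
proof -
  assume "y \<in> cube c"
  then have "norm y \<le> R" using norm_le_cube[of y c] by (simp add: R_def)
  then have "(norm y)\<^sup>2 \<le> R\<^sup>2" by (intro power_mono) auto
  then show ?thesis using R_pos by (simp add: \<kappa>_def)
qed

text \<open>A small cube inside the ball of radius \<open>\<delta>\<close> already contributes this
  much, since \<open>\<kappa>\<close> is bounded below on the ball. The factor \<open>v\<close> is
  the volume of that small cube and does not depend on n.\<close>

lemma mass_lower:
  assumes "0 < \<delta>" "\<delta> \<le> R"
  obtains v where "v > 0" "\<And>n. v * (1 - \<delta>\<^sup>2 / R\<^sup>2) ^ n \<le> mass n"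
proof
  define \<rho> where "\<rho> = min c (\<delta> / DIM('a))"
  have \<rho>: "\<rho> > 0" "\<rho> \<le> c" "DIM('a) * \<rho> \<le> \<delta>" using c_pos assms
    by (auto simp: \<rho>_def min_def field_simps)
  show "measure lborel (cube \<rho> :: 'a set) > 0" using \<rho> by (intro content_cube_pos)
  fix n
  have sub: "cube \<rho> \<subseteq> (cube c :: 'a set)" using \<rho>(2) by (force simp: mem_cube)
  have b: "0 \<le> 1 - \<delta>\<^sup>2 / R\<^sup>2" using assms R_pos by (simp add: power_mono)
  have "measure lborel (cube \<rho> :: 'a set) * (1 - \<delta>\<^sup>2 / R\<^sup>2) ^ n = integral (cube \<rho> :: 'a set) (\<lambda>y. (1 - \<delta>\<^sup>2 / R\<^sup>2) ^ n)"
    unfolding cube_def by simp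
  also have "\<dots> \<le> integral (cube \<rho>) (\<lambda>y. \<kappa> y ^ n)"
  proof (rule integral_le)
    show "(\<lambda>y. (1 - \<delta>\<^sup>2 / R\<^sup>2) ^ n) integrable_on (cube \<rho> :: 'a set)" unfolding cube_def by (rule integrable_const)
    show "(\<lambda>y. \<kappa> y ^ n) integrable_on cube \<rho>" by (rule kappa_integrable)
    fix y :: 'a assume "y \<in> cube \<rho>"
    then have "norm y \<le> \<delta>" using norm_le_cube[of y \<rho>] \<rho>(3) by linarith
    then have "(norm y)\<^sup>2 / R\<^sup>2 \<le> \<delta>\<^sup>2 / R\<^sup>2" by (intro divide_right_mono power_mono) auto
    then show "(1 - \<delta>\<^sup>2 / R\<^sup>2) ^ n \<le> \<kappa> y ^ n" using b by (intro power_mono) (auto simp: \<kappa>_def)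
  qed
  also have "\<dots> \<le> mass n" unfolding mass_def
    by (intro integral_subset_le sub kappa_integrable ballI zero_le_power kappa_nonneg)
  finally show "measure lborel (cube \<rho> :: 'a set) * (1 - \<delta>\<^sup>2 / R\<^sup>2) ^ n \<le> mass n" .
qed

lemma mass_pos: "mass n > 0"
proof -
  obtain v where v: "v > 0" "\<And>n. v * (1 - (R/2)\<^sup>2 / R\<^sup>2) ^ n \<le> mass n"
    by (rule mass_lower[of "R/2"]) (use R_pos in auto)
  have "0 < v * (1 - (R/2)\<^sup>2 / R\<^sup>2) ^ n" using v(1) R_pos by (simp add: power_divide)
  then show ?thesis using v(2)[of n] by linarith
qed

text \<open>Outside the ball of radius \<open>\<delta>\<close> the kernel before normalisation is at
  most \<open>a ^ n\<close>, while the mass is at least \<open>v * b ^ n\<close> with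
  \<open>b\<close> taken from the ball of half the radius. As \<open>a < b\<close>, the quotient
  decays geometrically.\<close>

lemma kernel_tail:
  assumes "0 < \<delta>" "\<delta> \<le> R"
  obtains s where "s \<longlonglongrightarrow> 0" "\<And>n. 0 \<le> s n" "\<And>n y. y \<in> cube c \<Longrightarrow> \<delta> \<le> norm y \<Longrightarrow> \<kappa> y ^ n / mass n \<le> s n"
proof -
  define a b where "a = 1 - \<delta>\<^sup>2 / R\<^sup>2" and "b = 1 - (\<delta>/2)\<^sup>2 / R\<^sup>2"
  have ab: "0 \<le> a" "a < b" using assms R_pos by (auto simp: a_def b_def power_mono divide_strict_right_mono power_strict_mono)
  obtain v where v: "v > 0" "\<And>n. v * b ^ n \<le> mass n"
    unfolding b_def by (rule mass_lower[of "\<delta>/2"]) (use assms in auto)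
  show ?thesis
  proof (rule that[of "\<lambda>n. (1 / v) * (a / b) ^ n"])
    have "(\<lambda>n. (a / b) ^ n) \<longlonglongrightarrow> 0" using ab by (intro LIMSEQ_power_zero) auto
    then show "(\<lambda>n. (1 / v) * (a / b) ^ n) \<longlonglongrightarrow> 0" using tendsto_mult_right_zero by blast
    show "0 \<le> (1 / v) * (a / b) ^ n" for n using ab v by simp
    fix n and y :: 'a assume y: "y \<in> cube c" "\<delta> \<le> norm y"
    have "\<delta>\<^sup>2 / R\<^sup>2 \<le> (norm y)\<^sup>2 / R\<^sup>2" using y assms by (intro divide_right_mono power_mono) auto
    then have "\<kappa> y ^ n \<le> a ^ n" using kappa_nonneg[OF y(1)] by (intro power_mono) (auto simp: \<kappa>_def a_def)
    then have "\<kappa> y ^ n / mass n \<le> a ^ n / (v * b ^ n)"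
      using v ab mass_pos[of n] by (intro frac_le) auto
    then show "\<kappa> y ^ n / mass n \<le> (1 / v) * (a / b) ^ n" by (simp add: power_divide)
  qed
qed

definition mollify :: "('a \<Rightarrow> real) \<Rightarrow> nat \<Rightarrow> 'a \<Rightarrow> real" where
  "mollify f n z = integral (cube c) (\<lambda>y. (\<kappa> y ^ n / mass n) * f (z - y))"

lemma kernel_cont: "continuous_on A (\<lambda>y. \<kappa> y ^ n / mass n)"
  using mass_pos[of n] by (intro continuous_on_divide kappa_cont continuous_on_const) auto

lemma mollify_integrable:
  assumes "continuous_on UNIV f"
  shows "(\<lambda>y. (\<kappa> y ^ n / mass n) * f (z - y)) integrable_on cube c"
  unfolding cube_def
proof (rule integrable_continuous, rule continuous_on_mult[OF kernel_cont])
  show "continuous_on (cbox (- (c *\<^sub>R One)) (c *\<^sub>R One)) (\<lambda>y. f (z - y))"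
    by (rule continuous_on_compose2[OF assms]) (auto intro!: continuous_intros)
qed

lemma mollify_tendsto:
  assumes cf: "continuous_on UNIV f"
  shows "((\<lambda>(n, z). mollify f n z) \<longlongrightarrow> f w) (sequentially \<times>\<^sub>F nhds w)"
proof (rule tendstoI)
  fix \<epsilon> :: real assume e: "\<epsilon> > 0"
  obtain \<delta>0 where d0: "\<delta>0 > 0" "\<And>u. dist u w < \<delta>0 \<Longrightarrow> dist (f u) (f w) < \<epsilon>/3"
    using cf e unfolding continuous_on_iff by (metis UNIV_I zero_less_divide_iff zero_less_numeral)
  \<comment> \<open>At most \<open>R\<close> for the tail estimate, at most 1 so that
    \<open>z - y\<close> remains in the compact set \<open>A\<close>, and at most half of
    \<open>\<delta>0\<close> because both \<open>z - w\<close> and \<open>y\<close> contribute to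
    the displacement.\<close>
  define \<delta> where "\<delta> = min R (min 1 (\<delta>0 / 2))"
  have \<delta>: "0 < \<delta>" "\<delta> \<le> R" "\<delta> \<le> 1" "2 * \<delta> \<le> \<delta>0" using d0 R_pos by (auto simp: \<delta>_def)
  obtain s where s: "s \<longlonglongrightarrow> 0" "\<And>n. 0 \<le> s n" "\<And>n y. y \<in> cube c \<Longrightarrow> \<delta> \<le> norm y \<Longrightarrow> \<kappa> y ^ n / mass n \<le> s n"
    using kernel_tail[OF \<delta>(1,2)] by metis
  define A where "A = (\<lambda>(x, y). x - y) ` (cball w 1 \<times> (cube c :: 'a set))"
  have "compact A" unfolding A_def case_prod_unfold
    by (intro compact_continuous_image compact_Times compact_cube compact_cball continuous_intros)
  then have "bounded (f ` A)" by (intro compact_imp_bounded compact_continuous_image continuous_on_subset[OF cf]) auto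
  then obtain M where M: "\<And>u. u \<in> A \<Longrightarrow> \<bar>f u\<bar> \<le> M" unfolding bounded_iff by auto
  define M' where "M' = \<bar>M\<bar> + \<bar>f w\<bar>"
  define v where "v = measure lborel (cube c :: 'a set)"
  have v: "v \<ge> 0" by (simp add: v_def)
  have "(\<lambda>n. M' * s n * v) \<longlonglongrightarrow> M' * 0 * v" by (intro tendsto_intros s)
  then have "\<forall>\<^sub>F n in sequentially. M' * s n * v < \<epsilon>/3" using e by (intro order_tendstoD) auto
  moreover have "\<forall>\<^sub>F z in nhds w. dist z w < \<delta>" unfolding eventually_nhds_metric using \<delta> by auto
  moreover have "dist (mollify f n z) (f w) < \<epsilon>" if n: "M' * s n * v < \<epsilon>/3" and z: "dist z w < \<delta>" for n z
  proof -
    let ?q = "\<lambda>y. \<kappa> y ^ n / mass n"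
    have q0: "0 \<le> ?q y" if "y \<in> cube c" for y using kappa_nonneg[OF that] mass_pos[of n] by simp
    have qi: "?q integrable_on cube c" unfolding cube_def by (rule integrable_continuous[OF kernel_cont])
    have q1: "integral (cube c) ?q = 1"
      using mass_pos[of n] by (simp add: mass_def divide_inverse)
    have ci: "(\<lambda>y. ?q y * f w) integrable_on cube c" using qi by (rule integrable_on_mult_left)
    have "mollify f n z - f w = integral (cube c) (\<lambda>y. ?q y * f (z - y)) - integral (cube c) (\<lambda>y. ?q y * f w)"
      using q1 by (simp add: mollify_def)
    also have "\<dots> = integral (cube c) (\<lambda>y. ?q y * f (z - y) - ?q y * f w)"
      by (rule integral_diff[symmetric, OF mollify_integrable[OF cf] ci])
    also have "norm \<dots> \<le> integral (cube c) (\<lambda>y. ?q y * (\<epsilon>/3) + M' * s n)"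
    proof (rule integral_norm_bound_integral)
      show "(\<lambda>y. ?q y * f (z - y) - ?q y * f w) integrable_on cube c"
        by (rule integrable_diff[OF mollify_integrable[OF cf] ci])
      show "(\<lambda>y. ?q y * (\<epsilon>/3) + M' * s n) integrable_on cube c"
        by (intro integrable_add integrable_on_mult_left qi) (auto simp: cube_def)
      fix y :: 'a assume y: "y \<in> cube c"
      have eq: "norm (?q y * f (z - y) - ?q y * f w) = ?q y * \<bar>f (z - y) - f w\<bar>"
        using q0[OF y] by (simp only: right_diff_distrib[symmetric] real_norm_def abs_mult abs_of_nonneg)
      have sn: "0 \<le> M' * s n" using s(2)[of n] by (simp add: M'_def)
      show "norm (?q y * f (z - y) - ?q y * f w) \<le> ?q y * (\<epsilon>/3) + M' * s n"
      proof (cases "norm y < \<delta>")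
        case True
        have "dist (z - y) w \<le> dist z w + norm y"
          using norm_triangle_ineq4[of "z - w" y] by (simp add: dist_norm algebra_simps)
        then have "\<bar>f (z - y) - f w\<bar> \<le> \<epsilon>/3" using d0(2)[of "z - y"] True z \<delta>(4) by (simp add: dist_real_def)
        then have "?q y * \<bar>f (z - y) - f w\<bar> \<le> ?q y * (\<epsilon>/3)" using q0[OF y] by (rule mult_left_mono)
        then show ?thesis using eq sn by linarith
      next
        case False
        have "z \<in> cball w 1" using z \<delta>(3) by (simp add: dist_commute)
        then have "z - y \<in> A" unfolding A_def using y by force
        then have "\<bar>f (z - y) - f w\<bar> \<le> M'" using M[of "z - y"] by (simp add: M'_def)
        then have "?q y * \<bar>f (z - y) - f w\<bar> \<le> s n * M'"
          using s(3)[OF y, of n] False s(2)[of n] by (intro mult_mono) auto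
        moreover have "0 \<le> ?q y * (\<epsilon>/3)" using q0[OF y] e by (intro mult_nonneg_nonneg) auto
        ultimately show ?thesis using eq by (simp add: mult.commute)
      qed
    qed
    also have "\<dots> = integral (cube c) ?q * (\<epsilon>/3) + M' * s n * v"
    proof -
      have "integral (cube c) (\<lambda>y. ?q y * (\<epsilon>/3) + M' * s n) = integral (cube c) (\<lambda>y. ?q y * (\<epsilon>/3)) + integral (cube c :: 'a set) (\<lambda>y. M' * s n)"
        by (intro integral_add integrable_on_mult_left qi) (auto simp: cube_def)
      moreover have "integral (cube c :: 'a set) (\<lambda>y. M' * s n) = M' * s n * v" by (simp add: cube_def v_def)
      ultimately show ?thesis by (simp only: integral_mult_left)
    qed
    finally have "norm (mollify f n z - f w) \<le> 1 * (\<epsilon>/3) + M' * s n * v" unfolding q1 .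
    then show ?thesis using n e by (simp add: dist_real_def)
  qed
  ultimately show "\<forall>\<^sub>F x in sequentially \<times>\<^sub>F nhds w. dist (case x of (n, z) \<Rightarrow> mollify f n z) (f w) < \<epsilon>"
    unfolding eventually_prod_filter
    by (intro exI[of _ "\<lambda>n. M' * s n * v < \<epsilon>/3"] exI[of _ "\<lambda>z. dist z w < \<delta>"]) simp
qed

text \<open>Differentiation under the integral sign. The derivative of the integrand is assembled as
  a \<open>blinfun\<close> from the basis functionals, which reduces its joint continuity to
  continuity of the partial derivatives of \<open>f\<close>.\<close>

lemma mollify_has_derivative:
  assumes d: "\<And>x. f differentiable (at x)" and cb: "\<And>b. b \<in> Basis \<Longrightarrow> continuous_on UNIV (pd UNIV b f)"
  shows "(mollify f n has_derivative (\<lambda>v. \<Sum>b\<in>Basis. (v \<bullet> b) * mollify (pd UNIV b f) n z)) (at z)"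
proof -
  let ?q = "\<lambda>y. \<kappa> y ^ n / mass n"
  define fx where "fx x y = (\<Sum>b\<in>Basis. (?q y * pd UNIV b f (x - y)) *\<^sub>R blinfun_inner_left b)" for x y
  have fxa: "blinfun_apply (fx x y) v = (\<Sum>b\<in>Basis. (v \<bullet> b) * (?q y * pd UNIV b f (x - y)))" for x y v
    by (simp add: fx_def blinfun.sum_left blinfun.scaleR_left inner_commute mult_ac)
  have cf: "continuous_on UNIV f"
    using d by (intro differentiable_imp_continuous_on) (simp add: differentiable_on_def)
  have fc: "continuous_on (UNIV \<times> cbox (- (c *\<^sub>R One)) (c *\<^sub>R One)) (\<lambda>(x, y). fx x y)"
    unfolding fx_def case_prod_unfold
  proof (intro continuous_on_sum continuous_on_scaleR continuous_on_mult continuous_on_const)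
    show "continuous_on (UNIV \<times> cbox (- (c *\<^sub>R One)) (c *\<^sub>R One)) (\<lambda>p. ?q (snd p))"
      by (rule continuous_on_compose2[OF kernel_cont[of UNIV]]) (auto intro!: continuous_intros)
    fix b :: 'a assume b: "b \<in> Basis"
    show "continuous_on (UNIV \<times> cbox (- (c *\<^sub>R One)) (c *\<^sub>R One)) (\<lambda>p. pd UNIV b f (fst p - snd p))"
      by (rule continuous_on_compose2[OF cb[OF b]]) (auto intro!: continuous_intros)
  qed
  have fi: "fx z integrable_on cbox (- (c *\<^sub>R One)) (c *\<^sub>R One)"
  proof (rule integrable_continuous)
    have "continuous_on (cbox (- (c *\<^sub>R One)) (c *\<^sub>R One)) (\<lambda>y. (\<lambda>(x, y). fx x y) (z, y))"
      by (rule continuous_on_compose2[OF fc]) (auto intro!: continuous_intros)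
    then show "continuous_on (cbox (- (c *\<^sub>R One)) (c *\<^sub>R One)) (fx z)" by simp
  qed
  have D: "((\<lambda>x. integral (cbox (- (c *\<^sub>R One)) (c *\<^sub>R One)) (\<lambda>y. ?q y * f (x - y))) has_derivative
     integral (cbox (- (c *\<^sub>R One)) (c *\<^sub>R One)) (fx z)) (at z within UNIV)"
  proof (rule leibniz_rule[OF _ _ fc])
    show "((\<lambda>x. ?q t * f (x - t)) has_derivative blinfun_apply (fx x t)) (at x within UNIV)" for x t
    proof -
      have "((\<lambda>x. f (x - t)) has_derivative (\<lambda>v. pd UNIV v f (x - t))) (at x)"
        by (rule has_derivative_compose[OF _ has_derivative_pd[OF d], of "\<lambda>x. x - t" "\<lambda>v. v"])
          (auto intro!: derivative_eq_intros)
      then have "((\<lambda>x. ?q t * f (x - t)) has_derivative (\<lambda>v. ?q t * pd UNIV v f (x - t))) (at x)"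
        by (rule has_derivative_mult_right)
      moreover have "?q t * pd UNIV v f (x - t) = blinfun_apply (fx x t) v" for v
        unfolding fxa pd_basis_expansion[OF d, of v] by (simp add: sum_distrib_left mult_ac)
      ultimately show ?thesis by simp
    qed
    show "(\<lambda>y. ?q y * f (x - y)) integrable_on cbox (- (c *\<^sub>R One)) (c *\<^sub>R One)" for x
      using mollify_integrable[OF cf] by (simp add: cube_def)
  qed auto
  have E: "blinfun_apply (integral (cbox (- (c *\<^sub>R One)) (c *\<^sub>R One)) (fx z)) v = (\<Sum>b\<in>Basis. (v \<bullet> b) * mollify (pd UNIV b f) n z)" for v
  proof -
    have "blinfun_apply (integral (cube c) (fx z)) v = integral (cube c) (\<lambda>y. blinfun_apply (fx z y) v)"
      using fi unfolding cube_def by (rule blinfun_apply_integral)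
    also have "\<dots> = integral (cube c) (\<lambda>y. \<Sum>b\<in>Basis. (v \<bullet> b) * (?q y * pd UNIV b f (z - y)))" by (simp only: fxa)
    also have "\<dots> = (\<Sum>b\<in>Basis. integral (cube c) (\<lambda>y. (v \<bullet> b) * (?q y * pd UNIV b f (z - y))))"
      by (intro integral_sum integrable_on_mult_right mollify_integrable cb) auto
    finally show ?thesis unfolding mollify_def cube_def by (simp only: integral_mult_right)
  qed
  have m: "mollify f n = (\<lambda>x. integral (cbox (- (c *\<^sub>R One)) (c *\<^sub>R One)) (\<lambda>y. ?q y * f (x - y)))"
    by (simp only: mollify_def[abs_def] cube_def)
  show ?thesis using D unfolding m[symmetric] E .
qed

lemma mollify_Ck: "Ck_on k UNIV f \<Longrightarrow> Ck_conv_on k UNIV (mollify f)"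
proof (induction k arbitrary: f)
  case 0
  then have "continuous_on UNIV f" by simp
  from mollify_tendsto[OF this] show ?case by (intro Ck_conv_on_UNIV_0I) blast
next
  case (Suc k)
  have d: "\<And>x. f differentiable (at x)" and Ck': "\<And>b. b \<in> Basis \<Longrightarrow> Ck_on k UNIV (pd UNIV b f)"
    using Suc(2) unfolding Ck_on_UNIV_Suc by auto
  note der = mollify_has_derivative[OF d Ck_on_UNIV_continuous[OF Ck']]
  show ?case
  proof (rule Ck_conv_on_SucI)
    have "Ck_conv_on k UNIV (mollify f)" by (rule Suc(1)[OF Ck_on_UNIV_le[OF Suc(2)]]) simp
    then show "Ck_conv_on 0 UNIV (mollify f)" unfolding Ck_conv_on_def by (rule Ck_conv_le[OF le0])
    show "mollify f i differentiable at z" for i z using der by (rule differentiableI)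
    fix b :: 'a assume b: "b \<in> Basis"
    have "pd UNIV b (mollify f n) z = mollify (pd UNIV b f) n z" for n z
    proof -
      have "pd UNIV b (mollify f n) z = (\<Sum>b'\<in>Basis. (b \<bullet> b') * mollify (pd UNIV b' f) n z)" by (rule pd_eq[OF der])
      also have "\<dots> = (\<Sum>b'\<in>Basis. if b' = b then mollify (pd UNIV b f) n z else 0)"
        by (rule sum.cong) (use b in \<open>auto simp: inner_Basis\<close>)
      finally show ?thesis using b by simp
    qed
    then have "(\<lambda>n. pd UNIV b (mollify f n)) = mollify (pd UNIV b f)" by blast
    then show "Ck_conv_on k UNIV (\<lambda>n. pd UNIV b (mollify f n))" using Suc(1)[OF Ck'[OF b]] by simp
  qed
qed

end

section \<open>Integrals that are polynomials in a parameter\<close>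

text \<open>Polynomials in \<open>z\<close> whose coefficients are continuous functions of
  \<open>y\<close>. In this separated form, integration over \<open>y\<close> acts on the
  coefficients only and leaves a polynomial in \<open>z\<close>.\<close>

inductive sep_poly :: "('a::euclidean_space \<Rightarrow> 'a \<Rightarrow> real) \<Rightarrow> bool" where
  base: "continuous_on UNIV w \<Longrightarrow> sep_poly (\<lambda>z y. lin_monomial es z * w y)"
| add: "sep_poly P \<Longrightarrow> sep_poly Q \<Longrightarrow> sep_poly (\<lambda>z y. P z y + Q z y)"

lemma sep_poly_mult_base:
  assumes "sep_poly P" "continuous_on UNIV w"
  shows "sep_poly (\<lambda>z y. P z y * (lin_monomial es z * w y))"
  using assms(1)
proof induction
  case (base w' es')
  have "(\<lambda>z y. lin_monomial es' z * w' y * (lin_monomial es z * w y)) = (\<lambda>z y. lin_monomial (es' @ es) z * (w' y * w y))"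
    by (simp add: lin_monomial_def fun_eq_iff mult_ac)
  then show ?case using sep_poly.base[OF continuous_on_mult[OF base assms(2)]] by simp
next
  case (add P Q)
  then show ?case using sep_poly.add[OF add(3,4)] by (simp add: distrib_right)
qed

lemma sep_poly_mult:
  assumes "sep_poly P" "sep_poly Q"
  shows "sep_poly (\<lambda>z y. P z y * Q z y)"
  using assms(2)
proof induction
  case (base w es) then show ?case using sep_poly_mult_base[OF assms(1)] by simp
next
  case (add Q Q')
  then show ?case using sep_poly.add[OF add(3,4)] by (simp add: distrib_left)
qed

lemma sep_poly_continuous: "continuous_on UNIV w \<Longrightarrow> sep_poly (\<lambda>z y. w y)"
  using sep_poly.base[of w "[]"] by (simp add: lin_monomial_def)

lemma sep_poly_power: "sep_poly P \<Longrightarrow> sep_poly (\<lambda>z y. P z y ^ n)"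
  by (induction n) (auto intro: sep_poly_mult sep_poly_continuous)

lemma sep_poly_sum: "finite A \<Longrightarrow> (\<And>a. a \<in> A \<Longrightarrow> sep_poly (P a)) \<Longrightarrow> sep_poly (\<lambda>z y. \<Sum>a\<in>A. P a z y)"
  by (induction A rule: finite_induct) (auto intro: sep_poly.add sep_poly_continuous)

lemma sep_poly_kappa:
  "sep_poly (\<lambda>z y::'a::euclidean_space. 1 - (norm (z - y))\<^sup>2 / R)"
proof -
  have eq: "1 - (norm (z - y))\<^sup>2 / R = (1 - (y \<bullet> y) / R) +
      ((\<Sum>e\<in>Basis. lin_monomial [e] z * (2 * (e \<bullet> y) / R)) + (\<Sum>e\<in>Basis. lin_monomial [e, e] z * (- 1 / R)))"
    for z y :: 'a
  proof -
    have "(norm (z - y))\<^sup>2 = z \<bullet> z - 2 * (z \<bullet> y) + y \<bullet> y"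
      by (simp add: power2_norm_eq_inner inner_diff_left inner_diff_right inner_commute)
    moreover have "z \<bullet> z = (\<Sum>e\<in>Basis. lin_monomial [e, e] z)" "z \<bullet> y = (\<Sum>e\<in>Basis. lin_monomial [e] z * (e \<bullet> y))"
      using euclidean_inner[of z z] euclidean_inner[of z y] by (simp_all add: lin_monomial_def inner_commute)
    ultimately show ?thesis
      by (simp add: sum_divide_distrib sum_distrib_left sum_negf diff_divide_distrib add_divide_distrib mult_ac)
  qed
  show ?thesis unfolding eq
    by (intro sep_poly.add sep_poly_sum sep_poly.base sep_poly_continuous finite_Basis continuous_on_const)
      (auto intro!: continuous_intros simp: divide_inverse)
qed

context ridge_subspace
begin

lemma sep_poly_integral_in_closure:
  assumes "sep_poly P" "continuous_on UNIV f"
  shows "(\<forall>z. (\<lambda>y. f y * P z y) integrable_on cbox a b) \<and> (\<lambda>z. integral (cbox a b) (\<lambda>y. f y * P z y)) \<in> Ck_closure k X"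
  using assms(1)
proof induction
  case (base w es)
  have "continuous_on (cbox a b) (\<lambda>y. f y * w y)"
    by (intro continuous_on_mult continuous_on_subset[OF assms(2)] continuous_on_subset[OF base]) auto
  then have i: "(\<lambda>y. f y * w y) integrable_on cbox a b" by (rule integrable_continuous)
  have eq: "f y * (lin_monomial es z * w y) = lin_monomial es z * (f y * w y)" for y z by simp
  show ?case unfolding eq
  proof (intro conjI allI integrable_on_mult_right i)
    have "(\<lambda>z. integral (cbox a b) (\<lambda>y. lin_monomial es z * (f y * w y))) = (\<lambda>z. integral (cbox a b) (\<lambda>y. f y * w y) * lin_monomial es z)"
      by (simp add: fun_eq_iff)
    then show "(\<lambda>z. integral (cbox a b) (\<lambda>y. lin_monomial es z * (f y * w y))) \<in> Ck_closure k X"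
      using closure_scale[OF monomial_in_closure] by simp
  qed
next
  case (add P Q)
  have "(\<lambda>z. integral (cbox a b) (\<lambda>y. f y * P z y) + integral (cbox a b) (\<lambda>y. f y * Q z y)) \<in> Ck_closure k X"
    using add by (intro closure_add) auto
  then show ?case using add by (auto simp: distrib_left integral_add intro: integrable_add)
qed

text \<open>For \<open>z\<close> in \<open>cube c\<close> the substitution x = z - y moves the
  dependence on \<open>z\<close> from \<open>f\<close> into the kernel, where it is polynomial.
  Mollification and polynomial agree on the open interior of the cube, so all their derivatives
  agree on \<open>C\<close>.\<close>

lemma compact_support_approx:
  assumes f: "Ck_on k UNIV f" and supp: "\<And>x. x \<notin> cube c \<Longrightarrow> f x = 0" and c: "c > 0"
    and C: "compact C" "C \<subseteq> interior (cube c)" and e: "\<epsilon> > 0"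
  shows "\<exists>g\<in>X. Ck_near k C \<epsilon> f g"
proof -
  \<comment> \<open>If \<open>z\<close> and \<open>y\<close> lie in \<open>cube c\<close>, then
    \<open>z - y\<close> lies in \<open>cube (2 * c)\<close>. The kernel is integrated over this
    larger cube so that the whole support of \<open>f\<close> is seen from every such
    \<open>z\<close>.\<close>
  interpret landau_kernel "2 * c" "TYPE('a)" by unfold_locales (use c in simp)
  have cf: "continuous_on UNIV f" using f by (rule Ck_on_UNIV_continuous)
  have lim: "(\<lambda>n. mollify f n w) \<longlonglongrightarrow> f w" for w
  proof -
    have "filterlim (\<lambda>n. (n, w)) (sequentially \<times>\<^sub>F nhds w) sequentially"
      by (intro filterlim_Pair filterlim_ident tendsto_const)
    from filterlim_compose[OF mollify_tendsto[OF cf, of w] this] show ?thesis by simp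
  qed
  have e2: "\<epsilon>/2 > 0" using e by simp
  obtain n where n: "Ck_near k C (\<epsilon>/2) (mollify f n) f"
    using eventually_happens[OF Ck_conv_on_near[OF mollify_Ck[OF f] lim C(1) e2]] by auto
  define p where "p z = (1 / mass n) * integral (cube c) (\<lambda>y. f y * \<kappa> (z - y) ^ n)" for z
  have sp: "sep_poly (\<lambda>z y. \<kappa> (z - y) ^ n)" unfolding \<kappa>_def by (intro sep_poly_power sep_poly_kappa)
  note pi = sep_poly_integral_in_closure[OF sp cf, of "- (c *\<^sub>R One)" "c *\<^sub>R One", folded cube_def]
  have p: "p \<in> Ck_closure k X" unfolding p_def[abs_def] using pi by (intro closure_scale) simp
  have eq: "mollify f n z = p z" if z: "z \<in> cube c" for z
  proof -
    have "((\<lambda>y. f y * \<kappa> (z - y) ^ n) has_integral mass n * p z) (cbox (- (c *\<^sub>R One)) (c *\<^sub>R One))"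
      using pi mass_pos[of n] by (simp add: p_def cube_def integrable_integral)
    from has_integral_affinity[OF this, of "-1" z]
    have 1: "((\<lambda>x. f (z - x) * \<kappa> x ^ n) has_integral mass n * p z) ((\<lambda>x. z - x) ` cube c)"
      by (simp add: cube_def)
    have "((\<lambda>x. f (z - x) * \<kappa> x ^ n) has_integral mass n * p z) (cube (2 * c))"
    proof (rule has_integral_on_superset[OF 1])
      show "f (z - x) * \<kappa> x ^ n = 0" if "x \<notin> (\<lambda>x. z - x) ` cube c" for x
      proof -
        have "z - x \<notin> cube c" using that by (metis diff_diff_eq2 add_diff_cancel_left' image_eqI)
        then show ?thesis using supp by simp
      qed
      show "(\<lambda>x. z - x) ` cube c \<subseteq> cube (2 * c)"
      proof safe
        fix x :: 'a assume x: "x \<in> cube c"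
        show "z - x \<in> cube (2 * c)" unfolding mem_cube
        proof
          fix i :: 'a assume i: "i \<in> Basis"
          then have "\<bar>z \<bullet> i\<bar> \<le> c" "\<bar>x \<bullet> i\<bar> \<le> c" using x z unfolding mem_cube by auto
          then show "\<bar>(z - x) \<bullet> i\<bar> \<le> 2 * c" by (simp add: inner_diff_left)
        qed
      qed
    qed
    then have "((\<lambda>x. (1 / mass n) * (f (z - x) * \<kappa> x ^ n)) has_integral (1 / mass n) * (mass n * p z)) (cube (2 * c))"
      by (rule has_integral_mult_right)
    then have "((\<lambda>x. (\<kappa> x ^ n / mass n) * f (z - x)) has_integral p z) (cube (2 * c))"
      using mass_pos[of n] by (simp add: mult.commute)
    then show ?thesis unfolding mollify_def by (rule integral_unique)
  qed
  have np: "Ck_near k C (\<epsilon>/2) f p"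
    by (rule Ck_near_sym[OF Ck_near_cong_open[OF open_interior C(2) _ _ n]])
      (use eq interior_subset in auto)
  obtain g where g: "g \<in> X" "Ck_near k C (\<epsilon>/2) p g"
    using p C(1) e2 unfolding Ck_closure_def by blast
  have "Ck_near k C \<epsilon> f g" using Ck_near_trans[OF np g(2)] by simp
  then show ?thesis using g(1) by blast
qed

end

section \<open>Cut-off functions and universal approximation\<close>

lemma pos_part_power_deriv:
  "((\<lambda>s::real. max 0 s ^ Suc (Suc k)) has_real_derivative real (Suc (Suc k)) * max 0 s ^ Suc k) (at s)"
proof (cases s "0::real" rule: linorder_cases)
  case less
  have "((\<lambda>s::real. 0) has_real_derivative 0) (at s)" by simp
  then have "((\<lambda>s::real. max 0 s ^ Suc (Suc k)) has_real_derivative 0) (at s)"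
    by (rule has_field_derivative_transform_within_open[of _ _ _ "{..<0}"]) (use less in auto)
  then show ?thesis using less by simp
next
  case greater
  have "((\<lambda>s::real. s ^ Suc (Suc k)) has_real_derivative real (Suc (Suc k)) * s ^ Suc k) (at s)"
    using DERIV_pow[of "Suc (Suc k)" s] by simp
  then have "((\<lambda>s::real. max 0 s ^ Suc (Suc k)) has_real_derivative real (Suc (Suc k)) * s ^ Suc k) (at s)"
    by (rule has_field_derivative_transform_within_open[of _ _ _ "{0<..}"]) (use greater in auto)
  then show ?thesis using greater by simp
next
  case equal
  have "((\<lambda>h::real. max 0 h ^ Suc k) \<longlongrightarrow> max 0 0 ^ Suc k) (at 0)" by (intro tendsto_intros)
  then have lim: "((\<lambda>h::real. max 0 h ^ Suc k) \<longlongrightarrow> 0) (at 0)" by simp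
  have "((\<lambda>h::real. max 0 h ^ Suc (Suc k) / h) \<longlongrightarrow> 0) (at 0)"
  proof (rule Lim_null_comparison[OF always_eventually lim], rule allI)
    fix h :: real
    show "norm (max 0 h ^ Suc (Suc k) / h) \<le> max 0 h ^ Suc k" by (cases "h \<le> 0") auto
  qed
  then show ?thesis unfolding equal has_field_derivative_iff by simp
qed

lemma Ck_on_pos_part_power: "Ck_on k UNIV (\<lambda>s::real. max 0 s ^ Suc k)"
proof (induction k)
  case 0 show ?case by (auto intro!: continuous_intros)
next
  case (Suc k)
  have "pd UNIV 1 (\<lambda>s::real. max 0 s ^ Suc (Suc k)) = (\<lambda>s. real (Suc (Suc k)) * max 0 s ^ Suc k)"
    using pd_real_eq[OF pos_part_power_deriv] by blast
  moreover have "(\<lambda>s::real. max 0 s ^ Suc (Suc k)) differentiable (at s)" for s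
    using pos_part_power_deriv real_differentiable_def by blast
  ultimately show ?case
    unfolding Ck_on_real_Suc using Ck_on_UNIV_mult[OF Ck_on_UNIV_const Suc] by simp
qed

text \<open>Truncated powers provide a cut-off of the finite order \<open>k\<close>. The function
  \<open>w\<close> sums bumps supported in balls of radius \<open>e / 2\<close> and is at least
  \<open>c\<close> on the balls of radius \<open>e / 4\<close>; the outer truncated power then
  removes the positive part of 1 - w/c, leaving the value 1 on these smaller balls.\<close>

lemma smooth_cutoff:
  fixes C :: "'a::euclidean_space set"
  assumes C: "compact C" "C \<subseteq> U" "open U"
  obtains \<chi>' S N where "Ck_on k UNIV (\<chi>' :: 'a \<Rightarrow> real)" "compact S" "S \<subseteq> U" "open N" "C \<subseteq> N" "N \<subseteq> U"
    "\<And>z. z \<notin> S \<Longrightarrow> \<chi>' z = 0" "\<And>z. z \<in> N \<Longrightarrow> \<chi>' z = 1"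
proof -
  obtain e where e: "e > 0" "(\<Union>x\<in>C. ball x e) \<subseteq> U"
    using compact_subset_open_imp_ball_epsilon_subset[OF C(1,3,2)] by blast
  obtain F where F: "F \<subseteq> C" "finite F" "C \<subseteq> (\<Union>x\<in>F. ball x (e/4))"
    by (rule compactE_image[OF C(1), of C "\<lambda>x. ball x (e/4)"]) (use e in auto)
  define N where "N = (\<Union>x\<in>F. ball x (e/4))"
  define S where "S = (\<Union>x\<in>F. cball x (e/2))"
  define w where "w z = (\<Sum>x\<in>F. max 0 ((e/2)\<^sup>2 - (norm (z - x))\<^sup>2) ^ Suc k)" for z
  define c where "c = ((e/2)\<^sup>2 - (e/4)\<^sup>2) ^ Suc k"
  have c: "c > 0" unfolding c_def using e by (intro zero_less_power) (simp add: power_divide)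
  define \<chi>' where "\<chi>' z = 1 - max 0 (1 - (1 / c) * w z) ^ Suc k" for z
  have quad: "Ck_on k UNIV (\<lambda>z. (e/2)\<^sup>2 - (norm (z - x))\<^sup>2)" for x
  proof -
    have "(e/2)\<^sup>2 - (norm (z - x))\<^sup>2 = (e/2)\<^sup>2 - (\<Sum>b\<in>Basis. (b \<bullet> z + - (b \<bullet> x)) * (b \<bullet> z + - (b \<bullet> x)))" for z
      using euclidean_inner[of "z - x" "z - x"] by (simp add: power2_norm_eq_inner inner_commute inner_diff_right)
    then show ?thesis
      by (simp only:) (intro Ck_on_UNIV_diff Ck_on_UNIV_const Ck_on_UNIV_sum Ck_on_UNIV_mult Ck_on_affine)
  qed
  have w: "Ck_on k UNIV w" unfolding w_def[abs_def]
    by (intro Ck_on_UNIV_sum Ck_on_UNIV_compose[OF Ck_on_pos_part_power] quad)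
  show ?thesis
  proof (rule that[of \<chi>' S N])
    show "Ck_on k UNIV \<chi>'" unfolding \<chi>'_def[abs_def]
      by (intro Ck_on_UNIV_diff Ck_on_UNIV_const Ck_on_UNIV_compose[OF Ck_on_pos_part_power] Ck_on_UNIV_mult w)
    show "compact S" unfolding S_def using F by (intro compact_UN) auto
    have sub: "cball x (e/2) \<subseteq> U" if "x \<in> F" for x
    proof -
      have "cball x (e/2) \<subseteq> ball x e" using e by auto
      then show ?thesis using e(2) F(1) that by blast
    qed
    then show "S \<subseteq> U" unfolding S_def by blast
    have "ball x (e/4) \<subseteq> cball x (e/2)" for x :: 'a using e by auto
    then show "N \<subseteq> U" unfolding N_def using sub by blast
    show "open N" unfolding N_def by auto
    show "C \<subseteq> N" unfolding N_def by (rule F(3))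
    show "\<chi>' z = 0" if "z \<notin> S" for z
    proof -
      have "max 0 ((e/2)\<^sup>2 - (norm (z - x))\<^sup>2) = 0" if "x \<in> F" for x
      proof -
        have "e/2 \<le> norm (z - x)" using \<open>z \<notin> S\<close> that by (force simp: S_def dist_norm norm_minus_commute)
        then have "(e/2)\<^sup>2 \<le> (norm (z - x))\<^sup>2" using e by (intro power_mono) auto
        then show ?thesis by simp
      qed
      then have "w z = 0" unfolding w_def by (intro sum.neutral) (auto simp: power_0_left)
      then show ?thesis by (simp add: \<chi>'_def)
    qed
    show "\<chi>' z = 1" if z: "z \<in> N" for z
    proof -
      obtain x where x: "x \<in> F" "norm (z - x) < e/4" using z by (auto simp: N_def dist_norm norm_minus_commute)
      have "(norm (z - x))\<^sup>2 \<le> (e/4)\<^sup>2" using x by (intro power_mono) auto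
      moreover have "(e/4)\<^sup>2 \<le> (e/2)\<^sup>2" using e by (intro power_mono) auto
      ultimately have "c \<le> max 0 ((e/2)\<^sup>2 - (norm (z - x))\<^sup>2) ^ Suc k" unfolding c_def by (intro power_mono) auto
      also have "\<dots> \<le> w z" unfolding w_def
        by (rule member_le_sum[OF x(1)]) (use F in auto)
      finally have "1 \<le> (1 / c) * w z" using c by (simp add: field_simps)
      then show ?thesis by (simp add: \<chi>'_def)
    qed
  qed
qed

lemma Ck_on_open_SucD:
  "open U \<Longrightarrow> Ck_on (Suc k) U f \<Longrightarrow> Ck_on k U f"
proof (induction k arbitrary: f)
  case 0 then show ?case by (simp add: differentiable_imp_continuous_on)
next
  case (Suc k) then show ?case by simp
qed

text \<open>The extension vanishes on the open complement of \<open>S\<close>, which together with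
  \<open>U\<close> covers the space. By the product rule its partial derivatives are sums of two
  extensions of the same form, so \<open>V\<close> and the cut-off vary in the induction.\<close>

lemma Ck_on_cutoff_extend:
  fixes V \<chi>' :: "'a::euclidean_space \<Rightarrow> real"
  assumes U: "open U" and S: "closed S" "S \<subseteq> U"
  shows "Ck_on k U V \<Longrightarrow> Ck_on k UNIV \<chi>' \<Longrightarrow> (\<And>z. z \<notin> S \<Longrightarrow> \<chi>' z = 0) \<Longrightarrow>
     Ck_on k UNIV (\<lambda>z. if z \<in> U then \<chi>' z * V z else 0)"
proof (induction k arbitrary: V \<chi>')
  case 0
  have "continuous_on (U \<union> - S) (\<lambda>z. if z \<in> U then \<chi>' z * V z else 0)"
  proof (rule continuous_on_open_Un[OF U])
    have "continuous_on U (\<lambda>z. \<chi>' z * V z)" using 0 by (auto intro!: continuous_on_mult intro: continuous_on_subset)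
    then show "continuous_on U (\<lambda>z. if z \<in> U then \<chi>' z * V z else 0)" by (simp cong: continuous_on_cong)
    have "continuous_on (- S) (\<lambda>z. 0 :: real)" by simp
    then show "continuous_on (- S) (\<lambda>z. if z \<in> U then \<chi>' z * V z else 0)"
      using 0(3) by (subst continuous_on_cong[OF refl, where g = "\<lambda>z. 0"]) auto
  qed (use S in auto)
  moreover have "U \<union> - S = UNIV" using S by auto
  ultimately show ?case by simp
next
  case (Suc k)
  let ?f = "\<lambda>z. if z \<in> U then \<chi>' z * V z else 0"
  have dV: "V differentiable (at z)" if "z \<in> U" for z
  proof -
    have "V differentiable (at z within U)" using Suc(2) that by (simp add: differentiable_on_def)
    then show ?thesis by (simp only: at_within_open[OF that U])
  qed
  have d\<chi>: "\<chi>' differentiable (at z)" for z using Suc(3) unfolding Ck_on_UNIV_Suc by blast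
  have d\<chi>0: "pd UNIV b \<chi>' z = 0" if "z \<notin> S" for b z
  proof -
    have "(\<chi>' has_derivative (\<lambda>h. 0)) (at z)"
      by (rule has_derivative_transform_within_open[OF has_derivative_const[of 0] open_Compl[OF S(1)]])
        (use that Suc(4) in auto)
    then show ?thesis by (rule pd_eq)
  qed
  have der: "(?f has_derivative (\<lambda>v. if z \<in> U then \<chi>' z * pd UNIV v V z + pd UNIV v \<chi>' z * V z else 0)) (at z)" for z
  proof (cases "z \<in> U")
    case True
    have "((\<lambda>z. \<chi>' z * V z) has_derivative (\<lambda>v. \<chi>' z * pd UNIV v V z + pd UNIV v \<chi>' z * V z)) (at z)"
      by (intro has_derivative_mult has_derivative_pd d\<chi> dV True)
    then have "(?f has_derivative (\<lambda>v. \<chi>' z * pd UNIV v V z + pd UNIV v \<chi>' z * V z)) (at z)"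
      by (rule has_derivative_transform_within_open[OF _ U True]) auto
    then show ?thesis using True by simp
  next
    case False
    have "(?f has_derivative (\<lambda>h. 0)) (at z)"
      by (rule has_derivative_transform_within_open[OF has_derivative_const[of 0] open_Compl[OF S(1)]])
        (use False S Suc(4) in auto)
    then show ?thesis using False by simp
  qed
  show ?case unfolding Ck_on_UNIV_Suc
  proof (intro conjI allI ballI)
    show "?f differentiable (at z)" for z using der by (rule differentiableI)
    fix b :: 'a assume b: "b \<in> Basis"
    have "pd UNIV b ?f = (\<lambda>z. (if z \<in> U then \<chi>' z * pd UNIV b V z else 0) + (if z \<in> U then pd UNIV b \<chi>' z * V z else 0))"
      using pd_eq[OF der] by (intro ext) auto
    moreover have "Ck_on k UNIV (\<lambda>z. if z \<in> U then \<chi>' z * pd UNIV b V z else 0)"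
      by (rule Suc(1)) (use Suc(2-4) b Ck_on_UNIV_le[OF Suc(3), of k] in \<open>auto simp: pd_def\<close>)
    moreover have "Ck_on k UNIV (\<lambda>z. if z \<in> U then pd UNIV b \<chi>' z * V z else 0)"
      by (rule Suc(1)[OF Ck_on_open_SucD[OF U Suc(2)]]) (use Suc(3)[unfolded Ck_on_UNIV_Suc] b d\<chi>0 in auto)
    ultimately show "Ck_on k UNIV (pd UNIV b ?f)" using Ck_on_UNIV_add by simp
  qed
qed

text \<open>The cut-off is 1 on an open neighbourhood of \<open>C\<close>, so passing from
  \<open>V\<close> to its compactly supported extension changes no derivative on
  \<open>C\<close>.\<close>

theorem (in ridge_subspace) universal_approximation:
  assumes U: "open U" and V: "Ck_on k U V" and C: "compact C" "C \<subseteq> U" and e: "\<epsilon> > 0"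
  shows "\<exists>g\<in>X. Ck_near k C \<epsilon> V g"
proof -
  obtain \<chi>' :: "'a \<Rightarrow> real" and S N where \<chi>': "Ck_on k UNIV \<chi>'" "compact S" "S \<subseteq> U" "open N" "C \<subseteq> N" "N \<subseteq> U"
    "\<And>z. z \<notin> S \<Longrightarrow> \<chi>' z = 0" "\<And>z. z \<in> N \<Longrightarrow> \<chi>' z = 1"
    using smooth_cutoff[OF C U] by metis
  define f where "f z = (if z \<in> U then \<chi>' z * V z else 0)" for z
  have f: "Ck_on k UNIV f" unfolding f_def[abs_def]
    by (rule Ck_on_cutoff_extend[OF U compact_imp_closed[OF \<chi>'(2)] \<chi>'(3) V \<chi>'(1,7)])
  have "bounded (S \<union> C)" using \<chi>'(2) C by (simp add: compact_imp_bounded)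
  then obtain M where M: "\<And>x. x \<in> S \<union> C \<Longrightarrow> norm x \<le> M" unfolding bounded_iff by blast
  define c where "c = \<bar>M\<bar> + 1"
  have c: "c > 0" by (simp add: c_def)
  have supp: "f x = 0" if "x \<notin> cube c" for x
  proof -
    have "x \<notin> S" using that in_cube_norm[of x c] M[of x] by (force simp: c_def)
    then show ?thesis using \<chi>'(7) by (simp add: f_def)
  qed
  have "ball 0 c \<subseteq> (cube c :: 'a set)" by (auto intro!: in_cube_norm)
  then have "ball 0 c \<subseteq> interior (cube c :: 'a set)" by (simp add: interior_maximal)
  moreover have "C \<subseteq> ball 0 c" using M by (force simp: c_def)
  ultimately have "C \<subseteq> interior (cube c)" by blast
  from compact_support_approx[OF f supp c C(1) this e] obtain g where g: "g \<in> X" "Ck_near k C \<epsilon> f g" by blast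
  have "Ck_near k C \<epsilon> V g"
    by (rule Ck_near_cong_open[OF \<chi>'(4,5) _ _ g(2)]) (use \<chi>'(6,8) in \<open>auto simp: f_def\<close>)
  then show ?thesis using g(1) by blast
qed

section \<open>Gradient modules\<close>

text \<open>Each entry of the list is one neuron: outer coefficient, weight vector, bias.
  Concatenating lists adds the functions.\<close>

definition ridge_net :: "(real \<Rightarrow> real) \<Rightarrow> (real \<times> 'a::euclidean_space \<times> real) list \<Rightarrow> 'a \<Rightarrow> real" where
  "ridge_net S ps z = (\<Sum>(a, w, b)\<leftarrow>ps. a * S (w \<bullet> z + b))"

lemma Ck_on_ridge_net:
  assumes "Ck_on k UNIV S"
  shows "Ck_on k UNIV (ridge_net S ps)"
proof (induction ps)
  case Nil then show ?case by (simp add: ridge_net_def[abs_def] Ck_on_UNIV_const)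
next
  case (Cons p ps)
  obtain a w b where p: "p = (a, w, b)" by (cases p)
  have "ridge_net S (p # ps) = (\<lambda>z. a * S (w \<bullet> z + b) + ridge_net S ps z)"
    by (auto simp: ridge_net_def p)
  then show ?case
    by (simp only:) (intro Ck_on_UNIV_add Ck_on_UNIV_mult Ck_on_UNIV_const Cons
        Ck_on_UNIV_compose[OF assms Ck_on_affine])
qed

lemma ridge_subspace_ridge_net:
  assumes "Ck_on k UNIV S" "vanishing_mean ((rderiv ^^ k) S)" "(rderiv ^^ k) S \<noteq> (\<lambda>x. 0)"
  shows "ridge_subspace k (range (ridge_net S :: _ \<Rightarrow> 'a::euclidean_space \<Rightarrow> real)) S"
proof
  fix f g :: "'a \<Rightarrow> real" and c :: real and w :: 'a and b :: real
  show "Ck_on k UNIV f" if "f \<in> range (ridge_net S)" using that Ck_on_ridge_net[OF assms(1)] by auto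
  show "(\<lambda>z. 0) \<in> range (ridge_net S :: _ \<Rightarrow> 'a \<Rightarrow> real)"
    by (rule range_eqI[of _ _ "[]"]) (simp add: ridge_net_def fun_eq_iff)
  show "(\<lambda>z. f z + g z) \<in> range (ridge_net S)" if fg: "f \<in> range (ridge_net S)" "g \<in> range (ridge_net S)"
  proof -
    obtain ps qs where "f = ridge_net S ps" "g = ridge_net S qs" using fg by auto
    then show ?thesis by (intro range_eqI[of _ _ "ps @ qs"]) (simp add: ridge_net_def fun_eq_iff)
  qed
  show "(\<lambda>z. c * f z) \<in> range (ridge_net S)" if f: "f \<in> range (ridge_net S)"
  proof -
    obtain ps where "f = ridge_net S ps" using f by auto
    moreover have "c * ridge_net S ps z = ridge_net S (map (\<lambda>(a, w, b). (c * a, w, b)) ps) z" for z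
      by (induction ps) (auto simp: ridge_net_def distrib_left)
    ultimately show ?thesis by (intro range_eqI[of _ _ "map (\<lambda>(a, w, b). (c * a, w, b)) ps"]) (simp add: fun_eq_iff)
  qed
  show "(\<lambda>z. S (w \<bullet> z + b)) \<in> range (ridge_net S)"
    by (rule range_eqI[of _ _ "[(1, w, b)]"]) (simp add: ridge_net_def fun_eq_iff)
qed (use assms in auto)

lemma funpow_deriv_eq_rderiv: "Ck_on r UNIV f \<Longrightarrow> (deriv ^^ r) f = (rderiv ^^ r) f"
proof (induction r arbitrary: f)
  case (Suc r)
  then have d: "\<And>x. f differentiable (at x)" "Ck_on r UNIV (rderiv f)" unfolding Ck_on_real_Suc by auto
  have "deriv f = rderiv f" using DERIV_imp_deriv[OF has_real_derivative_pd[OF d(1)]] by blast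
  then show ?case using Suc(1)[OF d(2)] by (simp add: funpow_swap1)
qed simp

text \<open>A compact neighbourhood of a point of \<open>U\<close> is eventually contained in
  \<open>C n\<close>, where the error is below \<open>1 / Suc n\<close>; this is continuous
  convergence. Partial derivatives inherit the closeness with one order less, which carries the
  induction.\<close>

lemma Ck_near_exhaustion_conv:
  fixes V :: "'a::euclidean_space \<Rightarrow> real"
  assumes U: "open U" and C: "\<And>K. compact K \<Longrightarrow> K \<subseteq> U \<Longrightarrow> \<exists>N. \<forall>n\<ge>N. K \<subseteq> C n"
  shows "Ck_on k U V \<Longrightarrow> (\<And>n. Ck_on k UNIV (g n)) \<Longrightarrow> (\<And>n. Ck_near k (C n) (1 / real (Suc n)) V (g n)) \<Longrightarrow>
    Ck_conv_on k U g \<and> (\<forall>w\<in>U. (\<lambda>n. g n w) \<longlonglongrightarrow> V w)"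
proof (induction k arbitrary: V g)
  case 0
  have near: "\<bar>g n z - V z\<bar> < 1 / real (Suc n)" if "z \<in> C n" for n z
    using 0(3)[of n] that unfolding Ck_near_def by (auto simp: dist_real_def abs_minus_commute dest: spec[of _ "[]"])
  have lim: "((\<lambda>(n, z). g n z) \<longlongrightarrow> V w) (sequentially \<times>\<^sub>F inf (nhds w) (principal U))" if w: "w \<in> U" for w
  proof -
    have Vc: "(V \<longlongrightarrow> V w) (nhds w)"
      using 0(1) w U by (simp add: continuous_on_eq_continuous_at isCont_def tendsto_at_iff_tendsto_nhds)
    obtain \<delta> where \<delta>: "\<delta> > 0" "cball w \<delta> \<subseteq> U" using U w open_contains_cball by blast
    obtain N where N: "\<And>n. n \<ge> N \<Longrightarrow> cball w \<delta> \<subseteq> C n" using C[OF compact_cball \<delta>(2)] by blast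
    have inv: "((\<lambda>p. 1 / real (Suc (fst p))) \<longlongrightarrow> 0) (sequentially \<times>\<^sub>F nhds w)"
      by (rule filterlim_compose[OF LIMSEQ_Suc[OF lim_1_over_n] filterlim_fst])
    have "((\<lambda>p. g (fst p) (snd p) - V (snd p)) \<longlongrightarrow> 0) (sequentially \<times>\<^sub>F nhds w)"
    proof (rule Lim_null_comparison[OF _ inv])
      have "\<forall>\<^sub>F n in sequentially. n \<ge> N" by (rule eventually_ge_at_top)
      moreover have "\<forall>\<^sub>F z in nhds w. dist z w < \<delta>" unfolding eventually_nhds_metric using \<delta> by auto
      moreover have "norm (g n z - V z) \<le> 1 / real (Suc n)" if "n \<ge> N" "dist z w < \<delta>" for n z
        using near[of z n] N[OF that(1)] that(2) by (force simp: dist_commute)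
      ultimately show "\<forall>\<^sub>F p in sequentially \<times>\<^sub>F nhds w. norm (g (fst p) (snd p) - V (snd p)) \<le> 1 / real (Suc (fst p))"
        unfolding eventually_prod_filter
        by (intro exI[of _ "\<lambda>n. n \<ge> N"] exI[of _ "\<lambda>z. dist z w < \<delta>"]) (simp del: of_nat_Suc)
    qed
    from tendsto_add[OF this filterlim_compose[OF Vc filterlim_snd]]
    show ?thesis by (simp add: case_prod_unfold nhds_inf_principal_open[OF U w])
  qed
  have conv: "Ck_conv_on 0 U g" unfolding Ck_conv_on_def using lim by (intro Ck_conv_0I) blast
  have "(\<lambda>n. g n w) \<longlonglongrightarrow> V w" if w: "w \<in> U" for w
  proof -
    have "filterlim (\<lambda>n. (n, w)) (sequentially \<times>\<^sub>F inf (nhds w) (principal U)) sequentially"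
      by (intro filterlim_Pair filterlim_ident) (auto simp: filterlim_inf filterlim_principal w)
    from filterlim_compose[OF lim[OF w] this] show ?thesis by simp
  qed
  then show ?case using conv by blast
next
  case (Suc k)
  have near: "Ck_near k (C n) (1 / real (Suc n)) V (g n)" for n
    using Suc(4)[of n] unfolding Ck_near_def by auto
  have IH: "Ck_conv_on k U g \<and> (\<forall>w\<in>U. (\<lambda>n. g n w) \<longlonglongrightarrow> V w)"
    by (rule Suc(1)[OF Ck_on_open_SucD[OF U Suc(2)] Ck_on_UNIV_le[OF Suc(3)] near]) simp
  have d: "g n differentiable (at z)" for n z using Suc(3)[of n] unfolding Ck_on_UNIV_Suc by blast
  have "Ck_conv_on (Suc k) U g"
  proof (rule Ck_conv_on_SucI[OF _ d])
    show "Ck_conv_on 0 U g" using IH unfolding Ck_conv_on_def by (blast intro: Ck_conv_le[OF le0])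
    fix b :: 'a assume b: "b \<in> Basis"
    have V': "Ck_on k U (pd UNIV b V)" using Suc(2) b by (simp add: pd_def)
    have g': "Ck_on k UNIV (pd UNIV b (g n))" for n using Suc(3)[of n] b unfolding Ck_on_UNIV_Suc by blast
    from Suc(1)[OF V' g' Ck_near_pd[OF Suc(4) b]]
    show "Ck_conv_on k U (\<lambda>n. pd UNIV b (g n))" by blast
  qed
  then show ?case using IH by blast
qed

text \<open>The space part of a weight becomes a row of the matrix, its time part an entry of the
  time coefficient \<open>c\<close>. The factor \<open>s\<close>, later plus or minus 1/n, goes into
  \<open>a\<close>, on which the module depends linearly.\<close>

definition ridge_module :: "bool \<Rightarrow> real \<Rightarrow> (real \<times> ((real^'d) \<times> real) \<times> real) list \<Rightarrow> ('d::finite) gmod" where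
  "ridge_module up s ps = GMod up (length ps) (\<lambda>i j. fst (fst (snd (ps ! i))) $ j) (\<lambda>i. s * fst (ps ! i))
     (\<lambda>i. snd (snd (ps ! i))) (\<lambda>i. snd (fst (snd (ps ! i))))"

text \<open>The directions \<open>(b, 0)\<close> span the space variable only; time enters as a
  parameter.\<close>

definition grad_net :: "(real \<Rightarrow> real) \<Rightarrow> (real \<times> ((real^'d) \<times> real) \<times> real) list \<Rightarrow> (real^'d) \<times> real \<Rightarrow> real^('d::finite)" where
  "grad_net S ps z = (\<Sum>b\<in>Basis. pd UNIV (b, 0) (ridge_net S ps) z *\<^sub>R b)"

lemma pd_ridge_net:
  assumes "\<And>x. (S has_real_derivative \<sigma> x) (at x)"
  shows "pd UNIV v (ridge_net S ps) z = (\<Sum>(a, w, b)\<leftarrow>ps. a * ((w \<bullet> v) * \<sigma> (w \<bullet> z + b)))"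
proof -
  have "(ridge_net S ps has_derivative (\<lambda>v. \<Sum>(a, w, b)\<leftarrow>ps. a * ((w \<bullet> v) * \<sigma> (w \<bullet> z + b)))) (at z)"
  proof (induction ps)
    case Nil then show ?case by (simp add: ridge_net_def[abs_def])
  next
    case (Cons p ps)
    obtain a w b where p: "p = (a, w, b)" by (cases p)
    have "((\<lambda>z. w \<bullet> z + b) has_derivative (\<lambda>v. w \<bullet> v)) (at z)" by (auto intro!: derivative_eq_intros)
    from has_derivative_compose[OF this assms[unfolded has_field_derivative_def]]
    have "((\<lambda>z. S (w \<bullet> z + b)) has_derivative (\<lambda>v. (w \<bullet> v) * \<sigma> (w \<bullet> z + b))) (at z)" by (simp add: mult.commute)
    then have "((\<lambda>z. a * S (w \<bullet> z + b) + ridge_net S ps z) has_derivative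
       (\<lambda>v. a * ((w \<bullet> v) * \<sigma> (w \<bullet> z + b)) + (\<Sum>(a, w, b)\<leftarrow>ps. a * ((w \<bullet> v) * \<sigma> (w \<bullet> z + b))))) (at z)"
      by (intro has_derivative_add has_derivative_mult_right Cons)
    then show ?case by (simp add: p ridge_net_def[abs_def])
  qed
  then show ?thesis by (rule pd_eq)
qed

lemma grad_net_eq:
  assumes "\<And>x. (S has_real_derivative \<sigma> x) (at x)"
  shows "grad_net S ps z = (\<Sum>(a, w, b)\<leftarrow>ps. (a * \<sigma> (w \<bullet> z + b)) *\<^sub>R fst w)"
proof -
  have "(\<Sum>b\<in>Basis. (\<Sum>(a, w, b')\<leftarrow>ps. a * ((w \<bullet> (b, 0)) * \<sigma> (w \<bullet> z + b'))) *\<^sub>R b)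
     = (\<Sum>(a, w, b)\<leftarrow>ps. (a * \<sigma> (w \<bullet> z + b)) *\<^sub>R fst w)"
  proof (induction ps)
    case (Cons p ps)
    obtain a w b where p: "p = (a, w, b)" by (cases p)
    have "(\<Sum>e\<in>Basis. (a * ((w \<bullet> (e, 0)) * \<sigma> (w \<bullet> z + b))) *\<^sub>R e) = (a * \<sigma> (w \<bullet> z + b)) *\<^sub>R (\<Sum>e\<in>Basis. (fst w \<bullet> e) *\<^sub>R e)"
      by (simp add: scaleR_sum_right inner_prod_def mult_ac)
    then show ?case using Cons by (simp add: p scaleR_add_left sum.distrib euclidean_representation)
  qed simp
  then show ?thesis unfolding grad_net_def pd_ridge_net[OF assms] .
qed

text \<open>The transposed matrix in \<open>sigma_hat\<close> is the inner derivative that the chain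
  rule produces from the ridge functions.\<close>

lemma sigma_hat_ridge_module:
  assumes "\<And>x. (S has_real_derivative \<sigma> x) (at x)"
  shows "sigma_hat \<sigma> (ridge_module up s ps) y t = s *\<^sub>R grad_net S ps (y, t)"
proof -
  have "(sigma_hat \<sigma> (ridge_module up s ps) y t) $ j = (s *\<^sub>R grad_net S ps (y, t)) $ j" for j
  proof -
    have "(sigma_hat \<sigma> (ridge_module up s ps) y t) $ j =
      (\<Sum>i<length ps. (\<lambda>(a, w, b). fst w $ j * (s * a) * \<sigma> (w \<bullet> (y, t) + b)) (ps ! i))"
      by (simp add: ridge_module_def case_prod_unfold inner_prod_def inner_vec_def)
    also have "\<dots> = (\<Sum>(a, w, b)\<leftarrow>ps. fst w $ j * (s * a) * \<sigma> (w \<bullet> (y, t) + b))"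
      by (simp add: sum_list_sum_nth atLeast0LessThan)
    also have "\<dots> = s * (\<Sum>(a, w, b)\<leftarrow>ps. (a * \<sigma> (w \<bullet> (y, t) + b)) * fst w $ j)"
      by (induction ps) (auto simp: algebra_simps)
    also have "(\<Sum>(a, w, b)\<leftarrow>ps. (a * \<sigma> (w \<bullet> (y, t) + b)) * fst w $ j) = (\<Sum>(a, w, b)\<leftarrow>ps. (a * \<sigma> (w \<bullet> (y, t) + b)) *\<^sub>R fst w) $ j"
      by (induction ps) auto
    finally show ?thesis by (simp add: grad_net_eq[OF assms])
  qed
  then show ?thesis by (simp add: vec_eq_iff)
qed

text \<open>The potential is approximated in C^(r+1) on an exhaustion by compact sets, so its
  spatial gradient is approximated in C^r. The flag and the scaling stay free, since the position of
  the module in the splitting and the step size are fixed only when networks are assembled.\<close>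

theorem gradient_module_approximation:
  fixes V :: "real^'d \<Rightarrow> real \<Rightarrow> real" and \<sigma> :: "real \<Rightarrow> real"
  assumes \<sigma>: "Ck_on r UNIV \<sigma>" "r_finite r \<sigma>" and U: "open U"
    and V: "Ck_on (Suc r) (U \<times> UNIV) (\<lambda>(y, t). V y t)"
  obtains M :: "nat \<Rightarrow> bool \<Rightarrow> real \<Rightarrow> 'd::finite gmod" and v where
    "\<And>n up s. gmod_is_upper (M n up s) = up"
    "\<And>n up s y t. sigma_hat \<sigma> (M n up s) y t = s *\<^sub>R v n (y, t)"
    "Ck_conv_on r (U \<times> UNIV) v"
    "\<And>y t. y \<in> U \<Longrightarrow> (\<lambda>n. v n (y, t)) \<longlonglongrightarrow> grad (\<lambda>y. V y t) y"
proof -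
  let ?U = "U \<times> (UNIV :: real set)" and ?V = "\<lambda>(y, t). V y t"
  have oU: "open ?U" using U by (simp add: open_Times)
  obtain S where S: "\<And>x. (S has_real_derivative \<sigma> x) (at x)"
    using ex_antiderivative[OF Ck_on_UNIV_continuous[OF \<sigma>(1)]] by blast
  have rS: "rderiv S = \<sigma>" using pd_real_eq[OF S] by blast
  have SCk: "Ck_on (Suc r) UNIV S"
    unfolding Ck_on_real_Suc rS using \<sigma>(1) S real_differentiable_def by blast
  \<comment> \<open>The order r + 1 at which approximation takes place matches order r of
    \<open>\<sigma>\<close>, where r-finiteness gives information.\<close>
  have \<tau>: "(rderiv ^^ Suc r) S = (deriv ^^ r) \<sigma>"
    using funpow_deriv_eq_rderiv[OF \<sigma>(1)] rS by (simp add: funpow_swap1)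
  have "continuous_on UNIV ((rderiv ^^ r) \<sigma>)"
    using Ck_on_real_funpow[of 0 r \<sigma>] \<sigma>(1) by simp
  then have van: "vanishing_mean ((rderiv ^^ Suc r) S)"
    unfolding \<tau> using funpow_deriv_eq_rderiv[OF \<sigma>(1)] \<sigma>(2)
    by (intro vanishing_mean_of_integrable) (auto simp: r_finite_def)
  have nz: "(rderiv ^^ Suc r) S \<noteq> (\<lambda>x. 0)"
    unfolding \<tau> using \<sigma>(2) by (auto simp: r_finite_def)
  interpret ridge_subspace "Suc r" "range (ridge_net S :: _ \<Rightarrow> (real^'d) \<times> real \<Rightarrow> real)" S
    by (rule ridge_subspace_ridge_net[OF SCk van nz])
  have "\<exists>C. (\<forall>n. compact (C n) \<and> C n \<subseteq> ?U) \<and> (\<forall>K. compact K \<and> K \<subseteq> ?U \<longrightarrow> (\<exists>N. \<forall>n\<ge>N::nat. K \<subseteq> C n))"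
  proof (rule open_Union_compact_subsets[OF oU])
    fix C assume "\<And>n. compact (C n)" "\<And>n. C n \<subseteq> ?U" "\<And>K. compact K \<Longrightarrow> K \<subseteq> ?U \<Longrightarrow> \<exists>N. \<forall>n\<ge>N::nat. K \<subseteq> C n"
    then show ?thesis by (intro exI[of _ C]) auto
  qed
  then obtain C where C: "\<And>n. compact (C n)" "\<And>n. C n \<subseteq> ?U" "\<And>K. compact K \<Longrightarrow> K \<subseteq> ?U \<Longrightarrow> \<exists>N. \<forall>n\<ge>N::nat. K \<subseteq> C n"
    by metis
  have "\<exists>ps. Ck_near (Suc r) (C n) (1 / real (Suc n)) ?V (ridge_net S ps)" for n
    using universal_approximation[OF oU V C(1,2), of "1 / real (Suc n)" n] by auto
  then obtain ps where ps: "\<And>n. Ck_near (Suc r) (C n) (1 / real (Suc n)) ?V (ridge_net S (ps n))" by metis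
  have conv: "Ck_conv_on (Suc r) ?U (\<lambda>n. ridge_net S (ps n))" and lim: "\<And>w. w \<in> ?U \<Longrightarrow> (\<lambda>n. ridge_net S (ps n) w) \<longlonglongrightarrow> ?V w"
    using Ck_near_exhaustion_conv[OF oU C(3) V Ck_on_ridge_net[OF SCk] ps] by auto
  have Bas: "(b, 0) \<in> (Basis :: ((real^'d) \<times> real) set)" if "b \<in> Basis" for b using that by (simp add: Basis_prod_def)
  show ?thesis
  proof (rule that[of "\<lambda>n up s. ridge_module up s (ps n)" "\<lambda>n. grad_net S (ps n)"])
    show "gmod_is_upper (ridge_module up s (ps n)) = up" for n up s by (simp add: ridge_module_def)
    show "sigma_hat \<sigma> (ridge_module up s (ps n)) y t = s *\<^sub>R grad_net S (ps n) (y, t)" for n up s y t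
      by (rule sigma_hat_ridge_module[OF S])
    show "Ck_conv_on r ?U (\<lambda>n. grad_net S (ps n))"
      unfolding grad_net_def[abs_def] Ck_conv_on_def
      by (intro Ck_conv_sum Ck_conv_scaleR Ck_conv_const Ck_conv_pd[OF conv[unfolded Ck_conv_on_def]] Bas)
    fix y t assume y: "y \<in> U"
    have yt: "(y, t) \<in> ?U" using y by simp
    have "(\<lambda>n. pd UNIV (b, 0) (ridge_net S (ps n)) (y, t)) \<longlonglongrightarrow> pd UNIV (b, 0) ?V (y, t)" if b: "b \<in> Basis" for b
    proof -
      have "(\<lambda>n. pd UNIV (b, 0) (ridge_net S (ps n)) (y, t)) \<longlonglongrightarrow> pd ?U (b, 0) ?V (y, t)"
        using Ck_conv_on_pd_limit(2)[OF conv open_in_quadrant_open[OF oU] lim yt Bas[OF b]] by simp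
      then show ?thesis unfolding pd_def at_within_open[OF yt oU] .
    qed
    then have "(\<lambda>n. grad_net S (ps n) (y, t)) \<longlonglongrightarrow> (\<Sum>b\<in>Basis. pd UNIV (b, 0) ?V (y, t) *\<^sub>R b)"
      unfolding grad_net_def by (intro tendsto_sum tendsto_scaleR tendsto_const)
    moreover have "pd UNIV (b, 0) ?V (y, t) = frechet_derivative (\<lambda>y. V y t) (at y) b" for b
    proof -
      have "?V differentiable (at (y, t) within ?U)" using V yt by (simp add: differentiable_on_def)
      then have dV: "?V differentiable (at (y, t))" unfolding at_within_open[OF yt oU] .
      have "((\<lambda>y. (y, t)) has_derivative (\<lambda>v. (v, 0))) (at y)"
        by (intro has_derivative_Pair has_derivative_ident has_derivative_const)
      from has_derivative_compose[OF this has_derivative_pd[OF dV]]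
      have "((\<lambda>y. V y t) has_derivative (\<lambda>v. pd UNIV (v, 0) ?V (y, t))) (at y)" by simp
      from frechet_derivative_at[OF this] show ?thesis by metis
    qed
    ultimately show "(\<lambda>n. grad_net S (ps n) (y, t)) \<longlonglongrightarrow> grad (\<lambda>y. V y t) y" by (simp add: grad_def)
  qed
qed

section \<open>Convergence of the networks\<close>

lemma pdl_cong_within:
  assumes "\<And>z. z \<in> D \<Longrightarrow> f z = g z" "z \<in> D"
  shows "pdl D L f z = pdl D L g z"
  using assms(2)
proof (induction L arbitrary: z)
  case (Cons b L)
  have "(pdl D L f has_derivative h) (at z within D) \<longleftrightarrow> (pdl D L g has_derivative h) (at z within D)" for h
    using has_derivative_transform[of z D "pdl D L f" "pdl D L g" h]
      has_derivative_transform[of z D "pdl D L g" "pdl D L f" h] Cons by auto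
  then show ?case by (simp add: pd_def frechet_derivative_def)
qed (use assms in simp)

text \<open>Derivatives of the limit \<open>f\<close> are known within \<open>D\<close> and become
  available one order at a time. Within \<open>D\<close> the derivative of \<open>Y m\<close> is its
  full derivative, so the difference splits into the two kinds of derivative whose closeness has
  been shown.\<close>

lemma Ck_conv_on_pdl_diff:
  fixes Y :: "nat \<Rightarrow> 'a::euclidean_space \<Rightarrow> 'b::real_normed_vector"
  assumes "Ck_conv_on j D Y" "open_in_quadrant D" "\<And>w. w \<in> D \<Longrightarrow> (\<lambda>n. Y n w) \<longlonglongrightarrow> f w"
    "set L \<subseteq> Basis" "length L \<le> j" "z \<in> D"
  shows "pdl D L (\<lambda>z. f z - Y m z) z = pdl D L f z - pdl UNIV L (Y m) z"
  using assms(1,3-)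
proof (induction L arbitrary: j Y f z rule: rev_induct)
  case (snoc b L)
  obtain k where j: "j = Suc k" using snoc(5) by (cases j) auto
  have b: "b \<in> Basis" using snoc(4) by simp
  note Y = snoc(2)[unfolded j]
  have lim: "f differentiable (at w within D)" "(\<lambda>n. pd UNIV b (Y n) w) \<longlonglongrightarrow> pd D b f w" if w: "w \<in> D" for w
    using Ck_conv_on_pd_limit[OF Y assms(2) _ w, of f] snoc(3) b by auto
  have eq: "pd D b (\<lambda>z. f z - Y m z) w = pd D b f w - pd UNIV b (Y m) w" if w: "w \<in> D" for w
  proof -
    have f: "(f has_derivative frechet_derivative f (at w within D)) (at w within D)"
      using lim(1)[OF w] frechet_derivative_works by blast
    have Ym: "(Y m has_derivative (\<lambda>v. pd UNIV v (Y m) w)) (at w within D)"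
      by (rule has_derivative_at_withinI[OF has_derivative_pd[OF Ck_conv_differentiable[OF Y[unfolded Ck_conv_on_def]]]])
    note d = has_derivative_diff[OF f Ym]
    have "frechet_derivative (\<lambda>z. f z - Y m z) (at w within D) = (\<lambda>v. frechet_derivative f (at w within D) v - pd UNIV v (Y m) w)"
      by (rule open_in_quadrant_unique[OF assms(2) w frechet_derivative_works[THEN iffD1, OF differentiableI[OF d]] d])
    then show ?thesis by (simp add: pd_def)
  qed
  have "pdl D (L @ [b]) (\<lambda>z. f z - Y m z) z = pdl D L (\<lambda>z. pd D b f z - pd UNIV b (Y m) z) z"
    unfolding pdl_append by (rule pdl_cong_within[OF eq snoc(6)])
  also have "\<dots> = pdl D L (pd D b f) z - pdl UNIV L (pd UNIV b (Y m)) z"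
    by (rule snoc(1)[OF Ck_conv_pd[OF Y[unfolded Ck_conv_on_def] b, folded Ck_conv_on_def]])
      (use lim(2) snoc(4-6) j in auto)
  finally show ?case by (simp add: pdl_append)
qed simp

text \<open>The norm is a sum over finitely many direction lists. Passing to suprema leaves only
  weak bounds by \<open>\<delta>\<close>, and the 1 added to the number of lists restores a strict
  inequality.\<close>

lemma cr_norm_less:
  assumes e: "\<epsilon> > 0"
  obtains \<delta> where "\<delta> > 0" "\<And>F. (\<And>L z. set L \<subseteq> Basis \<Longrightarrow> length L \<le> r \<Longrightarrow> z \<in> D \<Longrightarrow> norm (pdl \<Omega> L F z) < \<delta>) \<Longrightarrow>
     cr_norm r \<Omega> D (F :: 'a::euclidean_space \<Rightarrow> 'b::euclidean_space) < \<epsilon>"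
proof -
  define \<L> where "\<L> = {L :: 'a list. set L \<subseteq> Basis \<and> length L \<le> r}"
  have fin: "finite \<L>" unfolding \<L>_def by (rule finite_lists_length_le[OF finite_Basis])
  define \<delta> where "\<delta> = \<epsilon> / (card \<L> + 1)"
  have \<delta>: "\<delta> > 0" using e by (simp add: \<delta>_def add_nonneg_pos)
  show ?thesis
  proof (rule that[OF \<delta>])
    fix F :: "'a \<Rightarrow> 'b"
    assume F: "\<And>L z. set L \<subseteq> Basis \<Longrightarrow> length L \<le> r \<Longrightarrow> z \<in> D \<Longrightarrow> norm (pdl \<Omega> L F z) < \<delta>"
    have "sup_maxcomp D (pdl \<Omega> L F) \<le> \<delta>" if L: "L \<in> \<L>" for L
    proof (cases "D = {}")
      case True then show ?thesis using \<delta> by (simp add: sup_maxcomp_def)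
    next
      case False
      have "Max ((\<lambda>b. \<bar>pdl \<Omega> L F z \<bullet> b\<bar>) ` Basis) \<le> \<delta>" if z: "z \<in> D" for z
      proof -
        have "\<bar>pdl \<Omega> L F z \<bullet> b\<bar> \<le> \<delta>" if "b \<in> Basis" for b
          using Basis_le_norm[OF that, of "pdl \<Omega> L F z"] F[of L z] L z by (simp add: \<L>_def)
        then show ?thesis by (subst Max_le_iff) auto
      qed
      then show ?thesis using False by (auto simp: sup_maxcomp_def intro!: cSUP_least)
    qed
    then have "cr_norm r \<Omega> D F \<le> card \<L> * \<delta>"
      unfolding cr_norm_def \<L>_def[symmetric] using sum_bounded_above by (metis of_nat_id)
    also have "\<dots> < \<epsilon>" using e by (simp add: \<delta>_def field_simps)
    finally show "cr_norm r \<Omega> D F < \<epsilon>" .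
  qed
qed

section \<open>The Hamiltonian field and the final iterate\<close>

lemma Ck_on_slice_differentiable:
  fixes V :: "'a::euclidean_space \<Rightarrow> real \<Rightarrow> real"
  assumes V: "Ck_on (Suc r) (U \<times> UNIV) (\<lambda>(y, t). V y t)" and U: "open U" "y \<in> U"
  shows "(\<lambda>y. V y t) differentiable (at y)"
proof -
  have oU: "open (U \<times> (UNIV :: real set))" and yt: "(y, t) \<in> U \<times> UNIV" using U by (auto simp: open_Times)
  have "(\<lambda>(y, t). V y t) differentiable (at (y, t) within U \<times> UNIV)" using V yt by (simp add: differentiable_on_def)
  then have dV: "(\<lambda>(y, t). V y t) differentiable (at (y, t))" unfolding at_within_open[OF yt oU] .
  have "((\<lambda>y. (y, t)) has_derivative (\<lambda>v. (v, 0))) (at y)"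
    by (intro has_derivative_Pair has_derivative_ident has_derivative_const)
  from has_derivative_compose[OF this has_derivative_pd[OF dV]]
  show ?thesis by (auto intro: differentiableI)
qed

lemma grad_Ham:
  fixes K V :: "real^'d::finite \<Rightarrow> real \<Rightarrow> real"
  assumes "(\<lambda>p. K p t) differentiable (at p)" "(\<lambda>q. V q t) differentiable (at q)"
  shows "grad (\<lambda>y. Ham K V y t) (p, q) = (grad (\<lambda>p. K p t) p, grad (\<lambda>q. V q t) q)"
proof -
  have fs: "(fst has_derivative fst) (at (p, q))" "(snd has_derivative snd) (at (p, q))"
    by (intro bounded_linear_imp_has_derivative bounded_linear_fst bounded_linear_snd)+
  have dK: "((\<lambda>p. K p t) has_derivative (\<lambda>v. pd UNIV v (\<lambda>p. K p t) p)) (at (fst (p, q)))"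
    and dV: "((\<lambda>q. V q t) has_derivative (\<lambda>v. pd UNIV v (\<lambda>q. V q t) q)) (at (snd (p, q)))"
    using has_derivative_pd[OF assms(1)] has_derivative_pd[OF assms(2)] by auto
  note K = has_derivative_compose[OF fs(1) dK] and V = has_derivative_compose[OF fs(2) dV]
  have "frechet_derivative (\<lambda>y. Ham K V y t) (at (p, q)) = (\<lambda>v. pd UNIV (fst v) (\<lambda>p. K p t) p + pd UNIV (snd v) (\<lambda>q. V q t) q)"
    using frechet_derivative_at[OF has_derivative_add[OF K V]] by (simp add: Ham_def)
  moreover have "pd UNIV 0 (\<lambda>p. K p t) p = 0" "pd UNIV 0 (\<lambda>q. V q t) q = 0"
    using linear_0[OF has_derivative_linear[OF has_derivative_pd[OF assms(1)]]]
      linear_0[OF has_derivative_linear[OF has_derivative_pd[OF assms(2)]]] by auto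
  ultimately show ?thesis
    unfolding grad_def sum_Basis_prod_eq by (simp add: pd_def sum_prod fst_sum snd_sum prod_eq_iff)
qed

lemma fold_concat_replicate: "fold f (concat (replicate n xs)) = (fold f xs ^^ n)"
  by (induction n) (auto simp: funpow_swap1 fun_eq_iff)

text \<open>After n of n steps the time k/n is 1, so the diagonal of the array carries the time-one
  map.\<close>

lemma filterlim_grid_diagonal:
  "filterlim (\<lambda>(n, z). ((n, n), z)) (grid_filter D 1 w) (sequentially \<times>\<^sub>F inf (nhds w) (principal D))"
  unfolding filterlim_iff
proof (intro allI impI)
  fix P assume "eventually P (grid_filter D 1 w)"
  then obtain e where e: "e > 0" "\<And>n k z'. 0 < n \<Longrightarrow> k \<le> n \<Longrightarrow> z' \<in> D \<Longrightarrow>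
     1 / real n < e \<Longrightarrow> \<bar>real k / real n - 1\<bar> < e \<Longrightarrow> dist z' w < e \<Longrightarrow> P ((n, k), z')"
    unfolding eventually_grid by auto
  obtain N where N: "\<And>n. n \<ge> N \<Longrightarrow> 0 < n \<and> 1 / real n < e"
    using eventually_conj[OF eventually_gt_at_top[of 0] order_tendstoD(2)[OF lim_1_over_n e(1)]]
    unfolding eventually_sequentially by blast
  show "\<forall>\<^sub>F x in sequentially \<times>\<^sub>F inf (nhds w) (principal D). P (case x of (n, z) \<Rightarrow> ((n, n), z))"
    unfolding eventually_seq_nhds_within
  proof (intro exI[of _ e] exI[of _ N] conjI e(1) allI ballI impI)
    fix n z assume "n \<ge> N" "z \<in> D" "dist z w < e"
    then have "P ((n, n), z)" using N[of n] e(1) by (intro e(2)) auto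
    then show "P (case (n, z) of (n, z) \<Rightarrow> ((n, n), z))" by simp
  qed
qed

lemma Ck_conv_on_diagonal:
  assumes "Ck_conv r (grid_filters D) E"
  shows "Ck_conv_on r D (\<lambda>n. E (n, n))"
proof -
  have "Ck_conv_on r D (\<lambda>n z. E (n, n) ((\<lambda>n z. z) n z))"
    unfolding Ck_conv_on_def
  proof (rule Ck_conv_compose[OF assms Ck_conv_on_ident[unfolded Ck_conv_on_def], where \<pi> = "\<lambda>n. (n, n)"])
    fix F assume "F \<in> (\<lambda>w. sequentially \<times>\<^sub>F inf (nhds w) (principal D)) ` D"
    then obtain w where w: "w \<in> D" and F: "F = sequentially \<times>\<^sub>F inf (nhds w) (principal D)" by auto
    have "grid_filter D 1 w \<in> grid_filters D" unfolding grid_filters_def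
      by (intro CollectI exI[of _ 1] exI[of _ w]) (use w in auto)
    then show "\<exists>G\<in>grid_filters D. filterlim (\<lambda>(i, z). ((i, i), z)) G F"
      using filterlim_grid_diagonal[of D w] F by blast
  qed
  then show ?thesis by simp
qed

text \<open>A solution on a bounded time interval can be continued by the given global flow, so uniqueness
  of global solutions yields uniqueness of local ones.\<close>
lemma ham_sol_local_unique:
  fixes K V :: "real^'d::finite \<Rightarrow> real \<Rightarrow> real"
  assumes Phi_sol: "\<And>t0 x0. t0 \<ge> 0 \<Longrightarrow> x0 \<in> U \<Longrightarrow> ham_sol K V U t0 x0 (\<lambda>h. \<Phi> h t0 x0)"
    and sol_unique: "\<And>t0 x0 \<gamma> h. t0 \<ge> 0 \<Longrightarrow> x0 \<in> U \<Longrightarrow> ham_sol K V U t0 x0 \<gamma> \<Longrightarrow> h \<ge> 0 \<Longrightarrow> \<gamma> h = \<Phi> h t0 x0"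
    and t0: "t0 \<ge> 0" and a: "a \<ge> 0"
    and \<gamma>U: "\<And>u. 0 \<le> u \<Longrightarrow> u \<le> a \<Longrightarrow> \<gamma> u \<in> U"
    and \<gamma>': "\<And>u. 0 \<le> u \<Longrightarrow> u \<le> a \<Longrightarrow>
       (\<gamma> has_vector_derivative symplJ_inv (grad (\<lambda>y. Ham K V y (t0 + u)) (\<gamma> u))) (at u within {0..a})"
  shows "\<gamma> a = \<Phi> a t0 (\<gamma> 0)"
proof -
  define F where "F x \<tau> = symplJ_inv (grad (\<lambda>y. Ham K V y \<tau>) x)" for x \<tau>
  define \<psi> where "\<psi> u = \<Phi> (u - a) (t0 + a) (\<gamma> a)" for u
  have sol: "ham_sol K V U (t0 + a) (\<gamma> a) (\<lambda>h. \<Phi> h (t0 + a) (\<gamma> a))"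
    using t0 a \<gamma>U by (intro Phi_sol) auto
  have \<psi>a: "\<psi> a = \<gamma> a" using sol by (simp add: ham_sol_def \<psi>_def)
  have \<psi>U: "\<psi> u \<in> U" if "u \<ge> a" for u using sol that by (simp add: ham_sol_def \<psi>_def)
  have \<psi>': "(\<psi> has_vector_derivative F (\<psi> u) (t0 + u)) (at u within {a..})" if u: "u \<ge> a" for u
  proof -
    have "((\<lambda>h. \<Phi> h (t0 + a) (\<gamma> a)) has_vector_derivative F (\<psi> u) (t0 + u)) (at (u - a) within {0..})"
    proof -
      have e: "t0 + a + (u - a) = t0 + u" and "0 \<le> u - a" using u by auto
      from sol[unfolded ham_sol_def, THEN conjunct2, rule_format, OF this(2)]
      show ?thesis unfolding e F_def \<psi>_def by simp
    qed
    then have "((\<lambda>h. \<Phi> h (t0 + a) (\<gamma> a)) has_vector_derivative F (\<psi> u) (t0 + u)) (at (u - a) within (\<lambda>u. u - a) ` {a..})"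
      by (rule has_vector_derivative_within_subset) auto
    moreover have "((\<lambda>u. u - a) has_vector_derivative 1) (at u within {a..})"
      unfolding has_real_derivative_iff_has_vector_derivative[symmetric] by (auto intro!: derivative_eq_intros)
    ultimately have "((\<lambda>h. \<Phi> h (t0 + a) (\<gamma> a)) \<circ> (\<lambda>u. u - a) has_vector_derivative 1 *\<^sub>R F (\<psi> u) (t0 + u)) (at u within {a..})"
      by (intro vector_diff_chain_within)
    then show ?thesis by (simp add: o_def \<psi>_def[abs_def])
  qed
  have cl: "closure {0..a} \<inter> closure {a..} = {a}" using a by auto
  define \<eta> where "\<eta> u = (if u \<in> {0..a} then \<gamma> u else \<psi> u)" for u
  have "ham_sol K V U t0 (\<gamma> 0) \<eta>"
    unfolding ham_sol_def F_def[symmetric]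
  proof (intro conjI allI impI)
    show "\<eta> 0 = \<gamma> 0" using a by (simp add: \<eta>_def)
    fix u :: real assume u: "0 \<le> u"
    show "\<eta> u \<in> U" using \<gamma>U \<psi>U u by (auto simp: \<eta>_def)
    have "(\<eta> has_vector_derivative (if u \<in> {0..a} then F (\<gamma> u) (t0 + u) else F (\<psi> u) (t0 + u))) (at u within {0..})"
      unfolding \<eta>_def[abs_def]
    proof (rule has_vector_derivative_If_within_closures[where f' = "\<lambda>u. F (\<gamma> u) (t0 + u)" and g' = "\<lambda>u. F (\<psi> u) (t0 + u)"
          and S = "{0..a}" and T = "{a..}"])
      show "u \<in> {0..a} \<union> {a..}" "{0..} = {0..a} \<union> {a..}" using u a by auto
      have e: "{0..a} \<union> (closure {0..a} \<inter> closure {a..}) = {0..a}" "{a..} \<union> (closure {0..a} \<inter> closure {a..}) = {a..}"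
        unfolding cl using a by auto
      show "(\<gamma> has_vector_derivative F (\<gamma> u) (t0 + u)) (at u within {0..a} \<union> (closure {0..a} \<inter> closure {a..}))"
        if "u \<in> {0..a} \<union> (closure {0..a} \<inter> closure {a..})"
        using that \<gamma>'[of u] unfolding e F_def by simp
      show "(\<psi> has_vector_derivative F (\<psi> u) (t0 + u)) (at u within {a..} \<union> (closure {0..a} \<inter> closure {a..}))"
        if "u \<in> {a..} \<union> (closure {0..a} \<inter> closure {a..})"
        using that \<psi>'[of u] unfolding e by simp
      have "u = a" if "u \<in> closure {0..a}" "u \<in> closure {a..}" using that cl by blast
      then show "\<gamma> u = \<psi> u" "F (\<gamma> u) (t0 + u) = F (\<psi> u) (t0 + u)" if "u \<in> closure {0..a}" "u \<in> closure {a..}"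
        using that \<psi>a by auto
    qed
    then show "(\<eta> has_vector_derivative F (\<eta> u) (t0 + u)) (at u within {0..})"
      by (simp add: \<eta>_def if_distrib[of "\<lambda>x. F x (t0 + u)"] cong: if_cong)
  qed
  from sol_unique[OF t0 _ this a] \<gamma>U[of 0] a show ?thesis by (simp add: \<eta>_def)
qed

text \<open>One upper and one lower module make up one explicit step of size \<open>1/n\<close> in the extended
  phase space of all \<open>(h, t, (p, q))\<close>.\<close>
definition split_field :: "(nat \<Rightarrow> (real^'d) \<times> real \<Rightarrow> real^'d) \<Rightarrow> (nat \<Rightarrow> (real^'d) \<times> real \<Rightarrow> real^'d) \<Rightarrow> nat
     \<Rightarrow> real \<times> real \<times> ('d::finite) phase \<Rightarrow> real \<times> real \<times> 'd phase" where
  "split_field v w n = (\<lambda>(h, t, (p, q)). (0, h, (- (h *\<^sub>R v n (q, t)),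
     h *\<^sub>R w n (p - (h * (1 / real n)) *\<^sub>R v n (q, t), t + h * (1 / 2 * (1 / real n))))))"

text \<open>Each of the 2n modules advances t by h/(2n), so the lower module sees the half-advanced
  time together with the updated p. The factors -1/n and 1/n shorten the module step h to h/n and
  carry the signs of the Hamiltonian equations.\<close>

lemma split_step_eq_modules:
  fixes v w :: "nat \<Rightarrow> (real^'d::finite) \<times> real \<Rightarrow> real^'d"
  assumes n: "n > 0" and up: "gmod_is_upper M1" "\<not> gmod_is_upper M2"
    and M1: "\<And>y t. sigma_hat \<sigma> M1 y t = (- 1 / real n) *\<^sub>R v n (y, t)"
    and M2: "\<And>y t. sigma_hat \<sigma> M2 y t = (1 / real n) *\<^sub>R w n (y, t)"
  shows "(h, z) + (1 / real n) *\<^sub>R split_field v w n (h, z) =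
    (h, fold (\<lambda>md z. apply_gmod \<sigma> (2 * n) md h z) [M1, M2] z)"
proof -
  obtain t p q where z: "z = (t, (p, q))" by (metis surj_pair)
  have p': "p + h *\<^sub>R ((- 1 / real n) *\<^sub>R v n (q, t)) = p - (h * (1 / real n)) *\<^sub>R v n (q, t)" by simp
  have t': "t + h / real (2 * n) = t + h * (1 / 2 * (1 / real n))" by simp
  have t'': "t + h / real (2 * n) + h / real (2 * n) = t + (1 / real n) * h" using n by (simp add: field_simps)
  have "fold (\<lambda>md z. apply_gmod \<sigma> (2 * n) md h z) [M1, M2] z =
    (t + h / real (2 * n) + h / real (2 * n), (p - (h * (1 / real n)) *\<^sub>R v n (q, t),
      q + h *\<^sub>R ((1 / real n) *\<^sub>R w n (p - (h * (1 / real n)) *\<^sub>R v n (q, t), t + h * (1 / 2 * (1 / real n))))))"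
    unfolding z fold_simps apply_gmod_def using up by (simp only: M1 M2 p' t' prod.case if_True if_False id_apply simp_thms)
  then show ?thesis unfolding t'' by (simp add: split_field_def z mult.commute)
qed

lemma natg_eq_split_iterate:
  fixes v w :: "nat \<Rightarrow> (real^'d::finite) \<times> real \<Rightarrow> real^'d"
  assumes n: "n > 0" and up: "gmod_is_upper M1" "\<not> gmod_is_upper M2"
    and M1: "\<And>y t. sigma_hat \<sigma> M1 y t = (- 1 / real n) *\<^sub>R v n (y, t)"
    and M2: "\<And>y t. sigma_hat \<sigma> M2 y t = (1 / real n) *\<^sub>R w n (y, t)"
  shows "natg_x \<sigma> (concat (replicate n [M1, M2])) h t x =
    snd (snd (((\<lambda>z. z + (1 / real n) *\<^sub>R split_field v w n z) ^^ n) (h, t, x)))"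
proof -
  define f where "f = fold (\<lambda>md z. apply_gmod \<sigma> (2 * n) md h z) [M1, M2]"
  have len: "length (concat (replicate n [M1, M2])) = 2 * n" by (simp add: length_concat sum_list_replicate)
  have "((\<lambda>z. z + (1 / real n) *\<^sub>R split_field v w n z) ^^ k) (h, z) = (h, (f ^^ k) z)" for k z
  proof (induction k)
    case (Suc k)
    then show ?case using split_step_eq_modules[where v = v and w = w, OF assms, of h "(f ^^ k) z", folded f_def] by simp
  qed simp
  then show ?thesis unfolding natg_x_def natg_def len fold_concat_replicate f_def[symmetric] by simp
qed

text \<open>The arguments of \<open>w\<close> differ from (p, t) by terms that vanish like 1/n.
  Continuous convergence of \<open>w\<close> tolerates such moving arguments, so the limit is the
  unperturbed field.\<close>

lemma split_field_Ck:
  fixes v w :: "nat \<Rightarrow> (real^'d::finite) \<times> real \<Rightarrow> real^'d"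
  assumes v: "Ck_conv_on r (Uq \<times> UNIV) v" "open Uq" "\<And>y t. y \<in> Uq \<Longrightarrow> (\<lambda>n. v n (y, t)) \<longlonglongrightarrow> gv y t"
    and w: "Ck_conv_on r (Up \<times> UNIV) w" "open Up" "\<And>y t. y \<in> Up \<Longrightarrow> (\<lambda>n. w n (y, t)) \<longlonglongrightarrow> gw y t"
  shows "Ck_conv_on r (UNIV \<times> UNIV \<times> (Up \<times> Uq)) (split_field v w)"
    "\<And>h t p q. p \<in> Up \<Longrightarrow> q \<in> Uq \<Longrightarrow>
      (\<lambda>n. split_field v w n (h, t, (p, q))) \<longlonglongrightarrow> (0, h, (- (h *\<^sub>R gv q t), h *\<^sub>R gw p t))"
proof -
  let ?\<Omega> = "UNIV \<times> UNIV \<times> (Up \<times> Uq) :: (real \<times> real \<times> 'd phase) set"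
  let ?h = "\<lambda>z::real \<times> real \<times> 'd phase. fst z" and ?t = "\<lambda>z::real \<times> real \<times> 'd phase. fst (snd z)"
    and ?p = "\<lambda>z::real \<times> real \<times> 'd phase. fst (snd (snd z))" and ?q = "\<lambda>z::real \<times> real \<times> 'd phase. snd (snd (snd z))"
  have oU: "open (Up \<times> (UNIV :: real set))" "open (Uq \<times> (UNIV :: real set))" using v(2) w(2) by (auto simp: open_Times)
  define Y where "Y n z = (?p z - (?h z * (1 / real n)) *\<^sub>R v n (?q z, ?t z), ?t z + ?h z * (1 / 2 * (1 / real n)))" for n z
  have S: "split_field v w n z = (0, ?h z, (- (?h z *\<^sub>R v n (?q z, ?t z)), ?h z *\<^sub>R w n (Y n z)))" for n z
    by (simp add: split_field_def Y_def case_prod_unfold)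
  note id = Ck_conv_on_ident[of r ?\<Omega>, unfolded Ck_conv_on_def]
  note lin = Ck_conv_linear[OF bounded_linear_fst] Ck_conv_linear[OF bounded_linear_snd]
  note ix = Ck_conv_on_index[OF lim_1_over_n[where ?'a = real], of r ?\<Omega>, unfolded Ck_conv_on_def]
  have cv: "Ck_conv_on r ?\<Omega> (\<lambda>n z. v n (?q z, ?t z))"
  proof (rule Ck_conv_on_compose[OF v(1) _ oU(2)])
    show "Ck_conv_on r ?\<Omega> (\<lambda>n z. (?q z, ?t z))" unfolding Ck_conv_on_def by (intro Ck_conv_Pair lin id)
    show "\<exists>y\<in>Uq \<times> UNIV. (\<lambda>n. (?q z, ?t z)) \<longlonglongrightarrow> y" if "z \<in> ?\<Omega>" for z
      by (rule bexI[of _ "(?q z, ?t z)"]) (use that in auto)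
  qed
  have cY: "Ck_conv_on r ?\<Omega> Y" unfolding Y_def[abs_def] Ck_conv_on_def
    by (intro Ck_conv_Pair Ck_conv_diff Ck_conv_add Ck_conv_scaleR Ck_conv_mult Ck_conv_const lin id ix cv[unfolded Ck_conv_on_def])
  have Ylim: "(\<lambda>n. Y n z) \<longlonglongrightarrow> (?p z, ?t z)" if z: "z \<in> ?\<Omega>" for z
  proof -
    have "?q z \<in> Uq" using z by auto
    then have "(\<lambda>n. Y n z) \<longlonglongrightarrow> (?p z - (?h z * 0) *\<^sub>R gv (?q z) (?t z), ?t z + ?h z * (1 / 2 * 0))"
      unfolding Y_def by (intro tendsto_intros v(3) lim_1_over_n)
    then show ?thesis by simp
  qed
  have cw: "Ck_conv_on r ?\<Omega> (\<lambda>n z. w n (Y n z))"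
    by (rule Ck_conv_on_compose[OF w(1) cY oU(1)]) (use Ylim in force)
  show "Ck_conv_on r ?\<Omega> (split_field v w)"
    unfolding S[abs_def] Ck_conv_on_def
    by (intro Ck_conv_Pair Ck_conv_const Ck_conv_scaleR lin id cv[unfolded Ck_conv_on_def] cw[unfolded Ck_conv_on_def]
        Ck_conv_linear[OF bounded_linear_minus[OF bounded_linear_ident]])
  fix h t p q assume pq: "p \<in> Up" "q \<in> Uq"
  let ?z = "(h, t, (p, q)) :: real \<times> real \<times> 'd phase"
  have pt: "(p, t) \<in> Up \<times> UNIV" using pq by simp
  have "((\<lambda>(n, y). w n y) \<longlongrightarrow> gw p t) (sequentially \<times>\<^sub>F nhds (p, t))"
    using Ck_conv_on_tendsto[OF w(1) w(3)[OF pq(1)] pt] nhds_inf_principal_open[OF oU(1) pt] by simp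
  moreover have "filterlim (\<lambda>n. (n, Y n ?z)) (sequentially \<times>\<^sub>F nhds (p, t)) sequentially"
    using Ylim[of ?z] pq by (intro filterlim_Pair filterlim_ident) auto
  ultimately have wl: "(\<lambda>n. w n (Y n ?z)) \<longlonglongrightarrow> gw p t" using filterlim_compose by fastforce
  show "(\<lambda>n. split_field v w n ?z) \<longlonglongrightarrow> (0, h, (- (h *\<^sub>R gv q t), h *\<^sub>R gw p t))"
    unfolding S fst_conv snd_conv by (intro tendsto_Pair tendsto_const tendsto_minus tendsto_scaleR v(3) pq wl)
qed

theorem theorem4p6:
  fixes r :: nat
    and \<sigma> :: "real \<Rightarrow> real"
    and Up Uq :: "(real^'d) set"
    and K V :: "real^'d \<Rightarrow> real \<Rightarrow> real"
    and \<Phi> :: "real \<Rightarrow> real \<Rightarrow> 'd phase \<Rightarrow> 'd phase"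
    and T \<epsilon> :: real
    and Wt :: "real set"
    and W :: "'d phase set"
  assumes sigma_Cr: "Ck_on r UNIV \<sigma>"
    and sigma_rfin: "r_finite r \<sigma>"
    and open_Up: "open Up" and open_Uq: "open Uq"
    and K_smooth: "Ck_on (Suc r) (Up \<times> UNIV) (\<lambda>(p, t). K p t)"
    and V_smooth: "Ck_on (Suc r) (Uq \<times> UNIV) (\<lambda>(q, t). V q t)"
    and Phi_sol: "\<And>t0 x0. t0 \<ge> 0 \<Longrightarrow> x0 \<in> Up \<times> Uq \<Longrightarrow>
                    ham_sol K V (Up \<times> Uq) t0 x0 (\<lambda>h. \<Phi> h t0 x0)"
    and sol_unique: "\<And>t0 x0 \<gamma> h. t0 \<ge> 0 \<Longrightarrow> x0 \<in> Up \<times> Uq \<Longrightarrow>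
                    ham_sol K V (Up \<times> Uq) t0 x0 \<gamma> \<Longrightarrow> h \<ge> 0 \<Longrightarrow> \<gamma> h = \<Phi> h t0 x0"
    and T_pos: "T > 0"
    and Wt_compact: "compact Wt" and Wt_nonneg: "Wt \<subseteq> {0..}"
    and W_compact: "compact W" and W_sub: "W \<subseteq> Up \<times> Uq"
    and eps_pos: "\<epsilon> > 0"
  shows "\<exists>mods :: 'd gmod list. mods \<noteq> [] \<and>
           cr_norm r ({0..} \<times> {0..} \<times> (Up \<times> Uq)) ({0..T} \<times> Wt \<times> W)
             (\<lambda>(h, t, x). \<Phi> h t x - natg_x \<sigma> mods h t x) < \<epsilon>"
proof -
  define gv where "gv q t = grad (\<lambda>q. V q t) q" for q t
  define gk where "gk p t = grad (\<lambda>p. K p t) p" for p t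
  obtain MV v where MV: "\<And>n up s. gmod_is_upper (MV n up s) = up"
    "\<And>n up s y t. sigma_hat \<sigma> (MV n up s) y t = s *\<^sub>R v n (y, t)" and
    v: "Ck_conv_on r (Uq \<times> UNIV) v" "\<And>y t. y \<in> Uq \<Longrightarrow> (\<lambda>n. v n (y, t)) \<longlonglongrightarrow> gv y t"
    unfolding gv_def using gradient_module_approximation[OF sigma_Cr sigma_rfin open_Uq V_smooth] by blast
  obtain MK w where MK: "\<And>n up s. gmod_is_upper (MK n up s) = up"
    "\<And>n up s y t. sigma_hat \<sigma> (MK n up s) y t = s *\<^sub>R w n (y, t)" and
    w: "Ck_conv_on r (Up \<times> UNIV) w" "\<And>y t. y \<in> Up \<Longrightarrow> (\<lambda>n. w n (y, t)) \<longlonglongrightarrow> gk y t"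
    unfolding gk_def using gradient_module_approximation[OF sigma_Cr sigma_rfin open_Up K_smooth] by blast
  let ?U = "Up \<times> Uq"
  define \<Omega> where "\<Omega> = (UNIV \<times> UNIV \<times> ?U :: (real \<times> real \<times> 'd phase) set)"
  define D where "D = ({0..} \<times> {0..} \<times> ?U :: (real \<times> real \<times> 'd phase) set)"
  define G where "G z = (0 :: real, fst z, (- (fst z *\<^sub>R gv (snd (snd (snd z))) (fst (snd z))),
      fst z *\<^sub>R gk (fst (snd (snd z))) (fst (snd z))))" for z :: "real \<times> real \<times> 'd phase"
  define S where "S = split_field v w"
  define E where "E p z = ((\<lambda>z. z + (1 / real (fst p)) *\<^sub>R S (fst p) z) ^^ snd p) z" for p :: "nat \<times> nat" and z
  have \<Omega>: "open \<Omega>" unfolding \<Omega>_def using open_Up open_Uq by (intro open_Times open_UNIV)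
  have S: "Ck_conv_on r \<Omega> S"
    unfolding S_def \<Omega>_def by (rule split_field_Ck(1)[OF v(1) open_Uq v(2) w(1) open_Up w(2)])
  have Slim: "(\<lambda>n. S n z) \<longlonglongrightarrow> G z" if z: "z \<in> \<Omega>" for z
  proof -
    obtain h t p q where zz: "z = (h, t, (p, q))" by (metis surj_pair)
    show ?thesis unfolding S_def zz G_def fst_conv snd_conv
      by (rule split_field_Ck(2)[OF v(1) open_Uq v(2) w(1) open_Up w(2)]) (use z in \<open>auto simp: \<Omega>_def zz\<close>)
  qed
  have field: "symplJ_inv (grad (\<lambda>y. Ham K V y t) x) = (- gv (snd x) t, gk (fst x) t)" if x: "x \<in> ?U" for x t
  proof -
    obtain p q where pq: "x = (p, q)" by (cases x)
    have "grad (\<lambda>y. Ham K V y t) (p, q) = (gk p t, gv q t)" unfolding gk_def gv_def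
      by (rule grad_Ham) (use x pq Ck_on_slice_differentiable[OF K_smooth open_Up] Ck_on_slice_differentiable[OF V_smooth open_Uq] in auto)
    then show ?thesis by (simp add: pq symplJ_inv_def)
  qed
  \<comment> \<open>The candidate trajectory: the flow traversed at speed h in the rescaled time s,
    which reaches \<open>\<Phi> h t x\<close> in its phase-space component at s = 1.\<close>
  define Z where "Z z s = (fst z, fst (snd z) + s * fst z, \<Phi> (s * fst z) (fst (snd z)) (snd (snd z)))"
    for z :: "real \<times> real \<times> 'd phase" and s
  have Dh: "fst z \<ge> 0" "fst (snd z) \<ge> 0" "snd (snd z) \<in> ?U" if "z \<in> D" for z using that by (auto simp: D_def)
  have Z\<Omega>: "Z z s \<in> \<Omega>" if z: "z \<in> D" and s: "0 \<le> s" for z s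
    using Phi_sol[OF Dh(2,3)[OF z]] Dh(1)[OF z] s by (simp add: ham_sol_def Z_def \<Omega>_def)
  have Zc: "continuous_on {0..1} (Z z)" if z: "z \<in> D" for z
  proof -
    have "continuous_on {0..} (\<lambda>u. \<Phi> u (fst (snd z)) (snd (snd z)))"
      by (rule continuous_on_vector_derivative) (use Phi_sol[OF Dh(2,3)[OF z]] in \<open>auto simp: ham_sol_def\<close>)
    then have "continuous_on {0..1} (\<lambda>s. \<Phi> (s * fst z) (fst (snd z)) (snd (snd z)))"
      by (rule continuous_on_compose2) (use Dh(1)[OF z] in \<open>auto intro!: continuous_intros\<close>)
    then show ?thesis unfolding Z_def by (intro continuous_intros)
  qed
  have Z0: "Z z 0 = z" if z: "z \<in> D" for z
    using Phi_sol[OF Dh(2,3)[OF z]] by (simp add: ham_sol_def Z_def)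
  \<comment> \<open>A solution of the extended equation has constant h and affine t. This reduces
    uniqueness to the Hamiltonian equation traversed at speed h.\<close>
  have uniq: "X a = Z z a" if z: "z \<in> D" and a: "0 \<le> a" "a \<le> 1" and X0: "X 0 = z" and X\<Omega>: "\<And>s. 0 \<le> s \<Longrightarrow> s \<le> a \<Longrightarrow> X s \<in> \<Omega>"
    and X': "\<And>s. 0 \<le> s \<Longrightarrow> s \<le> a \<Longrightarrow> (X has_vector_derivative G (X s)) (at s within {0..a})" for z X a
  proof -
    let ?h = "fst z" and ?t = "fst (snd z)" and ?x = "snd (snd z)"
    have d1: "((\<lambda>s. fst (X s)) has_vector_derivative 0) (at s within {0..a})" if "s \<in> {0..a}" for s
      using bounded_linear.has_vector_derivative[OF bounded_linear_fst X'[of s]] that by (simp add: G_def)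
    obtain c where c: "\<And>s. s \<in> {0..a} \<Longrightarrow> fst (X s) = c"
      by (rule has_vector_derivative_zero_constant[OF convex_real_interval(5) d1]) auto
    have h: "fst (X s) = ?h" if "s \<in> {0..a}" for s using c[OF that] c[of 0] a X0 by simp
    have "((\<lambda>s. fst (snd (X s)) - s * ?h) has_vector_derivative ?h - ?h) (at s within {0..a})" if s: "s \<in> {0..a}" for s
    proof (rule has_vector_derivative_diff)
      show "((\<lambda>s. fst (snd (X s))) has_vector_derivative ?h) (at s within {0..a})"
        using bounded_linear.has_vector_derivative[OF bounded_linear_compose[OF bounded_linear_fst bounded_linear_snd] X'[of s]] s h[OF s]
        by (simp add: G_def)
      show "((\<lambda>s. s * ?h) has_vector_derivative ?h) (at s within {0..a})"
        by (auto intro!: derivative_eq_intros simp: has_real_derivative_iff_has_vector_derivative[symmetric])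
    qed
    then have d2: "((\<lambda>s. fst (snd (X s)) - s * ?h) has_vector_derivative 0) (at s within {0..a})" if "s \<in> {0..a}" for s
      using that by simp
    obtain c' where c': "\<And>s. s \<in> {0..a} \<Longrightarrow> fst (snd (X s)) - s * ?h = c'"
      by (rule has_vector_derivative_zero_constant[OF convex_real_interval(5) d2]) auto
    have t: "fst (snd (X s)) = ?t + s * ?h" if "s \<in> {0..a}" for s using c'[OF that] c'[of 0] a X0 by simp
    have XU: "snd (snd (X s)) \<in> ?U" if "s \<in> {0..a}" for s using X\<Omega>[of s] that by (auto simp: \<Omega>_def)
    have x': "((\<lambda>s. snd (snd (X s))) has_vector_derivative
       ?h *\<^sub>R symplJ_inv (grad (\<lambda>y. Ham K V y (?t + s * ?h)) (snd (snd (X s))))) (at s within {0..a})" if s: "s \<in> {0..a}" for s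
      using bounded_linear.has_vector_derivative[OF bounded_linear_compose[OF bounded_linear_snd bounded_linear_snd] X'[of s]] s
      by (simp add: G_def h t field[OF XU[OF s]])
    have "snd (snd (X a)) = \<Phi> (a * ?h) ?t ?x"
    \<comment> \<open>Undoing the time scaling divides by h; for h = 0 the phase-space component is
      constant and no rescaling is possible.\<close>
    proof (cases "?h = 0")
      case True
      have d3: "((\<lambda>s. snd (snd (X s))) has_vector_derivative 0) (at s within {0..a})" if "s \<in> {0..a}" for s
        using x'[OF that] True by simp
      obtain c where c: "\<And>s. s \<in> {0..a} \<Longrightarrow> snd (snd (X s)) = c"
        by (rule has_vector_derivative_zero_constant[OF convex_real_interval(5) d3]) auto
      have "snd (snd (X a)) = ?x" using c[of a] c[of 0] a X0 by simp
      moreover have "\<Phi> 0 ?t ?x = ?x" using Phi_sol[OF Dh(2,3)[OF z]] by (simp add: ham_sol_def)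
      ultimately show ?thesis using True by simp
    next
      case False
      then have h0: "?h > 0" using Dh(1)[OF z] by simp
      define \<gamma> where "\<gamma> u = snd (snd (X (u / ?h)))" for u
      have mem: "u / ?h \<in> {0..a}" if "0 \<le> u" "u \<le> a * ?h" for u using that h0 by (simp add: field_simps)
      have "\<gamma> (a * ?h) = \<Phi> (a * ?h) ?t (\<gamma> 0)"
      proof (rule ham_sol_local_unique[where U = "?U" and \<Phi> = \<Phi> and K = K and V = V and \<gamma> = \<gamma> and ?t0.0 = "?t"])
        show "ham_sol K V ?U t0 x0 (\<lambda>h. \<Phi> h t0 x0)" if "t0 \<ge> 0" "x0 \<in> ?U" for t0 x0 by (rule Phi_sol[OF that])
        show "\<gamma>' k = \<Phi> k t0 x0" if "t0 \<ge> 0" "x0 \<in> ?U" "ham_sol K V ?U t0 x0 \<gamma>'" "k \<ge> 0" for t0 x0 \<gamma>' k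
          by (rule sol_unique[OF that])
        show "0 \<le> ?t" by (rule Dh(2)[OF z])
        show "0 \<le> a * ?h" using a h0 by simp
        show "\<gamma> u \<in> ?U" if "0 \<le> u" "u \<le> a * ?h" for u unfolding \<gamma>_def by (rule XU[OF mem[OF that]])
        fix u assume u: "0 \<le> u" "u \<le> a * ?h"
        let ?F = "symplJ_inv (grad (\<lambda>y. Ham K V y (?t + u)) (\<gamma> u))"
        have "((\<lambda>s. snd (snd (X s))) has_vector_derivative ?h *\<^sub>R ?F) (at (u / ?h) within {0..a})"
          using x'[OF mem[OF u]] h0 by (simp add: \<gamma>_def)
        then have "((\<lambda>s. snd (snd (X s))) has_vector_derivative ?h *\<^sub>R ?F) (at (u / ?h) within (\<lambda>u. u / ?h) ` {0..a * ?h})"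
          by (rule has_vector_derivative_within_subset) (use mem in auto)
        moreover have "((\<lambda>u. u / ?h) has_vector_derivative (1 / ?h)) (at u within {0..a * ?h})"
          using h0 by (auto intro!: derivative_eq_intros simp: has_real_derivative_iff_has_vector_derivative[symmetric])
        ultimately have "((\<lambda>s. snd (snd (X s))) \<circ> (\<lambda>u. u / ?h) has_vector_derivative (1 / ?h) *\<^sub>R (?h *\<^sub>R ?F)) (at u within {0..a * ?h})"
          by (intro vector_diff_chain_within)
        then show "(\<gamma> has_vector_derivative ?F) (at u within {0..a * ?h})"
          using h0 by (simp add: o_def \<gamma>_def[abs_def])
      qed
      then show ?thesis using h0 X0 by (simp add: \<gamma>_def)
    qed
    then show ?thesis using h[of a] t[of a] a by (simp add: Z_def prod_eq_iff)
  qed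
  have E0: "E (n, 0) z = z" and ES: "E (n, Suc k) z = E (n, k) z + (1 / real n) *\<^sub>R S n (E (n, k) z)" for n k z
    by (simp_all add: E_def)
  have S0: "Ck_conv_on 0 \<Omega> S" using S unfolding Ck_conv_on_def by (rule Ck_conv_le[OF le0])
  have Elim: "((\<lambda>(p, z). E p z) \<longlongrightarrow> Z z s) (grid_filter D s z)" if s: "0 \<le> s" "s \<le> 1" and z: "z \<in> D" for s z
  proof (rule euler_grid_tendsto[where Z = "Z z" and G = G and E = E and S = S, OF \<Omega> S0 Slim _ Zc[OF z] Z0[OF z] _ E0 ES s])
    show "Z z u \<in> \<Omega>" if "0 \<le> u" "u \<le> 1" for u by (rule Z\<Omega>[OF z that(1)])
    show "X a = Z z a" if "0 \<le> a" "a \<le> 1" "X 0 = z" "\<And>u. 0 \<le> u \<Longrightarrow> u \<le> a \<Longrightarrow> X u \<in> \<Omega>"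
      "\<And>u. 0 \<le> u \<Longrightarrow> u \<le> a \<Longrightarrow> (X has_vector_derivative G (X u)) (at u within {0..a})" for X a
      using uniq[of z a X] z that by blast
  qed
  have "Ck_conv r (grid_filters D) E"
    by (rule euler_grid_Ck[OF \<Omega> S _ E0 ES]) (use Elim Z\<Omega> in blast)
  from Ck_conv_on_diagonal[OF this] have EC: "Ck_conv_on r D (\<lambda>n. E (n, n))" .
  define Y where "Y n z = snd (snd (E (n, n) z))" for n z
  define f where "f = (\<lambda>(h, t, x). \<Phi> h t x)"
  have YC: "Ck_conv_on r D Y" using EC unfolding Y_def[abs_def] Ck_conv_on_def
    by (intro Ck_conv_linear[OF bounded_linear_snd])
  have Ylim: "(\<lambda>n. Y n z) \<longlonglongrightarrow> f z" if z: "z \<in> D" for z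
  proof -
    have "filterlim (\<lambda>n. (n, z)) (sequentially \<times>\<^sub>F inf (nhds z) (principal D)) sequentially"
      by (intro filterlim_Pair filterlim_ident) (auto simp: filterlim_inf filterlim_principal z)
    from filterlim_compose[OF filterlim_grid_diagonal this]
    have "filterlim (\<lambda>n. ((n, n), z)) (grid_filter D 1 z) sequentially" by simp
    from filterlim_compose[OF Elim[of 1, OF _ _ z] this]
    have "(\<lambda>n. E (n, n) z) \<longlonglongrightarrow> Z z 1" by simp
    from tendsto_snd[OF tendsto_snd[OF this]] show ?thesis by (simp add: Y_def Z_def f_def case_prod_unfold)
  qed
  \<comment> \<open>The faces h = 0 and t = 0 belong to \<open>D\<close>, so \<open>D\<close> is in
    general not open. Nonnegative steps along basis vectors keep h and t nonnegative, and the open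
    condition on the phase variables is taken from \<open>\<Omega>\<close>.\<close>
  have quad: "open_in_quadrant D"
    unfolding open_in_quadrant_def
  proof (intro exI conjI)
    show "D = ({0..} \<times> {0..} \<times> UNIV) \<inter> \<Omega>" by (auto simp: D_def \<Omega>_def)
    show "convex ({0..} \<times> {0..} \<times> UNIV :: (real \<times> real \<times> 'd phase) set)"
      by (intro convex_Times convex_UNIV convex_real_interval)
    show "open \<Omega>" by (rule \<Omega>)
    have "fst b \<ge> 0 \<and> fst (snd b) \<ge> 0" if "b \<in> Basis" for b :: "real \<times> real \<times> 'd phase"
      using that by (auto simp: Basis_prod_def)
    then show "\<forall>w\<in>{0..} \<times> {0..} \<times> UNIV. \<forall>b\<in>Basis. \<forall>d\<ge>0. w + d *\<^sub>R b \<in> ({0..} \<times> {0..} \<times> UNIV :: (real \<times> real \<times> 'd phase) set)"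
      by (auto simp: mem_Times_iff)
  qed
  let ?W = "{0..T} \<times> Wt \<times> W"
  have W: "compact ?W" "?W \<subseteq> D"
    using Wt_compact W_compact Wt_nonneg W_sub by (auto simp: D_def intro!: compact_Times)
  obtain \<delta> where \<delta>: "\<delta> > 0" "\<And>F :: real \<times> real \<times> 'd phase \<Rightarrow> 'd phase.
     (\<And>L z. set L \<subseteq> Basis \<Longrightarrow> length L \<le> r \<Longrightarrow> z \<in> ?W \<Longrightarrow> norm (pdl D L F z) < \<delta>) \<Longrightarrow> cr_norm r D ?W F < \<epsilon>"
    using cr_norm_less[OF eps_pos, of r ?W D] by blast
  have "\<forall>\<^sub>F n in sequentially. \<forall>L\<in>{L. set L \<subseteq> Basis \<and> length L \<le> r}. \<forall>z\<in>?W. dist (pdl UNIV L (Y n) z) (pdl D L f z) < \<delta>"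
    by (intro eventually_ball_finite finite_lists_length_le finite_Basis ballI
        Ck_conv_on_pdl_uniform[OF YC quad Ylim W \<delta>(1)]) auto
  from eventually_conj[OF this eventually_gt_at_top[of 0]]
  obtain n where n: "n > 0" and near: "\<And>L z. set L \<subseteq> Basis \<Longrightarrow> length L \<le> r \<Longrightarrow> z \<in> ?W \<Longrightarrow>
      dist (pdl UNIV L (Y n) z) (pdl D L f z) < \<delta>"
    unfolding eventually_sequentially by blast
  \<comment> \<open>In each pair the upper module moves p along minus the gradient of
    \<open>V\<close>, and the lower module then moves q along the gradient of
    \<open>K\<close>.\<close>
  define mods where "mods = concat (replicate n [MV n True (- 1 / real n), MK n False (1 / real n)])"
  have "mods \<noteq> []" using n by (cases n) (auto simp: mods_def)
  moreover have "natg_x \<sigma> mods h t x = Y n (h, t, x)" for h t x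
    unfolding mods_def Y_def E_def S_def fst_conv snd_conv
    by (rule natg_eq_split_iterate[OF n]) (auto simp: MV MK)
  then have "(\<lambda>(h, t, x). \<Phi> h t x - natg_x \<sigma> mods h t x) = (\<lambda>z. f z - Y n z)"
    by (auto simp: f_def)
  moreover have "cr_norm r D ?W (\<lambda>z. f z - Y n z) < \<epsilon>"
  proof (rule \<delta>(2))
    fix L :: "(real \<times> real \<times> 'd phase) list" and z
    assume L: "set L \<subseteq> Basis" "length L \<le> r" and z: "z \<in> ?W"
    have "z \<in> D" using z W by blast
    then show "norm (pdl D L (\<lambda>z. f z - Y n z) z) < \<delta>"
      using Ck_conv_on_pdl_diff[OF YC quad Ylim L, of z n] near[OF L z] by (simp add: dist_norm norm_minus_commute)
  qed
  ultimately show ?thesis unfolding D_def by (intro exI[of _ mods]) simp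
qed

end
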